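(* Let $\mathcal P_J\subset\mathcal F_n^\infty$ be a set of noncommutative polynomials generating a WOT-closed two-sided ideal $J\ne\mathcal F_n^\infty$. Let $\mathcal H=\mathcal H_1\oplus\mathcal H_0\oplus\mathcal H_{-1}$ be Hilbert spaces and let $T=(T_1,\ldots,T_n)$ be operators on $\mathcal H$ of the form $$T_i=\begin{bmatrix}S_i&*&*\\0&N_i&*\\0&0&C_i\end{bmatrix}\qquad(i=1,\ldots,n).$$ If $T$ is a $J$-constrained row contraction, then $S$, $N$ and $C$ are also $J$-constrained row contractions on $\mathcal H_1$, $\mathcal H_0$ and $\mathcal H_{-1}$, respectively, and there exist Hilbert spaces $\mathcal E_1,\mathcal E_2,\mathcal E$ and unitary operators $\tau_1\in\mathcal B(\mathcal D_{N^*}\oplus\mathcal E,\mathcal D_C\oplus\mathcal E_1)$ and $\tau_2\in\mathcal B(\mathcal D_{S^*}\oplus\mathcal E_2,\mathcal D_N\oplus\mathcal E)$ such that the constrained characteristic function $\Theta_{J,T}$ coincides with $$\begin{bmatrix}\Theta_{J,C}&0\\0&I_{\mathcal N_J\otimes\mathcal E_1}\end{bmatrix}(I_{\mathcal N_J}\otimes\tau_1)\begin{bmatrix}\Theta_{J,N}&0\\0&I_{\mathcal N_J\otimes\mathcal E}\end{bmatrix}(I_{\mathcal N_J}\otimes\tau_2)\begin{bmatrix}\Theta_{J,S}&0\\0&I_{\mathcal N_J\otimes\mathcal E_2}\end{bmatrix}.$$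
   Context: $\Gamma=\bigoplus_{m\ge0}(\mathbb C^n)^{\otimes m}$ is the full Fock space. With $e_1,\ldots,e_n$ the standard basis of $\mathbb C^n$, the left and right creation operators on $\Gamma$ are $L_jf=e_j\otimes f$ and $R_jf=f\otimes e_j$. $\mathcal F_n^\infty$ is the WOT-closed algebra generated by $I_\Gamma,L_1,\ldots,L_n$; a noncommutative polynomial in $\mathcal F_n^\infty$ is a polynomial $p=p(L_1,\ldots,L_n)$. Given $J$, put $\mathcal M_J=\overline{\mathrm{span}}\{\phi\psi:\phi\in J,\psi\in\Gamma\}$ and $\mathcal N_J=\Gamma\ominus\mathcal M_J$. A row contraction on $\mathcal H$ is an $n$-tuple $T=(T_1,\ldots,T_n)$ of bounded operators with $\sum_iT_iT_i^*\le I$; $T$ also denotes the row operator $\mathcal H^n\to\mathcal H$. It is $J$-constrained if $p(T_1,\ldots,T_n)=0$ for all $p\in\mathcal P_J$. Defect operators: $D_T=(I-T^*T)^{1/2}$ on $\mathcal H^n$, $D_{T^*}=(I-TT^* )^{1/2}$ on $\mathcal H$; $\mathcal D_T=\overline{\mathrm{ran}}\,D_T$, $\mathcal D_{T^*}=\overline{\mathrm{ran}}\,D_{T^*}$. The characteristic function of $T$ is the operator $\Theta_T\in\mathcal B(\Gamma\otimes\mathcal D_T,\Gamma\otimes\mathcal D_{T^*})$ given by $$\Theta_T=\text{SOT-}\lim_{r\to1^-}\Big[-I_\Gamma\otimes T+(I_\Gamma\otimes D_{T^*})\Big(I_{\Gamma\otimes\mathcal H}-r\sum_{i=1}^nR_i\otimes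 T_i^*\Big)^{-1}r\tilde R\,(I_\Gamma\otimes D_T)\Big]\Big|_{\Gamma\otimes\mathcal D_T},$$ where $\tilde R=(R_1\otimes I_{\mathcal H},\ldots,R_n\otimes I_{\mathcal H}):(\Gamma\otimes\mathcal H)^n\to\Gamma\otimes\mathcal H$ and $\Gamma\otimes\mathcal H^n$ is identified with $(\Gamma\otimes\mathcal H)^n$. The constrained characteristic function of a $J$-constrained row contraction $T$ is $$\Theta_{J,T}=P_{\mathcal N_J\otimes\mathcal D_{T^*}}\Theta_T|_{\mathcal N_J\otimes\mathcal D_T}\in\mathcal B(\mathcal N_J\otimes\mathcal D_T,\mathcal N_J\otimes\mathcal D_{T^*}).$$ Operators $M\in\mathcal B(\mathcal N_J\otimes\mathcal E,\mathcal N_J\otimes\mathcal E_* )$ and $M'\in\mathcal B(\mathcal N_J\otimes\mathcal E',\mathcal N_J\otimes\mathcal E_*')$ coincide if there are unitaries $W:\mathcal E\to\mathcal E'$, $W_*:\mathcal E_*\to\mathcal E'_*$ with $(I_{\mathcal N_J}\otimes W_* )M=M'(I_{\mathcal N_J}\otimes W)$. *)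

theory Defs
  imports "HOL-Analysis.Analysis" "HOL-Library.Poly_Mapping"
begin

section \<open>Complex Hilbert spaces\<close>

text \<open>The real structure (norm, topology, real inner product) is the one of the library class
  \<open>real_inner\<close>; the real inner product is the real part of the complex one. Hilbert spaces
  are not assumed separable, and the zero space is allowed.\<close>

class complex_vector = real_vector +
  fixes scaleC :: "complex \<Rightarrow> 'a \<Rightarrow> 'a"  (infixr "*\<^sub>C" 75)
  assumes scaleC_add_right: "c *\<^sub>C (x + y) = c *\<^sub>C x + c *\<^sub>C y"
    and scaleC_add_left: "(c + d) *\<^sub>C x = c *\<^sub>C x + d *\<^sub>C x"
    and scaleC_scaleC: "c *\<^sub>C d *\<^sub>C x = (c * d) *\<^sub>C x"
    and scaleC_one: "1 *\<^sub>C x = x"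
    and scaleR_scaleC: "r *\<^sub>R x = complex_of_real r *\<^sub>C x"

class complex_inner = complex_vector + real_inner +
  fixes cinner :: "'a \<Rightarrow> 'a \<Rightarrow> complex"
  assumes cinner_commute: "cinner x y = cnj (cinner y x)"
    and cinner_add_left: "cinner (x + y) z = cinner x z + cinner y z"
    and cinner_scaleC_left: "cinner (c *\<^sub>C x) y = c * cinner x y"
    and inner_cinner: "inner x y = Re (cinner x y)"

class chilbert_space = complex_inner + complete_space

global_interpretation complex_vector: vector_space "scaleC :: complex \<Rightarrow> 'a \<Rightarrow> 'a::complex_vector"
  defines csubspace_raw_def: csubspace = complex_vector.subspace
    and cspan_raw_def: cspan = complex_vector.span
  by unfold_locales (rule scaleC_add_right scaleC_add_left scaleC_scaleC scaleC_one)+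

lemma cinner_add_right: "cinner x (y + z) = cinner x y + cinner (x::'a::complex_inner) z"
  by (metis cinner_add_left cinner_commute complex_cnj_add)

lemma cinner_scaleC_right: "cinner x (c *\<^sub>C y) = cnj c * cinner (x::'a::complex_inner) y"
  by (metis cinner_scaleC_left cinner_commute complex_cnj_mult)

lemma norm_scaleC: "norm (c *\<^sub>C x) = norm c * norm (x::'a::complex_inner)"
proof -
  have "cinner (c *\<^sub>C x) (c *\<^sub>C x) = complex_of_real ((cmod c)\<^sup>2) * cinner x x"
    unfolding complex_norm_square by (simp add: cinner_scaleC_left cinner_scaleC_right)
  then have "inner (c *\<^sub>C x) (c *\<^sub>C x) = (cmod c)\<^sup>2 * inner x x"
    by (simp add: inner_cinner)
  then show ?thesis
    by (simp add: norm_eq_sqrt_inner real_sqrt_mult)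
qed

lemma norm_cinner_le: "norm (cinner x y) \<le> norm x * norm (y::'a::complex_inner)"
proof (cases "cinner x y = 0")
  case False
  define c where "c = cnj (cinner x y) / of_real (cmod (cinner x y))"
  have "c * cinner x y = of_real (cmod (cinner x y))"
    using False complex_norm_square[of "cinner x y"]
    by (simp add: c_def field_simps power2_eq_square)
  then have "cmod (cinner x y) = inner (c *\<^sub>C x) y"
    by (simp add: inner_cinner cinner_scaleC_left)
  also have "\<dots> \<le> norm (c *\<^sub>C x) * norm y"
    by (rule norm_cauchy_schwarz)
  also have "norm (c *\<^sub>C x) = norm x"
    using False by (simp add: norm_scaleC c_def norm_divide)
  finally show ?thesis .
qed simp

instantiation complex :: chilbert_space
begin
definition scaleC_complex :: "complex \<Rightarrow> complex \<Rightarrow> complex" where "scaleC_complex = (*)"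
definition cinner_complex :: "complex \<Rightarrow> complex \<Rightarrow> complex" where "cinner_complex x y = x * cnj y"
instance
  by intro_classes
    (auto simp: scaleC_complex_def cinner_complex_def algebra_simps scaleR_conv_of_real
      inner_complex_def)
end

instantiation prod :: (complex_vector, complex_vector) complex_vector
begin
definition scaleC_prod :: "complex \<Rightarrow> 'a \<times> 'b \<Rightarrow> 'a \<times> 'b"
  where "scaleC_prod c x = (c *\<^sub>C fst x, c *\<^sub>C snd x)"
instance
  by intro_classes
    (auto simp: scaleC_prod_def prod_eq_iff scaleC_add_right scaleC_add_left scaleC_scaleC
      scaleC_one scaleR_scaleC)
end

instantiation prod :: (complex_inner, complex_inner) complex_inner
begin
definition cinner_prod :: "'a \<times> 'b \<Rightarrow> 'a \<times> 'b \<Rightarrow> complex"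
  where "cinner_prod x y = cinner (fst x) (fst y) + cinner (snd x) (snd y)"
instance
proof
  fix x y :: "'a \<times> 'b"
  show "cinner x y = cnj (cinner y x)"
    using cinner_commute[of "fst x" "fst y"] cinner_commute[of "snd x" "snd y"]
    by (simp add: cinner_prod_def)
qed (auto simp: cinner_prod_def scaleC_prod_def cinner_add_left cinner_scaleC_left
      inner_prod_def inner_cinner algebra_simps)
end

instance prod :: (chilbert_space, chilbert_space) chilbert_space ..

instantiation vec :: (complex_vector, finite) complex_vector
begin
definition scaleC_vec :: "complex \<Rightarrow> 'a ^ 'b \<Rightarrow> 'a ^ 'b"
  where "scaleC_vec c x = (\<chi> i. c *\<^sub>C (x $ i))"
instance
  by intro_classes
    (auto simp: scaleC_vec_def vec_eq_iff scaleC_add_right scaleC_add_left scaleC_scaleC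
      scaleC_one scaleR_scaleC)
end

instantiation vec :: (complex_inner, finite) complex_inner
begin
definition cinner_vec :: "'a ^ 'b \<Rightarrow> 'a ^ 'b \<Rightarrow> complex"
  where "cinner_vec x y = (\<Sum>i\<in>UNIV. cinner (x $ i) (y $ i))"
instance
proof
  fix x y :: "'a ^ 'b"
  show "cinner x y = cnj (cinner y x)"
    unfolding cinner_vec_def cnj_sum by (rule sum.cong[OF refl], rule cinner_commute)
qed (auto simp: cinner_vec_def scaleC_vec_def cinner_add_left cinner_scaleC_left
      inner_vec_def inner_cinner sum.distrib sum_distrib_left)
end

instance vec :: (chilbert_space, finite) chilbert_space ..

section \<open>Square-summable families\<close>

text \<open>\<open>('i, 'k) ell2\<close> is the Hilbert space of square-summable families in \<open>'k\<close>. It serves both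
  as \<open>\<ell>\<^sup>2('i)\<close> (for \<open>'k = complex\<close>) and as the Hilbert space tensor product of
  \<open>\<ell>\<^sup>2('i)\<close> with \<open>'k\<close>; see \<open>etensor\<close> below for the elementary tensors.\<close>

typedef (overloaded) ('i, 'k) ell2 =
  "{f :: 'i \<Rightarrow> 'k::complex_inner. (\<lambda>i. (norm (f i))\<^sup>2) summable_on UNIV}"
  morphisms ell2_nth Abs_ell2
  by (rule exI[of _ "\<lambda>_. 0"]) simp

setup_lifting type_definition_ell2

lemma sq_norm_add_le: "(norm (x + y))\<^sup>2 \<le> 2 * (norm x)\<^sup>2 + 2 * (norm (y::'a::real_normed_vector))\<^sup>2"
proof -
  have "(norm (x + y))\<^sup>2 \<le> (norm x + norm y)\<^sup>2"
    by (simp add: norm_triangle_ineq power_mono)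
  also have "\<dots> \<le> 2 * (norm x)\<^sup>2 + 2 * (norm y)\<^sup>2"
    using zero_le_power2[of "norm x - norm y"] by (simp add: power2_eq_square algebra_simps)
  finally show ?thesis .
qed

lemma summable_on_le:
  fixes f g :: "'i \<Rightarrow> real"
  assumes "g summable_on A" "\<And>i. i \<in> A \<Longrightarrow> 0 \<le> f i" "\<And>i. i \<in> A \<Longrightarrow> f i \<le> g i"
  shows "f summable_on A"
proof -
  have "(\<lambda>i. norm (g i)) summable_on A"
    using assms(1) summable_on_iff_abs_summable_on_real by blast
  then have "(\<lambda>i. norm (f i)) summable_on A"
    by (rule Infinite_Sum.abs_summable_on_comparison_test) (use assms(2,3) in force)
  then show ?thesis
    using summable_on_iff_abs_summable_on_real by blast
qed

lemma ell2_add_closed: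
  fixes f g :: "'i \<Rightarrow> 'k::real_normed_vector"
  assumes "(\<lambda>i. (norm (f i))\<^sup>2) summable_on A" "(\<lambda>i. (norm (g i))\<^sup>2) summable_on A"
  shows "(\<lambda>i. (norm (f i + g i))\<^sup>2) summable_on A"
proof (rule summable_on_le)
  show "(\<lambda>i. 2 * (norm (f i))\<^sup>2 + 2 * (norm (g i))\<^sup>2) summable_on A"
    by (intro summable_on_add summable_on_cmult_right assms)
qed (auto intro: sq_norm_add_le)

lemma ell2_cinner_summable:
  fixes f g :: "'i \<Rightarrow> 'k::complex_inner"
  assumes "(\<lambda>i. (norm (f i))\<^sup>2) summable_on A" "(\<lambda>i. (norm (g i))\<^sup>2) summable_on A"
  shows "(\<lambda>i. cinner (f i) (g i)) summable_on A"
proof -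
  have le: "norm (cinner (f i) (g i)) \<le> (norm (f i))\<^sup>2 + (norm (g i))\<^sup>2" for i
  proof -
    have "norm (cinner (f i) (g i)) \<le> norm (f i) * norm (g i)"
      by (rule norm_cinner_le)
    also have "\<dots> \<le> (norm (f i))\<^sup>2 + (norm (g i))\<^sup>2"
    proof -
      have "0 \<le> norm (f i) * norm (g i)" by simp
      moreover have "2 * (norm (f i) * norm (g i)) \<le> (norm (f i))\<^sup>2 + (norm (g i))\<^sup>2"
        using zero_le_power2[of "norm (f i) - norm (g i)"]
        by (simp add: power2_eq_square algebra_simps)
      ultimately show ?thesis by linarith
    qed
    finally show ?thesis .
  qed
  have "(\<lambda>i. norm (cinner (f i) (g i))) summable_on A"
    by (rule summable_on_le[OF summable_on_add[OF assms]]) (auto intro: le)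
  then show ?thesis
    by (rule abs_summable_summable)
qed

lemma ell2_inner_summable:
  fixes f g :: "'i \<Rightarrow> 'k::complex_inner"
  assumes "(\<lambda>i. (norm (f i))\<^sup>2) summable_on A" "(\<lambda>i. (norm (g i))\<^sup>2) summable_on A"
  shows "(\<lambda>i. inner (f i) (g i)) summable_on A"
  unfolding inner_cinner by (intro summable_on_Re ell2_cinner_summable assms)

instantiation ell2 :: (type, complex_inner) complex_vector
begin
lift_definition zero_ell2 :: "('a, 'b) ell2" is "\<lambda>_. 0" by simp
lift_definition plus_ell2 :: "('a, 'b) ell2 \<Rightarrow> ('a, 'b) ell2 \<Rightarrow> ('a, 'b) ell2"
  is "\<lambda>f g i. f i + g i" by (rule ell2_add_closed)
lift_definition uminus_ell2 :: "('a, 'b) ell2 \<Rightarrow> ('a, 'b) ell2" is "\<lambda>f i. - f i" by simp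
lift_definition minus_ell2 :: "('a, 'b) ell2 \<Rightarrow> ('a, 'b) ell2 \<Rightarrow> ('a, 'b) ell2"
  is "\<lambda>f g i. f i - g i"
  subgoal for f g using ell2_add_closed[of f UNIV "\<lambda>i. - g i"] by simp
  done
lift_definition scaleR_ell2 :: "real \<Rightarrow> ('a, 'b) ell2 \<Rightarrow> ('a, 'b) ell2" is "\<lambda>r f i. r *\<^sub>R f i"
  by (simp add: power_mult_distrib summable_on_cmult_right)
lift_definition scaleC_ell2 :: "complex \<Rightarrow> ('a, 'b) ell2 \<Rightarrow> ('a, 'b) ell2" is "\<lambda>c f i. c *\<^sub>C f i"
  by (simp add: norm_scaleC power_mult_distrib summable_on_cmult_right)
instance
  by intro_classes
    (transfer; auto simp: fun_eq_iff algebra_simps scaleC_add_right scaleC_add_left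
      scaleC_scaleC scaleC_one scaleR_scaleC)+
end

instantiation ell2 :: (type, complex_inner) complex_inner
begin
lift_definition inner_ell2 :: "('a, 'b) ell2 \<Rightarrow> ('a, 'b) ell2 \<Rightarrow> real"
  is "\<lambda>f g. infsum (\<lambda>i. inner (f i) (g i)) UNIV" .
lift_definition cinner_ell2 :: "('a, 'b) ell2 \<Rightarrow> ('a, 'b) ell2 \<Rightarrow> complex"
  is "\<lambda>f g. infsum (\<lambda>i. cinner (f i) (g i)) UNIV" .
definition norm_ell2 :: "('a, 'b) ell2 \<Rightarrow> real" where "norm_ell2 f = sqrt (inner f f)"
definition sgn_ell2 :: "('a, 'b) ell2 \<Rightarrow> ('a, 'b) ell2" where "sgn_ell2 f = f /\<^sub>R norm f"
definition dist_ell2 :: "('a, 'b) ell2 \<Rightarrow> ('a, 'b) ell2 \<Rightarrow> real" where "dist_ell2 f g = norm (f - g)"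
definition uniformity_ell2 :: "(('a, 'b) ell2 \<times> ('a, 'b) ell2) filter"
  where "uniformity_ell2 = (INF e\<in>{0<..}. principal {(f, g). dist f g < e})"
definition open_ell2 :: "('a, 'b) ell2 set \<Rightarrow> bool"
  where "open_ell2 U = (\<forall>x\<in>U. \<forall>\<^sub>F (x', y) in uniformity. x' = x \<longrightarrow> y \<in> U)"
instance
proof
  fix f g h :: "('a, 'b) ell2" and r :: real and c :: complex and U :: "('a, 'b) ell2 set"
  show "dist f g = norm (f - g)" by (rule dist_ell2_def)
  show "sgn f = f /\<^sub>R norm f" by (rule sgn_ell2_def)
  show "uniformity = (INF e\<in>{0<..}. principal {(f, g :: ('a, 'b) ell2). dist f g < e})"
    by (rule uniformity_ell2_def)
  show "open U = (\<forall>x\<in>U. \<forall>\<^sub>F (x', y) in uniformity. x' = x \<longrightarrow> y \<in> U)"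
    by (rule open_ell2_def)
  show "norm f = sqrt (inner f f)" by (rule norm_ell2_def)
  show "inner f g = inner g f"
    by transfer (simp add: inner_commute)
  show "inner (f + g) h = inner f h + inner g h"
    by transfer (simp add: inner_add_left infsum_add ell2_inner_summable)
  show "inner (r *\<^sub>R f) g = r * inner f g"
    by transfer (simp add: infsum_cmult_right')
  show "0 \<le> inner f f"
    by transfer (simp add: infsum_nonneg)
  show "inner f f = 0 \<longleftrightarrow> f = 0"
  proof
    assume z: "inner f f = 0"
    have "inner (ell2_nth f i) (ell2_nth f i) = 0" for i
      by (rule nonneg_infsum_le_0D[of "\<lambda>i. inner (ell2_nth f i) (ell2_nth f i)" UNIV])
        (use z ell2_nth[of f] in \<open>auto simp: inner_ell2.rep_eq power2_norm_eq_inner\<close>)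
    then show "f = 0"
      by (auto simp: zero_ell2.rep_eq fun_eq_iff simp flip: ell2_nth_inject)
  next
    assume "f = 0"
    then show "inner f f = 0" by simp (transfer, simp)
  qed
  show "cinner f g = cnj (cinner g f)"
    unfolding cinner_ell2.rep_eq infsum_cnj[symmetric] by (rule infsum_cong, rule cinner_commute)
  show "cinner (f + g) h = cinner f h + cinner g h"
    by transfer (simp add: cinner_add_left infsum_add ell2_cinner_summable)
  show "cinner (c *\<^sub>C f) g = c * cinner f g"
    by transfer (simp add: cinner_scaleC_left infsum_cmult_right')
  show "inner f g = Re (cinner f g)"
    by transfer (simp add: inner_cinner infsum_Re ell2_cinner_summable)
qed
end

lemma ell2_norm_sq: "(norm f)\<^sup>2 = infsum (\<lambda>i. (norm (ell2_nth f i))\<^sup>2) UNIV"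
  by (simp add: power2_norm_eq_inner inner_ell2.rep_eq)

lemma ell2_sum_le:
  assumes "finite F"
  shows "(\<Sum>i\<in>F. (norm (ell2_nth f i))\<^sup>2) \<le> (norm f)\<^sup>2"
  unfolding ell2_norm_sq using ell2_nth[of f] assms by (intro finite_sum_le_infsum) auto

lemma ell2_nth_le: "norm (ell2_nth f i) \<le> norm f"
  by (rule power2_le_imp_le) (use ell2_sum_le[of "{i}" f] in simp_all)

instance ell2 :: (type, chilbert_space) chilbert_space
proof
  fix X :: "nat \<Rightarrow> ('a, 'b) ell2"
  assume X: "Cauchy X"
  have "Cauchy (\<lambda>n. ell2_nth (X n) i)" for i
  proof (rule metric_CauchyI)
    fix e :: real assume "e > 0"
    then obtain M where M: "\<And>m n. m \<ge> M \<Longrightarrow> n \<ge> M \<Longrightarrow> dist (X m) (X n) < e"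
      using X unfolding Cauchy_def by blast
    have "dist (ell2_nth (X m) i) (ell2_nth (X n) i) \<le> dist (X m) (X n)" for m n
      using ell2_nth_le[of "X m - X n" i] by (simp add: dist_norm minus_ell2.rep_eq)
    then show "\<exists>M. \<forall>m\<ge>M. \<forall>n\<ge>M. dist (ell2_nth (X m) i) (ell2_nth (X n) i) < e"
      using M by (meson le_less_trans)
  qed
  then have "\<exists>l. (\<lambda>n. ell2_nth (X n) i) \<longlonglongrightarrow> l" for i
    using Cauchy_convergent convergent_def by blast
  then obtain g where g: "\<And>i. (\<lambda>n. ell2_nth (X n) i) \<longlonglongrightarrow> g i" by metis
  have bound: "\<exists>M. \<forall>m\<ge>M. \<forall>F. finite F \<longrightarrow> (\<Sum>i\<in>F. (norm (ell2_nth (X m) i - g i))\<^sup>2) \<le> e\<^sup>2"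
    if "e > 0" for e :: real
  proof -
    obtain M where M: "\<And>m n. m \<ge> M \<Longrightarrow> n \<ge> M \<Longrightarrow> dist (X m) (X n) < e"
      using X \<open>e > 0\<close> unfolding Cauchy_def by blast
    have "(\<Sum>i\<in>F. (norm (ell2_nth (X m) i - g i))\<^sup>2) \<le> e\<^sup>2" if "m \<ge> M" "finite F" for m F
    proof (rule Lim_bounded[where M = M])
      show "(\<lambda>n. \<Sum>i\<in>F. (norm (ell2_nth (X m) i - ell2_nth (X n) i))\<^sup>2)
              \<longlonglongrightarrow> (\<Sum>i\<in>F. (norm (ell2_nth (X m) i - g i))\<^sup>2)"
        by (intro tendsto_intros g)
      show "\<forall>n\<ge>M. (\<Sum>i\<in>F. (norm (ell2_nth (X m) i - ell2_nth (X n) i))\<^sup>2) \<le> e\<^sup>2"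
      proof (intro allI impI)
        fix n assume "n \<ge> M"
        have "(\<Sum>i\<in>F. (norm (ell2_nth (X m) i - ell2_nth (X n) i))\<^sup>2) \<le> (norm (X m - X n))\<^sup>2"
          using ell2_sum_le[OF \<open>finite F\<close>, of "X m - X n"] by (simp add: minus_ell2.rep_eq)
        also have "\<dots> \<le> e\<^sup>2"
          using M[OF \<open>m \<ge> M\<close> \<open>n \<ge> M\<close>] by (intro power_mono) (auto simp: dist_norm)
        finally show "(\<Sum>i\<in>F. (norm (ell2_nth (X m) i - ell2_nth (X n) i))\<^sup>2) \<le> e\<^sup>2" .
      qed
    qed
    then show ?thesis by blast
  qed
  have summ: "(\<lambda>i. (norm (h i))\<^sup>2) summable_on UNIV"
    if "\<And>F. finite F \<Longrightarrow> (\<Sum>i\<in>F. (norm (h i))\<^sup>2) \<le> B" for h :: "'a \<Rightarrow> 'b" and B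
    by (rule nonneg_bdd_above_summable_on) (use that in \<open>auto intro!: bdd_aboveI2\<close>)
  have gs: "(\<lambda>i. (norm (g i))\<^sup>2) summable_on UNIV"
  proof -
    obtain M where M: "\<And>F. finite F \<Longrightarrow> (\<Sum>i\<in>F. (norm (ell2_nth (X M) i - g i))\<^sup>2) \<le> 1\<^sup>2"
      using bound[of 1] by auto
    have "(\<lambda>i. (norm (g i - ell2_nth (X M) i))\<^sup>2) summable_on UNIV"
      by (rule summ) (use M in \<open>simp add: norm_minus_commute\<close>)
    then have "(\<lambda>i. (norm (ell2_nth (X M) i + (g i - ell2_nth (X M) i)))\<^sup>2) summable_on UNIV"
      using ell2_nth[of "X M"] by (intro ell2_add_closed) auto
    then show ?thesis by simp
  qed
  define G where "G = Abs_ell2 g"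
  have G: "ell2_nth G = g"
    using gs by (simp add: G_def Abs_ell2_inverse)
  have "X \<longlonglongrightarrow> G"
  proof (rule metric_LIMSEQ_I)
    fix r :: real assume "r > 0"
    obtain M where M: "\<And>m F. m \<ge> M \<Longrightarrow> finite F \<Longrightarrow>
        (\<Sum>i\<in>F. (norm (ell2_nth (X m) i - g i))\<^sup>2) \<le> (r/2)\<^sup>2"
      using bound[of "r/2"] \<open>r > 0\<close> by auto
    have "dist (X m) G < r" if "m \<ge> M" for m
    proof -
      have "(norm (X m - G))\<^sup>2 \<le> (r/2)\<^sup>2"
        unfolding ell2_norm_sq
        by (rule infsum_le_finite_sums)
          (use ell2_nth[of "X m - G"] M[OF that] in \<open>auto simp: minus_ell2.rep_eq G\<close>)
      then have "norm (X m - G) \<le> r/2"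
        by (rule power2_le_imp_le) (use \<open>r > 0\<close> in simp)
      then show ?thesis using \<open>r > 0\<close> by (simp add: dist_norm)
    qed
    then show "\<exists>M. \<forall>m\<ge>M. dist (X m) G < r" by blast
  qed
  then show "convergent X" by (auto simp: convergent_def)
qed

section \<open>Operators\<close>

text \<open>An operator between closed subspaces \<open>X\<close> and \<open>Y\<close> is represented by a function on the ambient
  type, of which only the values on \<open>X\<close> matter.\<close>

definition bounded_clinear :: "('a::complex_inner \<Rightarrow> 'b::complex_inner) \<Rightarrow> bool" where
  "bounded_clinear A \<longleftrightarrow> bounded_linear A \<and> (\<forall>c x. A (c *\<^sub>C x) = c *\<^sub>C A x)"

definition bounded_operator_between ::
    "'a::complex_inner set \<Rightarrow> 'b::complex_inner set \<Rightarrow> ('a \<Rightarrow> 'b) \<Rightarrow> bool" where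
  "bounded_operator_between X Y A \<longleftrightarrow>
     A ` X \<subseteq> Y \<and>
     (\<forall>x\<in>X. \<forall>y\<in>X. A (x + y) = A x + A y) \<and>
     (\<forall>c. \<forall>x\<in>X. A (c *\<^sub>C x) = c *\<^sub>C A x) \<and>
     (\<exists>K. \<forall>x\<in>X. norm (A x) \<le> K * norm x)"

text \<open>Every unitary between closed subspaces \<open>X\<close> and \<open>Y\<close> extends to a bounded operator on the whole
  space (by zero on the orthogonal complement of \<open>X\<close>); for convenience such an extension is part
  of the representation.\<close>

definition unitary_between ::
    "'a::complex_inner set \<Rightarrow> 'b::complex_inner set \<Rightarrow> ('a \<Rightarrow> 'b) \<Rightarrow> bool" where
  "unitary_between X Y W \<longleftrightarrow>
     bounded_clinear W \<and> W ` X = Y \<and> (\<forall>x\<in>X. \<forall>y\<in>X. cinner (W x) (W y) = cinner x y)"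

definition closed_csubspace :: "'a::complex_inner set \<Rightarrow> bool" where
  "closed_csubspace M \<longleftrightarrow> csubspace M \<and> closed M"

definition ortho_compl :: "'a::complex_inner set \<Rightarrow> 'a set" where
  "ortho_compl M = {x. \<forall>y\<in>M. cinner x y = 0}"

definition ortho_proj :: "'a::complex_inner set \<Rightarrow> 'a \<Rightarrow> 'a" where
  "ortho_proj M x = (THE y. y \<in> M \<and> x - y \<in> ortho_compl M)"

definition cadjoint :: "('a::complex_inner \<Rightarrow> 'b::complex_inner) \<Rightarrow> 'b \<Rightarrow> 'a" where
  "cadjoint A = (THE B. \<forall>x y. cinner (A x) y = cinner x (B y))"

definition positive_op :: "('a::complex_inner \<Rightarrow> 'a) \<Rightarrow> bool" where
  "positive_op A \<longleftrightarrow> (\<forall>x. cinner (A x) x \<in> \<real>\<^sub>\<ge>\<^sub>0)"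

definition op_sqrt :: "('a::complex_inner \<Rightarrow> 'a) \<Rightarrow> 'a \<Rightarrow> 'a" where
  "op_sqrt A = (THE B. bounded_clinear B \<and> positive_op B \<and> B \<circ> B = A)"

text \<open>The weak operator topology on the bounded operators: the initial topology for the maps
  \<open>A \<mapsto> \<langle>A x, y\<rangle>\<close>.\<close>

definition wot :: "('a::complex_inner \<Rightarrow> 'b::complex_inner) topology" where
  "wot = pullback_topology {A. bounded_clinear A} (\<lambda>A (x, y). cinner (A x) y) euclidean"

section \<open>Tensor products with sequence spaces\<close>

lift_definition etensor :: "('i, complex) ell2 \<Rightarrow> 'k::complex_inner \<Rightarrow> ('i, 'k) ell2"
  (infixr "\<otimes>\<^sub>e" 70) is "\<lambda>f x i. f i *\<^sub>C x"
  by (simp add: norm_scaleC power_mult_distrib summable_on_cmult_left)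

definition tensor_space ::
    "('i, complex) ell2 set \<Rightarrow> 'k::complex_inner set \<Rightarrow> ('i, 'k) ell2 set"
  (infixr "\<otimes>\<^sub>s" 70) where
  "M \<otimes>\<^sub>s D = closure (cspan {f \<otimes>\<^sub>e x |f x. f \<in> M \<and> x \<in> D})"

definition tensor_op ::
    "(('i, complex) ell2 \<Rightarrow> ('i, complex) ell2) \<Rightarrow> ('k::complex_inner \<Rightarrow> 'l::complex_inner) \<Rightarrow>
     ('i, 'k) ell2 \<Rightarrow> ('i, 'l) ell2"  (infixr "\<otimes>\<^sub>o" 70) where
  "A \<otimes>\<^sub>o B = (THE G. bounded_clinear G \<and> (\<forall>f x. G (f \<otimes>\<^sub>e x) = A f \<otimes>\<^sub>e B x))"

text \<open>The identification of \<open>\<Gamma> \<otimes> \<H>\<^sup>n\<close> with \<open>(\<Gamma> \<otimes> \<H>)\<^sup>n\<close>.\<close>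

definition tensor_split ::
    "('i, 'k::complex_inner ^ 'n::finite) ell2 \<Rightarrow> ('i, 'k) ell2 ^ 'n" where
  "tensor_split F = (\<chi> i. (id \<otimes>\<^sub>o (\<lambda>v. v $ i)) F)"

text \<open>The diagonal block operator \<open>A \<oplus> B\<close> on \<open>(M \<otimes> D) \<oplus> (M \<otimes> E)\<close>, transported to
  \<open>M \<otimes> (D \<oplus> E)\<close>. The direct sum \<open>D \<oplus> E\<close> of subspaces is the set \<open>D \<times> E\<close> in the product
  Hilbert space.\<close>

definition block_diag ::
    "(('i, 'k::complex_inner) ell2 \<Rightarrow> ('i, 'l::complex_inner) ell2) \<Rightarrow>
     (('i, 'd::complex_inner) ell2 \<Rightarrow> ('i, 'e::complex_inner) ell2) \<Rightarrow>
     ('i, 'k \<times> 'd) ell2 \<Rightarrow> ('i, 'l \<times> 'e) ell2" where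
  "block_diag A B F =
     (id \<otimes>\<^sub>o (\<lambda>x. (x, 0))) (A ((id \<otimes>\<^sub>o fst) F)) + (id \<otimes>\<^sub>o (\<lambda>y. (0, y))) (B ((id \<otimes>\<^sub>o snd) F))"

section \<open>The full Fock space\<close>

text \<open>The tensor power of order \<open>m\<close> of \<open>\<complex>\<^sup>n\<close> has the orthonormal basis of the
  \<open>e\<^bsub>i\<^sub>1\<^esub> \<otimes> \<dots> \<otimes> e\<^bsub>i\<^sub>m\<^esub>\<close>, indexed by the words of length \<open>m\<close>; an element of the full Fock space is
  given by its square-summable family of coefficients. The number \<open>n\<close> of generators is \<open>CARD('n)\<close>.\<close>

type_synonym 'n fock = "('n list, complex) ell2"

lemma summable_on_reindex_extend:
  fixes f :: "'i \<Rightarrow> 'k::complex_inner"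
  assumes "(\<lambda>i. (norm (f i))\<^sup>2) summable_on UNIV" and "inj h"
    and "\<And>i. g (h i) = f i" and "\<And>j. j \<notin> range h \<Longrightarrow> g j = 0"
  shows "(\<lambda>j. (norm (g j))\<^sup>2) summable_on UNIV"
proof -
  have "(\<lambda>j. (norm (g j))\<^sup>2) summable_on range h"
    using assms(1,3) by (simp add: summable_on_reindex[OF \<open>inj h\<close>] o_def)
  moreover have "(\<lambda>j. (norm (g j))\<^sup>2) summable_on range h \<longleftrightarrow> (\<lambda>j. (norm (g j))\<^sup>2) summable_on UNIV"
    by (rule summable_on_cong_neutral) (use assms(4) in auto)
  ultimately show ?thesis by blast
qed

text \<open>\<open>L\<^sub>j f = e\<^sub>j \<otimes> f\<close> and \<open>R\<^sub>j f = f \<otimes> e\<^sub>j\<close>.\<close>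

lift_definition create_left :: "'n \<Rightarrow> 'n fock \<Rightarrow> 'n fock"
  is "\<lambda>j f w. if w \<noteq> [] \<and> hd w = j then f (tl w) else 0"
  subgoal for j f
  proof (rule summable_on_reindex_extend[of f "(#) j"])
    show "(if w \<noteq> [] \<and> hd w = j then f (tl w) else 0) = 0" if "w \<notin> range ((#) j)" for w
      using that by (cases w) auto
  qed (simp_all add: inj_def)
  done

lift_definition create_right :: "'n \<Rightarrow> 'n fock \<Rightarrow> 'n fock"
  is "\<lambda>j f w. if w \<noteq> [] \<and> last w = j then f (butlast w) else 0"
  subgoal for j f
  proof (rule summable_on_reindex_extend[of f "\<lambda>v. v @ [j]"])
    show "(if w \<noteq> [] \<and> last w = j then f (butlast w) else 0) = 0" if "w \<notin> range (\<lambda>v. v @ [j])" for w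
      using that by (cases w rule: rev_cases) auto
  qed (simp_all add: inj_def)
  done

definition operator_algebra :: "('a::complex_inner \<Rightarrow> 'a) set \<Rightarrow> bool" where
  "operator_algebra \<A> \<longleftrightarrow>
     \<A> \<subseteq> {A. bounded_clinear A} \<and>
     (\<lambda>x. 0) \<in> \<A> \<and>
     (\<forall>A\<in>\<A>. \<forall>B\<in>\<A>. (\<lambda>x. A x + B x) \<in> \<A>) \<and>
     (\<forall>c. \<forall>A\<in>\<A>. (\<lambda>x. c *\<^sub>C A x) \<in> \<A>) \<and>
     (\<forall>A\<in>\<A>. \<forall>B\<in>\<A>. A \<circ> B \<in> \<A>)"

definition fock_algebra :: "('n fock \<Rightarrow> 'n fock) set" where
  "fock_algebra = (\<lambda>\<A>. operator_algebra \<A> \<and> closedin wot \<A>) hull insert id (range create_left)"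

definition two_sided_ideal_of ::
    "('a::complex_inner \<Rightarrow> 'a) set \<Rightarrow> ('a \<Rightarrow> 'a) set \<Rightarrow> bool" where
  "two_sided_ideal_of \<A> J \<longleftrightarrow>
     J \<subseteq> \<A> \<and>
     (\<lambda>x. 0) \<in> J \<and>
     (\<forall>A\<in>J. \<forall>B\<in>J. (\<lambda>x. A x + B x) \<in> J) \<and>
     (\<forall>c. \<forall>A\<in>J. (\<lambda>x. c *\<^sub>C A x) \<in> J) \<and>
     (\<forall>A\<in>\<A>. \<forall>B\<in>J. A \<circ> B \<in> J \<and> B \<circ> A \<in> J)"

text \<open>A noncommutative polynomial in indeterminates indexed by \<open>'n\<close> is a finitely supported family
  of coefficients indexed by words.\<close>

type_synonym 'n ncpoly = "'n list \<Rightarrow>\<^sub>0 complex"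

definition word_op :: "('n \<Rightarrow> 'a \<Rightarrow> 'a) \<Rightarrow> 'n list \<Rightarrow> 'a \<Rightarrow> 'a" where
  "word_op T w = foldr (\<lambda>i A. T i \<circ> A) w id"

definition ncpoly_eval :: "'n ncpoly \<Rightarrow> ('n \<Rightarrow> 'a::complex_vector \<Rightarrow> 'a) \<Rightarrow> 'a \<Rightarrow> 'a" where
  "ncpoly_eval p T x = (\<Sum>w\<in>Poly_Mapping.keys p. Poly_Mapping.lookup p w *\<^sub>C word_op T w x)"

definition generated_ideal :: "'n ncpoly set \<Rightarrow> ('n fock \<Rightarrow> 'n fock) set" where
  "generated_ideal P =
     (\<lambda>J. two_sided_ideal_of fock_algebra J \<and> closedin wot J) hull
       ((\<lambda>p. ncpoly_eval p create_left) ` P)"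

definition M_space :: "('n fock \<Rightarrow> 'n fock) set \<Rightarrow> 'n fock set" where
  "M_space J = closure (cspan {\<phi> \<psi> |\<phi> \<psi>. \<phi> \<in> J})"

definition N_space :: "('n fock \<Rightarrow> 'n fock) set \<Rightarrow> 'n fock set" where
  "N_space J = ortho_compl (M_space J)"

section \<open>Row contractions and characteristic functions\<close>

definition row_op :: "('n::finite \<Rightarrow> 'h::complex_inner \<Rightarrow> 'k::complex_inner) \<Rightarrow> 'h ^ 'n \<Rightarrow> 'k" where
  "row_op T v = (\<Sum>i\<in>UNIV. T i (v $ i))"

definition row_contraction :: "('n::finite \<Rightarrow> 'h::complex_inner \<Rightarrow> 'h) \<Rightarrow> bool" where
  "row_contraction T \<longleftrightarrow>
     (\<forall>i. bounded_clinear (T i)) \<and> positive_op (\<lambda>x. x - (\<Sum>i\<in>UNIV. T i (cadjoint (T i) x)))"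

definition constrained_row_contraction ::
    "'n ncpoly set \<Rightarrow> ('n::finite \<Rightarrow> 'h::complex_inner \<Rightarrow> 'h) \<Rightarrow> bool" where
  "constrained_row_contraction P T \<longleftrightarrow>
     row_contraction T \<and> (\<forall>p\<in>P. ncpoly_eval p T = (\<lambda>x. 0))"

definition defect :: "('n::finite \<Rightarrow> 'h::complex_inner \<Rightarrow> 'h) \<Rightarrow> 'h ^ 'n \<Rightarrow> 'h ^ 'n" where
  "defect T = op_sqrt (\<lambda>v. v - cadjoint (row_op T) (row_op T v))"

definition defect_star :: "('n::finite \<Rightarrow> 'h::complex_inner \<Rightarrow> 'h) \<Rightarrow> 'h \<Rightarrow> 'h" where
  "defect_star T = op_sqrt (\<lambda>x. x - row_op T (cadjoint (row_op T) x))"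

definition defect_space :: "('n::finite \<Rightarrow> 'h::complex_inner \<Rightarrow> 'h) \<Rightarrow> ('h ^ 'n) set" where
  "defect_space T = closure (range (defect T))"

definition defect_star_space :: "('n::finite \<Rightarrow> 'h::complex_inner \<Rightarrow> 'h) \<Rightarrow> 'h set" where
  "defect_star_space T = closure (range (defect_star T))"

definition char_fun_approx ::
    "('n::finite \<Rightarrow> 'h::complex_inner \<Rightarrow> 'h) \<Rightarrow> real \<Rightarrow>
     ('n list, 'h ^ 'n) ell2 \<Rightarrow> ('n list, 'h) ell2" where
  "char_fun_approx T r F =
     - (id \<otimes>\<^sub>o row_op T) F +
     (id \<otimes>\<^sub>o defect_star T)
       (inv (\<lambda>G. G - r *\<^sub>R (\<Sum>i\<in>UNIV. (create_right i \<otimes>\<^sub>o cadjoint (T i)) G))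
         (r *\<^sub>R row_op (\<lambda>i. create_right i \<otimes>\<^sub>o id) (tensor_split ((id \<otimes>\<^sub>o defect T) F))))"

text \<open>The limit in the strong operator topology is the pointwise limit.\<close>

definition char_fun ::
    "('n::finite \<Rightarrow> 'h::complex_inner \<Rightarrow> 'h) \<Rightarrow> ('n list, 'h ^ 'n) ell2 \<Rightarrow> ('n list, 'h) ell2" where
  "char_fun T F = Lim (at_left 1) (\<lambda>r. char_fun_approx T r F)"

definition constrained_char_fun ::
    "('n fock \<Rightarrow> 'n fock) set \<Rightarrow> ('n::finite \<Rightarrow> 'h::complex_inner \<Rightarrow> 'h) \<Rightarrow>
     ('n list, 'h ^ 'n) ell2 \<Rightarrow> ('n list, 'h) ell2" where
  "constrained_char_fun J T F = ortho_proj (N_space J \<otimes>\<^sub>s defect_star_space T) (char_fun T F)"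

text \<open>\<open>M\<close> acts from \<open>\<N> \<otimes> E\<close> to \<open>\<N> \<otimes> E\<^sub>*\<close>, and \<open>M'\<close> from \<open>\<N> \<otimes> E'\<close> to \<open>\<N> \<otimes> E'\<^sub>*\<close>.\<close>

definition coincide ::
    "('i, complex) ell2 set \<Rightarrow>
     'e::complex_inner set \<Rightarrow> 's::complex_inner set \<Rightarrow> (('i, 'e) ell2 \<Rightarrow> ('i, 's) ell2) \<Rightarrow>
     'f::complex_inner set \<Rightarrow> 't::complex_inner set \<Rightarrow> (('i, 'f) ell2 \<Rightarrow> ('i, 't) ell2) \<Rightarrow> bool" where
  "coincide \<N> E Es M E' Es' M' \<longleftrightarrow>
     bounded_operator_between (\<N> \<otimes>\<^sub>s E) (\<N> \<otimes>\<^sub>s Es) M \<and>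
     bounded_operator_between (\<N> \<otimes>\<^sub>s E') (\<N> \<otimes>\<^sub>s Es') M' \<and>
     (\<exists>W Ws. unitary_between E E' W \<and> unitary_between Es Es' Ws \<and>
        (\<forall>F \<in> \<N> \<otimes>\<^sub>s E. (id \<otimes>\<^sub>o Ws) (M F) = M' ((id \<otimes>\<^sub>o W) F)))"

end

theory Submission
  imports Defs
begin

text \<open>The Halmos operator \<open>(T\<^sup>*, D\<^sub>T; D\<^sub>T\<^sub>*, -T)\<close> of a row contraction is a unitary colligation whose
  transfer function is \<open>\<Theta>\<^sub>T\<close>. If the state space is \<open>H\<^sub>1 \<oplus> H\<^sub>2\<close> and \<open>T\<close> is block upper triangular, the
  colligation is a cascade of two unitary colligations with main operators the adjoints of the
  diagonal blocks, so that \<open>\<Theta>\<^sub>T\<close> is a product of two transfer functions; splitting twice gives three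
  factors. A unitary colligation with main operator \<open>S\<^sup>*\<close> is, up to unitaries of the input and output
  spaces, the Halmos colligation of \<open>S\<close> plus an identity feedthrough. The \<open>\<tau>\<close>'s are the resulting
  changes of coordinates on the two intermediate spaces. Finally, \<open>\<M>\<^sub>J\<close> is invariant under the right
  creation operators, so compression to \<open>\<N>\<^sub>J\<close> is multiplicative on transfer functions.\<close>

section \<open>Hilbert space preliminaries\<close>

text \<open>Two points shape the proof. \<open>char_fun\<close> is a limit of expressions that
  contain a resolvent, and at r = 1 this resolvent need not exist. Reading a transfer function as
  the input-output map of a system running along words avoids it: the state recursion makes sense at
  r = 1, an energy estimate bounds the output there, and weighting words by powers of r relates the
  parameters r and 1. Cascades and changes of coordinates then become inductions over words. The
  step that still needs r < 1 is compression: the compressed state X satisfies norm X \<le> r * norm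
  X, which forces it to vanish, and the conclusion passes to the limit.

  The other point is typing. Defect and intermediate spaces are closed subspaces, so colligations
  are total contractions on ambient types that are unitary only between subspaces. The complements
  \<open>E\<^sub>1\<close>, \<open>E\<^sub>2\<close>, \<open>E\<close> arise inside input spaces of
  different types and are all transported into one type, that of H \<times> H^n for the full space H
  of T.\<close>

lemma cinner_zero_left [simp]: "cinner 0 y = 0"
  and cinner_minus_left [simp]: "cinner (- x) y = - cinner x y"
  and cinner_diff_left: "cinner (x - z) y = cinner x y - cinner z y"
  for x y z :: "'a::complex_inner"
proof -
  show z: "cinner 0 y = 0"
    using cinner_add_left[of 0 0 y] by simp
  show m: "cinner (- x) y = - cinner x y" for x
    using cinner_add_left[of "- x" x y] z by (simp add: eq_neg_iff_add_eq_0)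
  show "cinner (x - z) y = cinner x y - cinner z y"
    using cinner_add_left[of x "- z" y] m by simp
qed

lemma cinner_zero_right [simp]: "cinner x 0 = 0"
  and cinner_minus_right [simp]: "cinner x (- y) = - cinner x y"
  and cinner_diff_right: "cinner x (y - z) = cinner x y - cinner x z"
  for x y z :: "'a::complex_inner"
  by (metis cinner_zero_left cinner_commute complex_cnj_zero,
      metis cinner_minus_left cinner_commute complex_cnj_minus,
      metis cinner_diff_left cinner_commute complex_cnj_diff)

lemma cinner_sum_left: "cinner (\<Sum>i\<in>I. f i) y = (\<Sum>i\<in>I. cinner (f i) (y::'a::complex_inner))"
  by (induction I rule: infinite_finite_induct) (simp_all add: cinner_add_left)

lemma cinner_self: "cinner x x = complex_of_real ((norm (x::'a::complex_inner))\<^sup>2)"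
proof -
  have "Im (cinner x x) = 0"
    using arg_cong[OF cinner_commute[of x x], of Im] by simp
  then show ?thesis
    by (simp add: complex_eq_iff power2_norm_eq_inner inner_cinner)
qed

lemma cinner_self_eq_0 [simp]: "cinner x x = 0 \<longleftrightarrow> (x::'a::complex_inner) = 0"
  by (simp add: cinner_self)

lemma cinner_eqI:
  assumes "\<And>z. cinner x z = cinner (y::'a::complex_inner) z"
  shows "x = y"
  using assms[of "x - y"] cinner_self_eq_0[of "x - y"] by (simp only: cinner_diff_left) simp

lemma cinner_eqI_right:
  assumes "\<And>z. cinner z x = cinner z (y::'a::complex_inner)"
  shows "x = y"
  by (rule cinner_eqI) (metis assms cinner_commute)

lemma cinner_commute_0: "cinner x y = 0 \<longleftrightarrow> cinner y (x::'a::complex_inner) = 0"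
  by (metis cinner_commute complex_cnj_zero_iff)

lemma norm_eq_if_cinner_eq: "cinner x x = cinner y y \<Longrightarrow> norm x = norm y"
  for x :: "'a::complex_inner" and y :: "'b::complex_inner"
  by (simp only: cinner_self of_real_eq_iff) (simp add: power2_eq_iff_nonneg)

lemma bounded_bilinear_cinner: "bounded_bilinear (cinner :: 'a \<Rightarrow> 'a::complex_inner \<Rightarrow> complex)"
proof
  show "\<exists>K. \<forall>a b. norm (cinner a b) \<le> norm (a::'a) * norm b * K"
    using norm_cinner_le by (intro exI[of _ 1]) auto
qed (auto simp: cinner_add_left cinner_add_right scaleR_scaleC cinner_scaleC_left
    cinner_scaleC_right scaleC_complex_def)

lemmas tendsto_cinner [tendsto_intros] = bounded_bilinear.tendsto[OF bounded_bilinear_cinner]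
lemmas continuous_on_cinner [continuous_intros] =
  bounded_bilinear.continuous_on[OF bounded_bilinear_cinner]

lemma bounded_clinearI:
  assumes "\<And>x y. A (x + y) = A x + A y" "\<And>c x. A (c *\<^sub>C x) = c *\<^sub>C A x"
    and "\<And>x. norm (A x) \<le> K * norm x"
  shows "bounded_clinear A"
  unfolding bounded_clinear_def
proof (intro conjI allI)
  show "bounded_linear A"
    by (rule bounded_linear_intro[of _ K])
      (use assms in \<open>auto simp: scaleR_scaleC mult.commute\<close>)
qed (rule assms)

lemma bounded_clinear_linear: "bounded_clinear A \<Longrightarrow> bounded_linear A"
  and bounded_clinear_scaleC: "bounded_clinear A \<Longrightarrow> A (c *\<^sub>C x) = c *\<^sub>C A x"
  by (auto simp: bounded_clinear_def)

lemma bounded_clinear_add: "bounded_clinear A \<Longrightarrow> A (x + y) = A x + A y"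
  and bounded_clinear_diff: "bounded_clinear A \<Longrightarrow> A (x - y) = A x - A y"
  and bounded_clinear_0: "bounded_clinear A \<Longrightarrow> A 0 = 0"
  and bounded_clinear_sum: "bounded_clinear A \<Longrightarrow> A (\<Sum>i\<in>I. f i) = (\<Sum>i\<in>I. A (f i))"
  by (drule bounded_clinear_linear, drule bounded_linear.linear,
      simp add: linear_add linear_diff linear_0 linear_sum)+

lemma bounded_clinear_pos_bounded:
  assumes "bounded_clinear A"
  obtains K where "K > 0" "\<And>x. norm (A x) \<le> K * norm x"
  using bounded_linear.pos_bounded[OF bounded_clinear_linear[OF assms]] by (metis mult.commute)

lemmas tendsto_bounded_clinear = bounded_linear.tendsto[OF bounded_clinear_linear]

lemma continuous_on_bounded_clinear: "bounded_clinear A \<Longrightarrow> continuous_on S A"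
  by (rule linear_continuous_on[OF bounded_clinear_linear])

lemma bounded_clinear_id [intro, simp]: "bounded_clinear (\<lambda>x. x)" "bounded_clinear id"
  and bounded_clinear_zero [intro, simp]: "bounded_clinear (\<lambda>x. 0)"
  and bounded_clinear_fst [intro, simp]: "bounded_clinear fst"
  and bounded_clinear_snd [intro, simp]: "bounded_clinear snd"
  and bounded_clinear_vec_nth [intro, simp]: "bounded_clinear (\<lambda>v. v $ i)"
  by (auto simp: bounded_clinear_def id_def scaleC_prod_def scaleC_vec_def
      complex_vector.scale_zero_right bounded_linear_fst bounded_linear_snd bounded_linear_ident
      bounded_linear_zero bounded_linear_vec_nth)

lemma scaleC_zero_right [simp]: "c *\<^sub>C (0::'a::complex_vector) = 0"
  by (rule complex_vector.scale_zero_right)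

lemma scaleC_minus1: "(- 1) *\<^sub>C x = - (x::'a::complex_vector)"
  using complex_vector.scale_minus_left[of 1 x] by (simp add: scaleC_one)

lemma bounded_clinear_compose:
  "bounded_clinear A \<Longrightarrow> bounded_clinear B \<Longrightarrow> bounded_clinear (\<lambda>x. A (B x))"
  by (auto simp: bounded_clinear_def intro: bounded_linear_compose)

lemma bounded_clinear_plus:
  "bounded_clinear A \<Longrightarrow> bounded_clinear B \<Longrightarrow> bounded_clinear (\<lambda>x. A x + B x)"
  by (auto simp: bounded_clinear_def scaleC_add_right intro: bounded_linear_add)

lemma bounded_clinear_minus_fun:
  "bounded_clinear A \<Longrightarrow> bounded_clinear B \<Longrightarrow> bounded_clinear (\<lambda>x. A x - B x)"
  by (auto simp: bounded_clinear_def complex_vector.scale_right_diff_distrib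
      intro: bounded_linear_sub)

lemma bounded_clinear_scaleC_const:
  fixes A :: "'a::complex_inner \<Rightarrow> 'b::complex_inner"
  assumes "bounded_clinear A"
  shows "bounded_clinear (\<lambda>x. c *\<^sub>C A x)"
proof -
  obtain K where K: "K > 0" "\<And>x. norm (A x) \<le> K * norm x"
    using bounded_clinear_pos_bounded[OF assms] by blast
  show ?thesis
  proof (rule bounded_clinearI)
    show "norm (c *\<^sub>C A x) \<le> (cmod c * K) * norm x" for x
      using mult_left_mono[OF K(2), of "cmod c"] by (simp add: norm_scaleC mult.assoc)
  qed (simp_all add: bounded_clinear_add[OF assms] bounded_clinear_scaleC[OF assms]
      scaleC_add_right scaleC_scaleC mult.commute)
qed

lemma bounded_clinear_scaleR_const:
  "bounded_clinear A \<Longrightarrow> bounded_clinear (\<lambda>x. r *\<^sub>R A x)"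
  unfolding scaleR_scaleC by (rule bounded_clinear_scaleC_const)

lemma bounded_clinear_Pair:
  "bounded_clinear A \<Longrightarrow> bounded_clinear B \<Longrightarrow> bounded_clinear (\<lambda>x. (A x, B x))"
  by (auto simp: bounded_clinear_def scaleC_prod_def intro: bounded_linear_Pair)

lemma bounded_clinear_sum_fun:
  "(\<And>i. i \<in> I \<Longrightarrow> bounded_clinear (A i)) \<Longrightarrow> bounded_clinear (\<lambda>x. \<Sum>i\<in>I. A i x)"
  by (induction I rule: infinite_finite_induct) (auto intro: bounded_clinear_plus)

lemma norm_vec_sq: "(norm (v::'a::real_inner ^ 'n))\<^sup>2 = (\<Sum>i\<in>UNIV. (norm (v $ i))\<^sup>2)"
  by (simp add: power2_norm_eq_inner inner_vec_def)

lemma norm_Pair_sq: "(norm (x, y))\<^sup>2 = (norm x)\<^sup>2 + (norm y)\<^sup>2"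
  for x :: "'a::real_normed_vector" and y :: "'b::real_normed_vector"
  by (simp add: norm_prod_def)

lemma bounded_clinear_vec_lambda:
  fixes A :: "'n::finite \<Rightarrow> 'a::complex_inner \<Rightarrow> 'b::complex_inner"
  assumes "\<And>i. bounded_clinear (A i)"
  shows "bounded_clinear (\<lambda>x. \<chi> i. A i x)"
proof -
  have "\<forall>i. \<exists>K. \<forall>x. norm (A i x) \<le> K * norm x"
    using bounded_clinear_pos_bounded[OF assms] by meson
  then obtain K where K: "\<And>i x. norm (A i x) \<le> K i * norm x"
    by metis
  show ?thesis
  proof (rule bounded_clinearI)
    show "norm (\<chi> i. A i x) \<le> (\<Sum>i\<in>UNIV. K i) * norm x" for x
    proof -
      have "norm (\<chi> i. A i x) \<le> (\<Sum>i\<in>UNIV. norm (A i x))"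
        using L2_set_le_sum[of UNIV "\<lambda>i. norm (A i x)"] by (simp add: norm_vec_def)
      also have "\<dots> \<le> (\<Sum>i\<in>UNIV. K i * norm x)"
        by (intro sum_mono K)
      finally show ?thesis by (simp add: sum_distrib_right)
    qed
  qed (auto simp: vec_eq_iff scaleC_vec_def bounded_clinear_add[OF assms]
      bounded_clinear_scaleC[OF assms])
qed

lemmas bounded_clinear_intros = bounded_clinear_plus bounded_clinear_minus_fun
  bounded_clinear_scaleC_const bounded_clinear_scaleR_const bounded_clinear_Pair
  bounded_clinear_vec_lambda bounded_clinear_sum_fun

lemma bounded_clinear_fst' [intro]: "bounded_clinear A \<Longrightarrow> bounded_clinear (\<lambda>x. fst (A x))"
  and bounded_clinear_snd' [intro]: "bounded_clinear A \<Longrightarrow> bounded_clinear (\<lambda>x. snd (A x))"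
  and bounded_clinear_vec_nth' [intro]: "bounded_clinear B \<Longrightarrow> bounded_clinear (\<lambda>x. B x $ i)"
  by (rule bounded_clinear_compose; auto)+

lemma cinner_Pair: "cinner (a, b) (c, d) = cinner a c + cinner b d"
  by (simp add: cinner_prod_def)

lemma bounded_clinear_eq_on_closure_span:
  fixes A B :: "'a::complex_inner \<Rightarrow> 'b::complex_inner"
  assumes A: "bounded_clinear A" and B: "bounded_clinear B"
    and eq: "\<And>x. x \<in> S \<Longrightarrow> A x = B x" and x: "x \<in> closure (cspan S)"
  shows "A x = B x"
proof -
  have sub: "csubspace {x. A x = B x}"
    by (rule complex_vector.subspaceI)
      (simp_all add: bounded_clinear_0 bounded_clinear_add bounded_clinear_scaleC A B)
  have "closed {x. A x = B x}"
    by (intro closed_Collect_eq continuous_on_bounded_clinear A B)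
  moreover have "cspan S \<subseteq> {x. A x = B x}"
    by (rule complex_vector.span_minimal) (use eq sub in auto)
  ultimately show ?thesis
    using closure_minimal x by blast
qed

section \<open>Closed subspaces and orthogonal projections\<close>

lemma closed_csubspaceD:
  assumes "closed_csubspace M"
  shows "0 \<in> M" "\<And>x y. x \<in> M \<Longrightarrow> y \<in> M \<Longrightarrow> x + y \<in> M"
    "\<And>x y. x \<in> M \<Longrightarrow> y \<in> M \<Longrightarrow> x - y \<in> M"
    "\<And>c x. x \<in> M \<Longrightarrow> c *\<^sub>C x \<in> M" "closed M" "\<And>r x. x \<in> M \<Longrightarrow> r *\<^sub>R x \<in> M"
  using assms by (auto simp: closed_csubspace_def scaleR_scaleC complex_vector.subspace_0
      complex_vector.subspace_add complex_vector.subspace_diff complex_vector.subspace_scale)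

lemma closed_csubspaceI:
  assumes "0 \<in> M" "\<And>x y. x \<in> M \<Longrightarrow> y \<in> M \<Longrightarrow> x + y \<in> M" "\<And>c x. x \<in> M \<Longrightarrow> c *\<^sub>C x \<in> M" "closed M"
  shows "closed_csubspace M"
  using assms by (auto simp: closed_csubspace_def complex_vector.subspace_def)

lemma closed_csubspace_UNIV [simp]: "closed_csubspace UNIV"
  by (rule closed_csubspaceI) auto

lemma closed_csubspace_Int: "closed_csubspace M \<Longrightarrow> closed_csubspace N \<Longrightarrow> closed_csubspace (M \<inter> N)"
  by (auto simp: closed_csubspace_def complex_vector.subspace_inter)

lemma closed_csubspace_Times:
  "closed_csubspace M \<Longrightarrow> closed_csubspace N \<Longrightarrow> closed_csubspace (M \<times> N)"
  by (rule closed_csubspaceI)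
    (auto simp: closed_csubspaceD zero_prod_def scaleC_prod_def intro: closed_Times)

lemma closed_csubspace_closure: "csubspace M \<Longrightarrow> closed_csubspace (closure (M::'a::complex_inner set))"
proof (rule closed_csubspaceI)
  assume M: "csubspace M"
  show "0 \<in> closure M"
    using complex_vector.subspace_0[OF M] closure_subset by blast
  show "x + y \<in> closure M" if "x \<in> closure M" "y \<in> closure M" for x y
  proof -
    obtain f g where "\<And>n. f n \<in> M" "f \<longlonglongrightarrow> x" "\<And>n. g n \<in> M" "g \<longlonglongrightarrow> y"
      using \<open>x \<in> closure M\<close> \<open>y \<in> closure M\<close> unfolding closure_sequential by blast
    then have "(\<lambda>n. f n + g n) \<longlonglongrightarrow> x + y" "\<And>n. f n + g n \<in> M"
      by (auto intro: tendsto_intros complex_vector.subspace_add[OF M])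
    then show ?thesis
      unfolding closure_sequential by (intro exI[of _ "\<lambda>n. f n + g n"]) auto
  qed
  show "c *\<^sub>C x \<in> closure M" if "x \<in> closure M" for c x
  proof -
    obtain f where "\<And>n. f n \<in> M" "f \<longlonglongrightarrow> x"
      using \<open>x \<in> closure M\<close> unfolding closure_sequential by blast
    then have "(\<lambda>n. c *\<^sub>C f n) \<longlonglongrightarrow> c *\<^sub>C x" "\<And>n. c *\<^sub>C f n \<in> M"
      using tendsto_bounded_clinear[OF bounded_clinear_scaleC_const[OF bounded_clinear_id(1)]]
      by (auto intro: complex_vector.subspace_scale[OF M])
    then show ?thesis
      unfolding closure_sequential by (intro exI[of _ "\<lambda>n. c *\<^sub>C f n"]) auto
  qed
qed auto

lemma csubspace_range: "bounded_clinear A \<Longrightarrow> csubspace (range A)"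
  by (rule complex_vector.subspaceI)
    (metis bounded_clinear_0 rangeI, metis (no_types) bounded_clinear_add imageE rangeI,
      metis (no_types) bounded_clinear_scaleC imageE rangeI)

lemma closed_csubspace_ortho_compl: "closed_csubspace (ortho_compl (M::'a::complex_inner set))"
proof (rule closed_csubspaceI)
  have "ortho_compl M = (\<Inter>y\<in>M. {x. cinner x y = 0})"
    by (auto simp: ortho_compl_def)
  moreover have "closed {x. cinner x y = 0}" for y :: 'a
    by (intro closed_Collect_eq continuous_intros)
  ultimately show "closed (ortho_compl M)" by auto
qed (auto simp: ortho_compl_def cinner_add_left cinner_scaleC_left)

lemma ortho_compl_closure:
  assumes "\<And>y. y \<in> M \<Longrightarrow> cinner x y = 0" "y \<in> closure M"
  shows "cinner x (y::'a::complex_inner) = 0"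
proof -
  have "closed {y. cinner x y = 0}"
    by (intro closed_Collect_eq continuous_intros)
  then show ?thesis
    using closure_minimal[of M "{y. cinner x y = 0}"] assms by blast
qed

text \<open>A minimizing sequence is Cauchy by the parallelogram law: midpoints stay in
  \<open>M\<close>, hence at distance at least \<open>d\<close> from \<open>x\<close>.\<close>

lemma nearest_point_exists:
  fixes x :: "'a::chilbert_space"
  assumes M: "closed_csubspace M"
  shows "\<exists>y\<in>M. \<forall>z\<in>M. norm (x - y) \<le> norm (x - z)"
proof -
  note D = closed_csubspaceD[OF M]
  define d where "d = infdist x M"
  have ne: "M \<noteq> {}" using D(1) by blast
  have dle: "d \<le> norm (x - z)" if "z \<in> M" for z
    using infdist_le[OF that, of x] by (simp add: d_def dist_norm)
  have d0: "d \<ge> 0" by (simp add: d_def infdist_nonneg)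
  have "\<exists>z\<in>M. norm (x - z) < d + 1 / real (Suc n)" for n
  proof -
    have "(INF z\<in>M. dist x z) < d + 1 / real (Suc n)"
      using ne by (simp add: d_def infdist_def)
    then show ?thesis
      by (subst (asm) cINF_less_iff) (auto simp: ne dist_norm intro!: bdd_belowI2[of _ 0])
  qed
  then obtain f where f: "\<And>n. f n \<in> M" "\<And>n. norm (x - f n) < d + 1 / real (Suc n)"
    by metis
  have par: "(norm (f m - f n))\<^sup>2 \<le> 2 * (norm (x - f m))\<^sup>2 + 2 * (norm (x - f n))\<^sup>2 - 4 * d\<^sup>2" for m n
  proof -
    have mid: "(1/2) *\<^sub>R (f m + f n) \<in> M"
      by (intro D f)
    have eq: "(x - f m) + (x - f n) = 2 *\<^sub>R (x - (1/2) *\<^sub>R (f m + f n))"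
      by (simp add: algebra_simps scaleR_2)
    have "2 * d \<le> norm ((x - f m) + (x - f n))"
      unfolding eq norm_scaleR using dle[OF mid] by simp
    then have "(2 * d)\<^sup>2 \<le> (norm ((x - f m) + (x - f n)))\<^sup>2"
      using d0 by (intro power_mono) auto
    moreover have "(norm ((x - f m) + (x - f n)))\<^sup>2 + (norm (f m - f n))\<^sup>2
        = 2 * (norm (x - f m))\<^sup>2 + 2 * (norm (x - f n))\<^sup>2"
      by (simp add: power2_norm_eq_inner inner_add_left inner_add_right inner_diff_left
          inner_diff_right inner_commute algebra_simps)
    ultimately show ?thesis by simp
  qed
  have lim: "(\<lambda>n. norm (x - f n)) \<longlonglongrightarrow> d"
  proof (rule tendsto_sandwich[of "\<lambda>_. d" _ _ "\<lambda>n. d + 1 / real (Suc n)"])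
    show "(\<lambda>n. d + 1 / real (Suc n)) \<longlonglongrightarrow> d"
      using tendsto_add[OF tendsto_const[of d] LIMSEQ_Suc[OF lim_1_over_n]] by simp
  qed (use f dle in \<open>auto intro: less_imp_le always_eventually\<close>)
  have lim2: "(\<lambda>n. 2 * (norm (x - f n))\<^sup>2 - 2 * d\<^sup>2) \<longlonglongrightarrow> 0"
    using tendsto_diff[OF tendsto_mult[OF tendsto_const[of 2] tendsto_power[OF lim, of 2]]
        tendsto_const[of "2 * d\<^sup>2"]] by simp
  have "Cauchy f"
  proof (rule metric_CauchyI)
    fix e :: real assume e: "e > 0"
    have "\<forall>\<^sub>F n in sequentially. 2 * (norm (x - f n))\<^sup>2 - 2 * d\<^sup>2 < e\<^sup>2 / 2"
      by (rule order_tendstoD(2)[OF lim2]) (use e in auto)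
    then obtain k where k: "\<And>n. n \<ge> k \<Longrightarrow> 2 * (norm (x - f n))\<^sup>2 - 2 * d\<^sup>2 < e\<^sup>2 / 2"
      by (auto simp: eventually_sequentially)
    have "dist (f m) (f n) < e" if "m \<ge> k" "n \<ge> k" for m n
    proof -
      have "(norm (f m - f n))\<^sup>2 < e\<^sup>2"
        using par[of m n] k[OF that(1)] k[OF that(2)] by simp
      then show ?thesis
        using e by (simp add: dist_norm power2_less_imp_less)
    qed
    then show "\<exists>k. \<forall>m\<ge>k. \<forall>n\<ge>k. dist (f m) (f n) < e" by blast
  qed
  then obtain y where y: "f \<longlonglongrightarrow> y"
    using Cauchy_convergent convergent_def by blast
  have "y \<in> M"
    using closed_sequentially[OF D(5)] f(1) y by blast
  moreover have "norm (x - y) = d"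
    using LIMSEQ_unique[OF tendsto_norm[OF tendsto_diff[OF tendsto_const y]] lim] .
  ultimately show ?thesis
    using dle by auto
qed

lemma ortho_decomp_exists:
  fixes x :: "'a::chilbert_space"
  assumes M: "closed_csubspace M"
  shows "\<exists>y\<in>M. x - y \<in> ortho_compl M"
proof -
  note D = closed_csubspaceD[OF M]
  obtain y where y: "y \<in> M" "\<And>z. z \<in> M \<Longrightarrow> norm (x - y) \<le> norm (x - z)"
    using nearest_point_exists[OF M] by blast
  have real: "inner (x - y) z = 0" if z: "z \<in> M" for z
  proof (rule ccontr)
    assume ne: "inner (x - y) z \<noteq> 0"
    then have z0: "inner z z > 0" by auto
    \<comment> \<open>The minimizer over real \<open>t\<close> of the distance from
      \<open>x - y\<close> to the multiple of \<open>z\<close> by \<open>t\<close>.\<close>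
    define t where "t = inner (x - y) z / inner z z"
    have "norm (x - y) \<le> norm (x - (y + t *\<^sub>R z))"
      by (rule y(2)) (intro D y z)
    then have "inner (x - y) (x - y) \<le> inner (x - y - t *\<^sub>R z) (x - y - t *\<^sub>R z)"
      by (simp add: norm_le diff_diff_eq)
    also have "\<dots> = inner (x - y) (x - y) - 2 * t * inner (x - y) z + t * t * inner z z"
      by (simp add: inner_diff_left inner_diff_right inner_commute algebra_simps)
    finally have "2 * t * inner (x - y) z \<le> t * (t * inner z z)"
      by simp
    also have "t * inner z z = inner (x - y) z"
      using z0 by (simp add: t_def)
    finally have "t * inner (x - y) z \<le> 0" by simp
    moreover have "t * inner (x - y) z = (inner (x - y) z)\<^sup>2 / inner z z"
      by (simp add: t_def power2_eq_square)
    ultimately show False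
      using ne z0 by (simp add: divide_le_0_iff)
  qed
  \<comment> \<open>Real orthogonality to \<open>z\<close> and to \<i> times \<open>z\<close> gives
    the real and the imaginary part.\<close>
  have "cinner (x - y) z = 0" if z: "z \<in> M" for z
  proof -
    have "Re (cinner (x - y) z) = 0"
      using real[OF z] by (simp add: inner_cinner)
    moreover have "Re (cinner (x - y) (\<i> *\<^sub>C z)) = 0"
      using real[OF D(4)[OF z]] by (simp add: inner_cinner)
    ultimately show ?thesis
      by (simp add: cinner_scaleC_right complex_eq_iff)
  qed
  then show ?thesis
    using y(1) by (auto simp: ortho_compl_def)
qed

lemma ortho_proj_unique:
  fixes x :: "'a::complex_inner"
  assumes "closed_csubspace M" "y \<in> M" "\<And>z. z \<in> M \<Longrightarrow> cinner (x - y) z = 0"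
  shows "ortho_proj M x = y"
  unfolding ortho_proj_def
proof (rule the_equality)
  show "y \<in> M \<and> x - y \<in> ortho_compl M"
    using assms by (auto simp: ortho_compl_def)
  fix w assume w: "w \<in> M \<and> x - w \<in> ortho_compl M"
  have "y - w \<in> M"
    using assms w by (intro closed_csubspaceD) auto
  then have "cinner (x - w) (y - w) = 0" "cinner (x - y) (y - w) = 0"
    using assms w by (auto simp: ortho_compl_def)
  then have "cinner ((x - w) - (x - y)) (y - w) = 0"
    by (simp only: cinner_diff_left) simp
  then show "w = y" by simp
qed

lemma ortho_proj_in:
    "closed_csubspace M \<Longrightarrow> ortho_proj M x \<in> M"
  and ortho_proj_orth:
    "closed_csubspace M \<Longrightarrow> z \<in> M \<Longrightarrow> cinner (x - ortho_proj M x) z = 0"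
  for x :: "'a::chilbert_space"
proof -
  assume M: "closed_csubspace M"
  obtain y where y: "y \<in> M" "x - y \<in> ortho_compl M"
    using ortho_decomp_exists[OF M] by blast
  then have "ortho_proj M x = y"
    by (intro ortho_proj_unique[OF M]) (auto simp: ortho_compl_def)
  then show "ortho_proj M x \<in> M" "z \<in> M \<Longrightarrow> cinner (x - ortho_proj M x) z = 0"
    using y by (auto simp: ortho_compl_def)
qed

lemma ortho_proj_id: "closed_csubspace M \<Longrightarrow> x \<in> M \<Longrightarrow> ortho_proj M x = x"
  for x :: "'a::complex_inner"
  by (rule ortho_proj_unique) auto

lemma norm_ortho_proj_le:
  fixes x :: "'a::chilbert_space"
  assumes "closed_csubspace M"
  shows "norm (ortho_proj M x) \<le> norm x"
proof -
  let ?y = "ortho_proj M x"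
  have "cinner (x - ?y) ?y = 0"
    using assms by (intro ortho_proj_orth ortho_proj_in)
  then have "inner (x - ?y) ?y = 0" by (simp add: inner_cinner)
  then have "(norm x)\<^sup>2 = (norm ?y)\<^sup>2 + (norm (x - ?y))\<^sup>2"
    by (simp add: power2_norm_eq_inner inner_diff_left inner_diff_right inner_commute)
  then show ?thesis
    by (simp add: power2_le_imp_le)
qed

lemma bounded_clinear_ortho_proj:
  fixes M :: "'a::chilbert_space set"
  assumes M: "closed_csubspace M"
  shows "bounded_clinear (ortho_proj M)"
proof (rule bounded_clinearI[where K = 1])
  note D = closed_csubspaceD[OF M] and P = ortho_proj_in[OF M] and O = ortho_proj_orth[OF M]
  fix x y :: 'a and c
  show "ortho_proj M (x + y) = ortho_proj M x + ortho_proj M y"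
  proof (rule ortho_proj_unique[OF M])
    fix z assume "z \<in> M"
    then have "cinner (x - ortho_proj M x) z + cinner (y - ortho_proj M y) z = 0"
      by (simp add: O)
    then show "cinner (x + y - (ortho_proj M x + ortho_proj M y)) z = 0"
      by (simp add: cinner_diff_left cinner_add_left algebra_simps)
  qed (intro D P)
  show "ortho_proj M (c *\<^sub>C x) = c *\<^sub>C ortho_proj M x"
  proof (rule ortho_proj_unique[OF M])
    fix z assume "z \<in> M"
    then show "cinner (c *\<^sub>C x - c *\<^sub>C ortho_proj M x) z = 0"
      using O[of z x] by (simp add: cinner_diff_left cinner_scaleC_left)
  qed (intro D P)
qed (use norm_ortho_proj_le[OF M] in auto)

text \<open>Removing from a vector of \<open>N\<close> its projection to \<open>M\<close> leaves a
  vector of \<open>N\<close> orthogonal to \<open>M\<close>. This reduces density of a span to a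
  test on orthogonal vectors.\<close>

lemma closed_csubspace_eqI:
  fixes M :: "'a::chilbert_space set"
  assumes M: "closed_csubspace M" and "M \<subseteq> N"
    and N: "\<And>x y. x \<in> N \<Longrightarrow> y \<in> N \<Longrightarrow> x - y \<in> N"
    and orth: "\<And>x. x \<in> N \<Longrightarrow> (\<And>z. z \<in> M \<Longrightarrow> cinner x z = 0) \<Longrightarrow> x = 0"
  shows "M = N"
proof
  show "N \<subseteq> M"
  proof
    fix x assume x: "x \<in> N"
    have "x - ortho_proj M x \<in> N"
      using ortho_proj_in[OF M, of x] \<open>M \<subseteq> N\<close> by (intro N x) auto
    then have "x - ortho_proj M x = 0"
      by (rule orth) (rule ortho_proj_orth[OF M])
    then show "x \<in> M"
      using ortho_proj_in[OF M, of x] by simp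
  qed
qed fact

section \<open>Adjoints\<close>

lemma riesz_representation:
  fixes \<phi> :: "'a::chilbert_space \<Rightarrow> complex"
  assumes \<phi>: "bounded_clinear \<phi>"
  shows "\<exists>y. \<forall>x. \<phi> x = cinner x y"
proof -
  define M where "M = {x. \<phi> x = 0}"
  have M: "closed_csubspace M"
    unfolding M_def
    by (rule closed_csubspaceI)
      (auto simp: bounded_clinear_0 bounded_clinear_add bounded_clinear_scaleC \<phi>
        intro!: closed_Collect_eq continuous_on_bounded_clinear continuous_on_const)
  show ?thesis
  proof (cases "M = UNIV")
    case True
    then show ?thesis
      by (intro exI[of _ 0]) (auto simp: M_def)
  next
    case False
    then obtain x0 where x0: "x0 \<notin> M" by blast
    define z where "z = x0 - ortho_proj M x0"
    have "\<phi> (ortho_proj M x0) = 0"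
      using ortho_proj_in[OF M, of x0] by (simp add: M_def)
    then have \<phi>z: "\<phi> z \<noteq> 0"
      using x0 by (simp add: z_def bounded_clinear_diff[OF \<phi>] M_def)
    then have z0: "cinner z z \<noteq> 0"
      using bounded_clinear_0[OF \<phi>] by auto
    have "\<phi> x = cinner x (cnj (\<phi> z / cinner z z) *\<^sub>C z)" for x
    proof -
      have "x - (\<phi> x / \<phi> z) *\<^sub>C z \<in> M"
        using \<phi>z by (simp add: M_def bounded_clinear_diff[OF \<phi>] bounded_clinear_scaleC[OF \<phi>]
            scaleC_complex_def)
      then have "cinner z (x - (\<phi> x / \<phi> z) *\<^sub>C z) = 0"
        unfolding z_def by (rule ortho_proj_orth[OF M])
      then have "cinner (x - (\<phi> x / \<phi> z) *\<^sub>C z) z = 0"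
        by (simp add: cinner_commute_0)
      then have "cinner x z = \<phi> x / \<phi> z * cinner z z"
        by (simp add: cinner_diff_left cinner_scaleC_left)
      then show ?thesis
        using \<phi>z z0 by (simp add: cinner_scaleC_right)
    qed
    then show ?thesis by blast
  qed
qed

lemma cadjointI:
  assumes "\<And>x y. cinner (A x) y = cinner x (B y)"
  shows "cadjoint A = B"
  unfolding cadjoint_def
proof (intro the_equality allI assms)
  show "B' = B" if "\<forall>x y. cinner (A x) y = cinner x (B' y)" for B'
  proof (rule ext, rule cinner_eqI_right)
    show "cinner z (B' y) = cinner z (B y)" for y z
      by (rule trans[OF that[rule_format, symmetric] assms])
  qed
qed

lemma cinner_cadjoint:
  fixes A :: "'a::chilbert_space \<Rightarrow> 'b::complex_inner"
  assumes A: "bounded_clinear A"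
  shows "cinner (A x) y = cinner x (cadjoint A y)"
proof -
  have "\<exists>z. \<forall>x. cinner (A x) y = cinner x z" for y
  proof (rule riesz_representation)
    obtain K where K: "K > 0" "\<And>x. norm (A x) \<le> K * norm x"
      using bounded_clinear_pos_bounded[OF A] by blast
    show "bounded_clinear (\<lambda>x. cinner (A x) y)"
    proof (rule bounded_clinearI)
      show "cmod (cinner (A x) y) \<le> (K * norm y) * norm x" for x
        using norm_cinner_le[of "A x" y] mult_right_mono[OF K(2)[of x], of "norm y"]
        by (simp add: mult_ac)
    qed (simp_all add: bounded_clinear_add[OF A] bounded_clinear_scaleC[OF A] cinner_add_left
        cinner_scaleC_left scaleC_complex_def)
  qed
  then obtain B where B: "\<forall>y. \<forall>x. cinner (A x) y = cinner x (B y)"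
    by (rule choice[THEN exE, OF allI])
  then have "cadjoint A = B"
    by (intro cadjointI) simp
  with B show ?thesis by simp
qed

lemma cinner_cadjoint': "bounded_clinear A \<Longrightarrow> cinner (cadjoint A y) x = cinner y (A x)"
  for A :: "'a::chilbert_space \<Rightarrow> 'b::complex_inner"
  using cinner_cadjoint[of A x y] cinner_commute[of "cadjoint A y" x] cinner_commute[of y "A x"]
  by simp

lemma norm_cadjoint_le:
  fixes A :: "'a::chilbert_space \<Rightarrow> 'b::complex_inner"
  assumes A: "bounded_clinear A" and K: "\<And>x. norm (A x) \<le> K * norm x" "K \<ge> 0"
  shows "norm (cadjoint A y) \<le> K * norm y"
proof (cases "cadjoint A y = 0")
  case False
  have "(norm (cadjoint A y))\<^sup>2 = Re (cinner (A (cadjoint A y)) y)"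
    by (simp add: cinner_cadjoint[OF A] cinner_self)
  also have "\<dots> \<le> norm (A (cadjoint A y)) * norm y"
    using norm_cinner_le[of "A (cadjoint A y)" y] complex_Re_le_cmod order_trans by blast
  also have "\<dots> \<le> (K * norm (cadjoint A y)) * norm y"
    by (intro mult_right_mono K) auto
  finally show ?thesis
    using False by (simp add: power2_eq_square)
qed (use K in simp)

lemma bounded_clinear_cadjoint:
  fixes A :: "'a::chilbert_space \<Rightarrow> 'b::complex_inner"
  assumes A: "bounded_clinear A"
  shows "bounded_clinear (cadjoint A)"
proof -
  note adj = cinner_cadjoint[OF A, symmetric]
  obtain K where "K > 0" "\<And>x. norm (A x) \<le> K * norm x"
    using bounded_clinear_pos_bounded[OF A] by blast
  then show ?thesis
    by (intro bounded_clinearI[where K = K] norm_cadjoint_le A)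
      (auto intro!: cinner_eqI_right[where 'a = 'a] simp: adj cinner_add_right cinner_scaleC_right)
qed

section \<open>Positive operators and square roots\<close>

lemma positive_op_Re: "positive_op A \<Longrightarrow> 0 \<le> Re (cinner (A x) x)"
  and positive_op_Im: "positive_op A \<Longrightarrow> Im (cinner (A x) x) = 0"
  by (auto simp: positive_op_def complex_nonneg_Reals_iff)

text \<open>Polarization: the quadratic form is real, and evaluating it at x + y and at x + \<i> y
  determines both parts of the sesquilinear form.\<close>

lemma positive_op_selfadjoint:
  assumes A: "bounded_clinear A" and pos: "positive_op A"
  shows "cinner (A x) y = cinner x (A y)"
proof -
  have 1: "Im (cinner (A x) y + cinner (A y) x) = 0" for x y
    using positive_op_Im[OF pos, of "x + y"] positive_op_Im[OF pos, of x]
      positive_op_Im[OF pos, of y]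
    by (simp add: bounded_clinear_add[OF A] cinner_add_left cinner_add_right)
  have "Im (cinner (A x) y) = - Im (cinner (A y) x)"
    using 1[of x y] by simp
  moreover have "Re (cinner (A x) y) = Re (cinner (A y) x)"
    using 1[of x "\<i> *\<^sub>C y"]
    by (simp add: bounded_clinear_scaleC[OF A] cinner_scaleC_left cinner_scaleC_right)
  ultimately have "cinner (A x) y = cnj (cinner (A y) x)"
    by (simp add: complex_eq_iff)
  then show ?thesis
    using cinner_commute[of x "A y"] by simp
qed

lemma positive_op_kernel:
  assumes A: "bounded_clinear A" and pos: "positive_op A" and z: "cinner (A z) z = 0"
  shows "A z = 0"
proof (rule ccontr)
  assume "A z \<noteq> 0"
  define a where "a = (norm (A z))\<^sup>2"
  define c where "c = Re (cinner (A (A z)) (A z))"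
  have a: "a > 0" using \<open>A z \<noteq> 0\<close> by (simp add: a_def)
  have c: "c \<ge> 0" using positive_op_Re[OF pos] by (simp add: c_def)
  \<comment> \<open>The quadratic 2 t a + t^2 c is negative for small negative t. The denominator
    \<open>c + 1\<close> instead of \<open>c\<close> covers \<open>c = 0\<close>.\<close>
  define t where "t = - (a / (c + 1))"
  have sa: "cinner (A (A z)) z = cinner (A z) (A z)"
    by (rule positive_op_selfadjoint[OF A pos])
  have "Re (cinner (A (z + complex_of_real t *\<^sub>C A z)) (z + complex_of_real t *\<^sub>C A z))
      = 2 * t * a + t\<^sup>2 * c"
    using z by (simp add: bounded_clinear_add[OF A] bounded_clinear_scaleC[OF A] cinner_add_left
        cinner_add_right cinner_scaleC_left cinner_scaleC_right sa cinner_self a_def c_def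
        power2_eq_square algebra_simps)
  then have "0 \<le> 2 * t * a + t\<^sup>2 * c"
    using positive_op_Re[OF pos, of "z + complex_of_real t *\<^sub>C A z"] by simp
  also have "2 * t * a + t\<^sup>2 * c = - (a\<^sup>2 * (c + 2) / (c + 1)\<^sup>2)"
    using c by (simp add: t_def power2_eq_square divide_simps) (simp add: algebra_simps)
  also have "\<dots> < 0"
    using a c by simp
  finally show False by simp
qed

text \<open>The square root of \<open>I - A\<close>, for a self-adjoint contraction \<open>A\<close>, is \<open>I - B\<close> with \<open>B\<close> the limit of
  the iteration below, which solves \<open>2 B = A + B\<^sup>2\<close>. The same iteration on the scalar 1 dominates
  all increments in norm.\<close>

primrec sqrt_iter :: "('a::real_vector \<Rightarrow> 'a) \<Rightarrow> nat \<Rightarrow> 'a \<Rightarrow> 'a" where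
  "sqrt_iter A 0 = (\<lambda>x. 0)"
| "sqrt_iter A (Suc n) = (\<lambda>x. (1/2) *\<^sub>R (A x + sqrt_iter A n (sqrt_iter A n x)))"

primrec sqrt_bound :: "nat \<Rightarrow> real" where
  "sqrt_bound 0 = 0"
| "sqrt_bound (Suc n) = (1 + (sqrt_bound n)\<^sup>2) / 2"

definition sqrt_lim :: "('a::real_normed_vector \<Rightarrow> 'a) \<Rightarrow> 'a \<Rightarrow> 'a" where
  "sqrt_lim A x = lim (\<lambda>n. sqrt_iter A n x)"

lemma sqrt_bound_range: "0 \<le> sqrt_bound n" "sqrt_bound n \<le> 1"
proof -
  have "0 \<le> sqrt_bound n \<and> sqrt_bound n \<le> 1"
    by (induction n) (auto simp: power_le_one)
  then show "0 \<le> sqrt_bound n" "sqrt_bound n \<le> 1" by auto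
qed

lemma sqrt_bound_mono: "sqrt_bound n \<le> sqrt_bound (Suc n)"
  by (induction n) (auto simp: sqrt_bound_range intro: power_mono)

lemma sqrt_bound_Cauchy: "Cauchy sqrt_bound"
proof -
  have inc: "incseq sqrt_bound"
    by (rule incseq_SucI) (rule sqrt_bound_mono)
  have "Bseq sqrt_bound"
    by (rule BseqI'[where K = 1]) (simp add: sqrt_bound_range)
  then have "convergent sqrt_bound"
    using inc by (intro Bseq_mono_convergent) (auto simp: incseq_def)
  then show ?thesis by (rule convergent_Cauchy)
qed

context
  fixes A :: "'a::chilbert_space \<Rightarrow> 'a"
  assumes A: "bounded_clinear A" and contr: "\<And>x. norm (A x) \<le> norm x"
begin

lemma bounded_clinear_sqrt_iter: "bounded_clinear (sqrt_iter A n)"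
  by (induction n) (auto intro!: bounded_clinear_intros A intro: bounded_clinear_compose)

lemma norm_sqrt_iter: "norm (sqrt_iter A n x) \<le> sqrt_bound n * norm x"
proof (induction n arbitrary: x)
  case (Suc n)
  have "norm (sqrt_iter A n (sqrt_iter A n x)) \<le> sqrt_bound n * (sqrt_bound n * norm x)"
    using Suc[of "sqrt_iter A n x"] mult_left_mono[OF Suc[of x] sqrt_bound_range(1)[of n]]
    by linarith
  then have "norm (A x + sqrt_iter A n (sqrt_iter A n x))
      \<le> norm x + sqrt_bound n * (sqrt_bound n * norm x)"
    by (intro norm_triangle_le add_mono contr)
  then show ?case
    by (simp add: power2_eq_square algebra_simps del: scaleR_right_distrib)
qed simp

lemma norm_sqrt_iter_le: "norm (sqrt_iter A n x) \<le> norm x"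
  using norm_sqrt_iter[of n x] mult_right_mono[OF sqrt_bound_range(2)[of n], of "norm x"] by simp

text \<open>Writing b' b' - b b = (b' - b) b' + b (b' - b) and estimating both terms reproduces the
  scalar factorization of s'^2 - s^2, so operator increments stay below the scalar ones.\<close>

lemma norm_sqrt_iter_Suc_diff:
  "norm (sqrt_iter A (Suc n) x - sqrt_iter A n x) \<le> (sqrt_bound (Suc n) - sqrt_bound n) * norm x"
proof (induction n arbitrary: x)
  case 0
  then show ?case using contr[of x] by simp
next
  case (Suc n)
  let ?b = "sqrt_iter A n" and ?b' = "sqrt_iter A (Suc n)"
  let ?s = "sqrt_bound n" and ?s' = "sqrt_bound (Suc n)"
  have d: "0 \<le> ?s' - ?s" using sqrt_bound_mono[of n] by (simp del: sqrt_bound.simps)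
  have "sqrt_iter A (Suc (Suc n)) x - ?b' x = (1/2) *\<^sub>R (?b' (?b' x) - ?b (?b x))"
    by (simp add: algebra_simps)
  also have "?b' (?b' x) - ?b (?b x) = (?b' (?b' x) - ?b (?b' x)) + ?b (?b' x - ?b x)"
    by (simp add: bounded_clinear_diff[OF bounded_clinear_sqrt_iter] del: sqrt_iter.simps)
  also have "norm ((1/2) *\<^sub>R ((?b' (?b' x) - ?b (?b' x)) + ?b (?b' x - ?b x)))
      \<le> (1/2) * ((?s' - ?s) * (?s' * norm x) + ?s * ((?s' - ?s) * norm x))"
  proof -
    have "norm (?b' (?b' x) - ?b (?b' x)) \<le> (?s' - ?s) * (?s' * norm x)"
      using Suc[of "?b' x"] mult_left_mono[OF norm_sqrt_iter[of "Suc n" x] d] by linarith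
    moreover have "norm (?b (?b' x - ?b x)) \<le> ?s * ((?s' - ?s) * norm x)"
      using norm_sqrt_iter[of n "?b' x - ?b x"]
        mult_left_mono[OF Suc[of x] sqrt_bound_range(1)[of n]] by linarith
    ultimately show ?thesis
      using norm_triangle_ineq[of "?b' (?b' x) - ?b (?b' x)" "?b (?b' x - ?b x)"]
      by (simp del: sqrt_iter.simps sqrt_bound.simps)
  qed
  also have "\<dots> = (sqrt_bound (Suc (Suc n)) - ?s') * norm x"
    unfolding sqrt_bound.simps(2)[of "Suc n"] sqrt_bound.simps(2)[of n]
    by (simp add: power2_eq_square field_simps)
  finally show ?case .
qed

lemma norm_sqrt_iter_diff:
  "norm (sqrt_iter A (n + k) x - sqrt_iter A n x) \<le> (sqrt_bound (n + k) - sqrt_bound n) * norm x"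
proof (induction k)
  case (Suc k)
  have "norm (sqrt_iter A (n + Suc k) x - sqrt_iter A n x)
      \<le> norm (sqrt_iter A (Suc (n + k)) x - sqrt_iter A (n + k) x)
        + norm (sqrt_iter A (n + k) x - sqrt_iter A n x)"
    using norm_triangle_ineq[of "sqrt_iter A (Suc (n + k)) x - sqrt_iter A (n + k) x"
        "sqrt_iter A (n + k) x - sqrt_iter A n x"] by (simp del: sqrt_iter.simps)
  also have "\<dots> \<le> (sqrt_bound (Suc (n + k)) - sqrt_bound (n + k)) * norm x
      + (sqrt_bound (n + k) - sqrt_bound n) * norm x"
    by (intro add_mono norm_sqrt_iter_Suc_diff Suc)
  finally show ?case
    by (simp add: left_diff_distrib del: sqrt_bound.simps)
qed simp

lemma sqrt_iter_tendsto: "(\<lambda>n. sqrt_iter A n x) \<longlonglongrightarrow> sqrt_lim A x"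
proof -
  have "Cauchy (\<lambda>n. sqrt_iter A n x)"
  proof (rule metric_CauchyI)
    fix e :: real assume e: "e > 0"
    define d where "d = e / (norm x + 1)"
    have "d > 0" using e by (simp add: d_def add_nonneg_pos)
    then obtain M where M: "\<And>m n. m \<ge> M \<Longrightarrow> n \<ge> M \<Longrightarrow> dist (sqrt_bound m) (sqrt_bound n) < d"
      using sqrt_bound_Cauchy unfolding Cauchy_def by blast
    have half: "dist (sqrt_iter A m x) (sqrt_iter A n x) < e" if "m \<ge> n" "n \<ge> M" for m n
    proof -
      obtain k where k: "m = n + k" using \<open>m \<ge> n\<close> le_iff_add by blast
      have "sqrt_bound (n + k) - sqrt_bound n \<le> d"
        using M[of m n] that k by (auto simp: dist_real_def)
      then have "dist (sqrt_iter A m x) (sqrt_iter A n x) \<le> d * norm x"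
        using norm_sqrt_iter_diff[of n k x] mult_right_mono[of _ d "norm x"]
        by (simp add: k dist_norm) (meson norm_ge_zero order_trans mult_right_mono)
      also have "\<dots> < d * (norm x + 1)" using \<open>d > 0\<close> by simp
      also have "\<dots> = e" by (simp add: d_def add_nonneg_eq_0_iff)
      finally show ?thesis .
    qed
    then have "dist (sqrt_iter A m x) (sqrt_iter A n x) < e" if "m \<ge> M" "n \<ge> M" for m n
      using half[of m n] half[of n m] that by (cases "m \<ge> n") (auto simp: dist_commute)
    then show "\<exists>M. \<forall>m\<ge>M. \<forall>n\<ge>M. dist (sqrt_iter A m x) (sqrt_iter A n x) < e" by blast
  qed
  then show ?thesis
    using Cauchy_convergent convergent_LIMSEQ_iff sqrt_lim_def by metis
qed

lemma sqrt_lim_unique: "(\<lambda>n. sqrt_iter A n x) \<longlonglongrightarrow> y \<Longrightarrow> sqrt_lim A x = y"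
  using sqrt_iter_tendsto LIMSEQ_unique by blast

lemma norm_sqrt_lim_le: "norm (sqrt_lim A x) \<le> norm x"
  by (rule Lim_bounded[OF tendsto_norm[OF sqrt_iter_tendsto], where M = 0])
    (auto simp: norm_sqrt_iter_le)

lemma bounded_clinear_sqrt_lim: "bounded_clinear (sqrt_lim A)"
proof (rule bounded_clinearI[where K = 1])
  show "sqrt_lim A (x + y) = sqrt_lim A x + sqrt_lim A y" for x y
    by (rule sqrt_lim_unique)
      (simp add: bounded_clinear_add[OF bounded_clinear_sqrt_iter]
        tendsto_add sqrt_iter_tendsto)
  show "sqrt_lim A (c *\<^sub>C x) = c *\<^sub>C sqrt_lim A x" for c x
    by (rule sqrt_lim_unique)
      (simp add: bounded_clinear_scaleC[OF bounded_clinear_sqrt_iter]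
        tendsto_bounded_clinear[OF bounded_clinear_scaleC_const[OF bounded_clinear_id(1)]]
        sqrt_iter_tendsto)
qed (use norm_sqrt_lim_le in simp)

lemma sqrt_lim_fixpoint: "2 *\<^sub>R sqrt_lim A x = A x + sqrt_lim A (sqrt_lim A x)"
proof -
  \<comment> \<open>Pointwise convergence does not by itself pass to compositions; that all iterates
    are contractions does it.\<close>
  have "(\<lambda>n. sqrt_iter A n (sqrt_iter A n x - sqrt_lim A x)) \<longlonglongrightarrow> 0"
  proof (rule Lim_null_comparison)
    show "\<forall>\<^sub>F n in sequentially. norm (sqrt_iter A n (sqrt_iter A n x - sqrt_lim A x))
        \<le> norm (sqrt_iter A n x - sqrt_lim A x)"
      by (intro always_eventually allI norm_sqrt_iter_le)
    show "(\<lambda>n. norm (sqrt_iter A n x - sqrt_lim A x)) \<longlonglongrightarrow> 0"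
      using tendsto_norm[OF tendsto_diff[OF sqrt_iter_tendsto[of x] tendsto_const[of "sqrt_lim A x"]]]
      by simp
  qed
  from tendsto_add[OF this sqrt_iter_tendsto[of "sqrt_lim A x"]]
  have "(\<lambda>n. sqrt_iter A n (sqrt_iter A n x)) \<longlonglongrightarrow> sqrt_lim A (sqrt_lim A x)"
    by (simp add: bounded_clinear_diff[OF bounded_clinear_sqrt_iter])
  then have "(\<lambda>n. sqrt_iter A (Suc n) x) \<longlonglongrightarrow> (1/2) *\<^sub>R (A x + sqrt_lim A (sqrt_lim A x))"
    by (auto intro!: tendsto_intros)
  then have "sqrt_lim A x = (1/2) *\<^sub>R (A x + sqrt_lim A (sqrt_lim A x))"
    using LIMSEQ_unique LIMSEQ_Suc[OF sqrt_iter_tendsto[of x]] by blast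
  then show ?thesis by (metis scaleR_half_double scaleR_2 scaleR_right_distrib)
qed

end

text \<open>The iterates for \<open>A\<close> and \<open>B\<close> are the same polynomials in
  \<open>A\<close> and \<open>B\<close>, so \<open>C\<close> carries one to the other. It serves
  twice: to make a competing square root commute with the constructed one, and to relate the two
  defect operators.\<close>

lemma sqrt_lim_intertwine:
  fixes A :: "'a::chilbert_space \<Rightarrow> 'a" and B :: "'b::chilbert_space \<Rightarrow> 'b"
  assumes A: "bounded_clinear A" "\<And>x. norm (A x) \<le> norm x"
    and B: "bounded_clinear B" "\<And>x. norm (B x) \<le> norm x"
    and C: "bounded_clinear C" and eq: "\<And>x. C (A x) = B (C x)"
  shows "C (sqrt_lim A x) = sqrt_lim B (C x)"
proof -
  have "C (sqrt_iter A n x) = sqrt_iter B n (C x)" for n x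
    by (induction n arbitrary: x)
      (simp_all add: bounded_clinear_0[OF C] bounded_clinear_add[OF C] eq scaleR_scaleC
        bounded_clinear_scaleC[OF C])
  then have "(\<lambda>n. sqrt_iter B n (C x)) \<longlonglongrightarrow> C (sqrt_lim A x)"
    using tendsto_bounded_clinear[OF C sqrt_iter_tendsto[OF A, of x]] by simp
  then show ?thesis
    using sqrt_lim_unique[OF B] by metis
qed

lemma sqrt_lim_selfadjoint:
  fixes A :: "'a::chilbert_space \<Rightarrow> 'a"
  assumes A: "bounded_clinear A" "\<And>x. norm (A x) \<le> norm x"
    and sa: "\<And>x y. cinner (A x) y = cinner x (A y)"
  shows "cinner (sqrt_lim A x) y = cinner x (sqrt_lim A y)"
proof (rule LIMSEQ_unique)
  have "cinner (sqrt_iter A n x) y = cinner x (sqrt_iter A n y)" for n x y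
    by (induction n arbitrary: x y)
      (simp_all add: cinner_add_left cinner_add_right sa scaleR_scaleC cinner_scaleC_left
        cinner_scaleC_right)
  then show "(\<lambda>n. cinner (sqrt_iter A n x) y) \<longlonglongrightarrow> cinner x (sqrt_lim A y)"
    by (simp add: tendsto_cinner sqrt_iter_tendsto[OF A])
qed (intro tendsto_cinner sqrt_iter_tendsto[OF A] tendsto_const)

text \<open>The fixed point equation of \<open>sqrt_lim\<close> makes the square of I -
  \<open>sqrt_lim A\<close> equal to I - A. Positivity holds because \<open>sqrt_lim A\<close> is a
  self-adjoint contraction.\<close>

lemma op_sqrt_eq:
  fixes A :: "'a::chilbert_space \<Rightarrow> 'a"
  assumes A: "bounded_clinear A" "\<And>x. norm (A x) \<le> norm x"
    and sa: "\<And>x y. cinner (A x) y = cinner x (A y)"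
  shows "op_sqrt (\<lambda>x. x - A x) = (\<lambda>x. x - sqrt_lim A x)"
    and "positive_op (\<lambda>x. x - sqrt_lim A x)"
    and "\<And>x. (x - sqrt_lim A x) - sqrt_lim A (x - sqrt_lim A x) = x - A x"
proof -
  let ?S = "\<lambda>x. x - sqrt_lim A x"
  have S: "bounded_clinear ?S"
    by (intro bounded_clinear_intros bounded_clinear_id bounded_clinear_sqrt_lim A)
  show sq: "?S x - sqrt_lim A (?S x) = x - A x" for x
    using sqrt_lim_fixpoint[OF A, of x]
    by (simp add: bounded_clinear_diff[OF bounded_clinear_sqrt_lim[OF A]] scaleR_2 algebra_simps)
  show pos: "positive_op ?S"
    unfolding positive_op_def
  proof
    fix x
    have "cinner (sqrt_lim A x) x = cnj (cinner (sqrt_lim A x) x)"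
      by (rule trans[OF sqrt_lim_selfadjoint[OF A sa] cinner_commute])
    then have "Im (cinner (sqrt_lim A x) x) = 0"
      by (simp add: complex_eq_iff)
    moreover have "Re (cinner (sqrt_lim A x) x) \<le> (norm x)\<^sup>2"
    proof -
      have "Re (cinner (sqrt_lim A x) x) \<le> norm (sqrt_lim A x) * norm x"
        using norm_cinner_le complex_Re_le_cmod order_trans by blast
      also have "\<dots> \<le> norm x * norm x"
        by (intro mult_right_mono norm_sqrt_lim_le A) auto
      finally show ?thesis by (simp add: power2_eq_square)
    qed
    ultimately show "cinner (?S x) x \<in> \<real>\<^sub>\<ge>\<^sub>0"
      by (simp add: complex_nonneg_Reals_iff cinner_diff_left cinner_self)
  qed
  show "op_sqrt (\<lambda>x. x - A x) = ?S"
    unfolding op_sqrt_def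
  proof (rule the_equality)
    show "bounded_clinear ?S \<and> positive_op ?S \<and> ?S \<circ> ?S = (\<lambda>x. x - A x)"
      using S pos sq by (simp add: fun_eq_iff)
    fix B assume "bounded_clinear B \<and> positive_op B \<and> B \<circ> B = (\<lambda>x. x - A x)"
    then have B: "bounded_clinear B" and Bpos: "positive_op B" and Bsq: "\<And>x. B (B x) = x - A x"
      by (auto simp: fun_eq_iff)
    have "B (A x) = A (B x)" for x
    proof -
      have "A x = x - B (B x)" for x using Bsq[of x] by simp
      then show ?thesis by (simp add: bounded_clinear_diff[OF B])
    qed
    then have comm: "B (sqrt_lim A x) = sqrt_lim A (B x)" for x
      by (rule sqrt_lim_intertwine[OF A A B])
    show "B = ?S"
    proof
      fix x
      \<comment> \<open>The two roots commute and have equal squares, so (S + B) y = 0. Both are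
        positive, hence S y = B y = 0, and moving S - B across the inner product shows that y is
        orthogonal to itself.\<close>
      define y where "y = ?S x - B x"
      have "?S y + B y = 0"
        using sq[of x] Bsq[of x] unfolding y_def
        by (simp add: bounded_clinear_diff[OF B]
            bounded_clinear_diff[OF bounded_clinear_sqrt_lim[OF A]] comm)
      then have sum0: "cinner (?S y) y + cinner (B y) y = 0"
        by (simp flip: cinner_add_left)
      have "cinner (?S y) y = 0" "cinner (B y) y = 0"
        using arg_cong[OF sum0, of Re] positive_op_Re[OF pos, of y] positive_op_Re[OF Bpos, of y]
          positive_op_Im[OF pos, of y] positive_op_Im[OF Bpos, of y]
        by (simp_all add: complex_eq_iff)
      then have "?S y = 0" "B y = 0"
        using positive_op_kernel[OF S pos] positive_op_kernel[OF B Bpos] by auto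
      then have "cinner (?S x) y = 0" "cinner (B x) y = 0"
        using positive_op_selfadjoint[OF S pos, of x y] positive_op_selfadjoint[OF B Bpos, of x y]
        by auto
      then have "cinner (?S x - B x) y = 0"
        by (simp add: cinner_diff_left)
      then have "y = 0"
        by (simp add: y_def)
      then show "B x = ?S x" by (simp add: y_def)
    qed
  qed
qed

section \<open>Unitary operators between closed subspaces\<close>

text \<open>Equal Gram forms give equal distances, so \<open>Q\<close> turns a Cauchy sequence of
  \<open>P\<close>-values into a Cauchy sequence. With \<open>P\<close> and \<open>Q\<close>
  exchanged it yields surjectivity of the extension below.\<close>

lemma isometric_sequences_Cauchy:
  fixes P :: "'v::complex_inner \<Rightarrow> 'a::chilbert_space" and Q :: "'v \<Rightarrow> 'b::chilbert_space"
  assumes P: "bounded_clinear P" and Q: "bounded_clinear Q"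
    and eq: "\<And>v w. cinner (P v) (P w) = cinner (Q v) (Q w)" and x: "x \<in> closure (range P)"
  obtains v y where "(\<lambda>n. P (v n)) \<longlonglongrightarrow> x" "(\<lambda>n. Q (v n)) \<longlonglongrightarrow> y"
proof -
  obtain f where f: "\<And>n. f n \<in> range P" "f \<longlonglongrightarrow> x"
    using x unfolding closure_sequential by blast
  then have "\<forall>n. \<exists>v. f n = P v" by blast
  then obtain v where v: "\<And>n. f n = P (v n)" by metis
  have "dist (Q a) (Q b) = dist (P a) (P b)" for a b
    using norm_eq_if_cinner_eq[OF eq[of "a - b" "a - b"]]
    by (simp add: dist_norm bounded_clinear_diff[OF P] bounded_clinear_diff[OF Q])
  moreover have "Cauchy (\<lambda>n. P (v n))"
    using LIMSEQ_imp_Cauchy[OF f(2)] by (simp flip: v)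
  ultimately have "Cauchy (\<lambda>n. Q (v n))"
    by (simp add: Cauchy_def)
  then obtain y where "(\<lambda>n. Q (v n)) \<longlonglongrightarrow> y"
    using Cauchy_convergent convergent_def by blast
  moreover have "(\<lambda>n. P (v n)) \<longlonglongrightarrow> x"
    using f(2) by (simp flip: v)
  ultimately show thesis by (rule that[rotated])
qed

lemma isometry_extension:
  fixes P :: "'v::complex_inner \<Rightarrow> 'a::chilbert_space" and Q :: "'v \<Rightarrow> 'b::chilbert_space"
  assumes P: "bounded_clinear P" and Q: "bounded_clinear Q"
    and eq: "\<And>v w. cinner (P v) (P w) = cinner (Q v) (Q w)"
  obtains W where "unitary_between (closure (range P)) (closure (range Q)) W" "\<And>v. W (P v) = Q v"
proof -
  let ?X = "closure (range P)" and ?Y = "closure (range Q)"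
  have X: "closed_csubspace ?X"
    by (intro closed_csubspace_closure csubspace_range P)
  \<comment> \<open>The closure of the graph of P v \<mapsto> Q v. That it is single-valued follows
    from preservation of inner products along it.\<close>
  define G where "G x y \<longleftrightarrow> (\<exists>v. (\<lambda>n. P (v n)) \<longlonglongrightarrow> x \<and> (\<lambda>n. Q (v n)) \<longlonglongrightarrow> y)" for x y
  have G_cinner: "cinner x x' = cinner y y'" if G: "G x y" "G x' y'" for x y x' y'
  proof -
    obtain v where v: "(\<lambda>n. P (v n)) \<longlonglongrightarrow> x" "(\<lambda>n. Q (v n)) \<longlonglongrightarrow> y"
      using G(1) unfolding G_def by auto
    obtain v' where v': "(\<lambda>n. P (v' n)) \<longlonglongrightarrow> x'" "(\<lambda>n. Q (v' n)) \<longlonglongrightarrow> y'"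
      using G(2) unfolding G_def by auto
    show ?thesis
      by (rule LIMSEQ_unique[OF tendsto_cinner[OF v(1) v'(1)]])
        (use tendsto_cinner[OF v(2) v'(2)] in \<open>simp add: eq\<close>)
  qed
  have G_add: "G (x + x') (y + y')" if G: "G x y" "G x' y'" for x y x' y'
  proof -
    obtain v where v: "(\<lambda>n. P (v n)) \<longlonglongrightarrow> x" "(\<lambda>n. Q (v n)) \<longlonglongrightarrow> y"
      using G(1) unfolding G_def by auto
    obtain v' where "(\<lambda>n. P (v' n)) \<longlonglongrightarrow> x'" "(\<lambda>n. Q (v' n)) \<longlonglongrightarrow> y'"
      using G(2) unfolding G_def by auto
    with v show ?thesis
      unfolding G_def
      by (intro exI[of _ "\<lambda>n. v n + v' n"])
        (simp add: bounded_clinear_add[OF P] bounded_clinear_add[OF Q] tendsto_add)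
  qed
  have G_scaleC: "G (c *\<^sub>C x) (c *\<^sub>C y)" if G: "G x y" for c x y
  proof -
    obtain v where "(\<lambda>n. P (v n)) \<longlonglongrightarrow> x" "(\<lambda>n. Q (v n)) \<longlonglongrightarrow> y"
      using G unfolding G_def by auto
    then show ?thesis
      unfolding G_def
      by (intro exI[of _ "\<lambda>n. c *\<^sub>C v n"])
        (simp add: bounded_clinear_scaleC[OF P] bounded_clinear_scaleC[OF Q]
          tendsto_bounded_clinear[OF bounded_clinear_scaleC_const[OF bounded_clinear_id(1)]])
  qed
  have G_ex: "\<exists>y. G x y" if "x \<in> ?X" for x
    by (rule isometric_sequences_Cauchy[OF P Q eq that]) (auto simp: G_def)
  have G_ex': "\<exists>x. G x y" if "y \<in> ?Y" for y
    by (rule isometric_sequences_Cauchy[OF Q P eq[symmetric] that]) (auto simp: G_def)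
  have G_in: "x \<in> ?X" "y \<in> ?Y" if G: "G x y" for x y
  proof -
    obtain v where "(\<lambda>n. P (v n)) \<longlonglongrightarrow> x" "(\<lambda>n. Q (v n)) \<longlonglongrightarrow> y"
      using G unfolding G_def by auto
    then show "x \<in> ?X" "y \<in> ?Y"
      unfolding closure_sequential
      by (auto intro: exI[of _ "\<lambda>n. P (v n)"] exI[of _ "\<lambda>n. Q (v n)"])
  qed
  have G_unique: "y = y'" if "G x y" "G x y'" for x y y'
  proof -
    have "G (x + (- 1) *\<^sub>C x) (y + (- 1) *\<^sub>C y')"
      by (intro G_add G_scaleC that)
    then have "G 0 (y - y')" by (simp add: scaleC_minus1)
    from G_cinner[OF this this] show ?thesis by simp
  qed
  \<comment> \<open>Projecting first extends the operator by zero to the whole ambient type, as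
    \<open>unitary_between\<close> demands.\<close>
  define W where "W x = (THE y. G (ortho_proj ?X x) y)" for x
  have W: "W x = y" if "G x y" for x y
    unfolding W_def ortho_proj_id[OF X G_in(1)[OF that]]
    by (rule the_equality[of "G x", OF that]) (rule G_unique[OF _ that])
  have GW: "G (ortho_proj ?X x) (W x)" for x
  proof -
    obtain y where y: "G (ortho_proj ?X x) y"
      using G_ex[OF ortho_proj_in[OF X]] by blast
    show ?thesis
      unfolding W_def by (rule theI[of "G (ortho_proj ?X x)", OF y]) (rule G_unique[OF _ y])
  qed
  have "W (x + y) = W x + W y" for x y
  proof (rule G_unique[OF GW])
    show "G (ortho_proj ?X (x + y)) (W x + W y)"
      unfolding bounded_clinear_add[OF bounded_clinear_ortho_proj[OF X]] by (intro G_add GW)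
  qed
  moreover have "W (c *\<^sub>C x) = c *\<^sub>C W x" for c x
  proof (rule G_unique[OF GW])
    show "G (ortho_proj ?X (c *\<^sub>C x)) (c *\<^sub>C W x)"
      unfolding bounded_clinear_scaleC[OF bounded_clinear_ortho_proj[OF X]]
      by (intro G_scaleC GW)
  qed
  moreover have "norm (W x) \<le> 1 * norm x" for x
    using norm_eq_if_cinner_eq[OF G_cinner[OF GW GW], of x] norm_ortho_proj_le[OF X, of x] by simp
  ultimately have "bounded_clinear W"
    by (rule bounded_clinearI)
  moreover have "W ` ?X = ?Y"
  proof (intro equalityI subsetI)
    show "y \<in> ?Y" if "y \<in> W ` ?X" for y
      using that G_in(2)[OF GW] by blast
    show "y \<in> W ` ?X" if "y \<in> ?Y" for y
      using G_ex'[OF that] W G_in(1) by (metis image_eqI)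
  qed
  moreover have "cinner (W x) (W y) = cinner x y" if "x \<in> ?X" "y \<in> ?X" for x y
    using G_cinner[OF GW[of x] GW[of y]] that by (simp add: ortho_proj_id[OF X])
  ultimately have "unitary_between ?X ?Y W"
    unfolding unitary_between_def by blast
  moreover have "W (P v) = Q v" for v
    by (rule W) (auto simp: G_def intro: exI[of _ "\<lambda>_. v"])
  ultimately show thesis by (rule that)
qed

lemma unitary_betweenD:
  assumes "unitary_between X Y W"
  shows "bounded_clinear W" "\<And>x. x \<in> X \<Longrightarrow> W x \<in> Y" "\<And>y. y \<in> Y \<Longrightarrow> \<exists>x\<in>X. y = W x"
    "\<And>x y. x \<in> X \<Longrightarrow> y \<in> X \<Longrightarrow> cinner (W x) (W y) = cinner x y"
  using assms by (auto simp: unitary_between_def)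

lemma unitary_betweenI:
  assumes "bounded_clinear W" "\<And>x. x \<in> X \<Longrightarrow> W x \<in> Y" "\<And>y. y \<in> Y \<Longrightarrow> \<exists>x\<in>X. y = W x"
    "\<And>x y. x \<in> X \<Longrightarrow> y \<in> X \<Longrightarrow> cinner (W x) (W y) = cinner x y"
  shows "unitary_between X Y W"
  using assms by (auto simp: unitary_between_def)

lemma unitary_between_compose:
  assumes "unitary_between X Y V" "unitary_between Y Z W"
  shows "unitary_between X Z (\<lambda>x. W (V x))"
  using assms by (auto simp: unitary_between_def intro: bounded_clinear_compose)

lemma unitary_between_inverse:
  fixes X :: "'a::chilbert_space set" and Y :: "'b::chilbert_space set"
  assumes X: "closed_csubspace X" and W: "unitary_between X Y W"
  obtains V where "unitary_between Y X V" "\<And>x. x \<in> X \<Longrightarrow> V (W x) = x"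
    "\<And>y. y \<in> Y \<Longrightarrow> W (V y) = y"
proof -
  note D = unitary_betweenD[OF W]
  \<comment> \<open>\<open>W\<close> is an ambient extension and need not vanish off
    \<open>X\<close>, so its adjoint may leave \<open>X\<close> and has to be projected
    back.\<close>
  define V where "V y = ortho_proj X (cadjoint W y)" for y
  have VW: "V (W x) = x" if "x \<in> X" for x
    unfolding V_def
  proof (rule ortho_proj_unique[OF X that])
    show "cinner (cadjoint W (W x) - x) z = 0" if "z \<in> X" for z
      using D(4)[OF \<open>x \<in> X\<close> that] by (simp add: cinner_diff_left cinner_cadjoint'[OF D(1)])
  qed
  have WV: "W (V y) = y" if "y \<in> Y" for y
    using D(3)[OF that] VW by auto
  have "unitary_between Y X V"
  proof (rule unitary_betweenI)
    show "bounded_clinear V"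
      unfolding V_def
      by (intro bounded_clinear_compose[OF bounded_clinear_ortho_proj[OF X]]
          bounded_clinear_cadjoint D)
    show "V y \<in> X" for y
      unfolding V_def by (rule ortho_proj_in[OF X])
    then show "cinner (V x) (V y) = cinner x y" if "x \<in> Y" "y \<in> Y" for x y
      using D(4)[of "V x" "V y"] WV that by simp
    show "\<exists>y\<in>Y. x = V y" if "x \<in> X" for x
      using VW[OF that] D(2)[OF that] by force
  qed
  then show thesis
    using VW WV by (rule that)
qed

section \<open>Operators on square-summable families\<close>

lemma closed_csubspace_vimage:
  assumes "bounded_clinear A" "closed_csubspace M"
  shows "closed_csubspace {x. A x \<in> M}"
proof (rule closed_csubspaceI)
  have "closed (A -` M)"
    using continuous_closed_vimage[of M A] closed_csubspaceD(5)[OF assms(2)]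
      continuous_on_bounded_clinear[OF assms(1), of UNIV]
    by (simp add: continuous_on_eq_continuous_at)
  then show "closed {x. A x \<in> M}" by (simp add: vimage_def)
qed (simp_all add: bounded_clinear_0 bounded_clinear_add bounded_clinear_scaleC closed_csubspaceD assms)

lemma closed_csubspace_INT:
  assumes "\<And>i. i \<in> I \<Longrightarrow> closed_csubspace (M i)"
  shows "closed_csubspace (\<Inter>i\<in>I. M i)"
  by (rule closed_csubspaceI) (auto simp: closed_csubspaceD assms)

lemma orthogonal_closure_cspan:
  fixes x :: "'a::complex_inner"
  assumes "\<And>y. y \<in> S \<Longrightarrow> cinner x y = 0" "y \<in> closure (cspan S)"
  shows "cinner x y = 0"
proof (rule ortho_compl_closure[OF _ assms(2)])
  have "csubspace {y. cinner x y = 0}"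
    by (rule complex_vector.subspaceI) (auto simp: cinner_add_right cinner_scaleC_right)
  then have "cspan S \<subseteq> {y. cinner x y = 0}"
    by (intro complex_vector.span_minimal) (use assms in auto)
  then show "cinner x y = 0" if "y \<in> cspan S" for y
    using that by blast
qed

lemma ell2_eqI: "(\<And>i. ell2_nth F i = ell2_nth G i) \<Longrightarrow> F = G"
  by (simp add: ell2_nth_inject[symmetric] ext)

lemmas ell2_nth_simps [simp] = zero_ell2.rep_eq plus_ell2.rep_eq minus_ell2.rep_eq
  uminus_ell2.rep_eq scaleR_ell2.rep_eq scaleC_ell2.rep_eq

lemma ell2_nth_sum [simp]: "ell2_nth (\<Sum>i\<in>I. F i) w = (\<Sum>i\<in>I. ell2_nth (F i) w)"
  by (induction I rule: infinite_finite_induct) auto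

lemma bounded_clinear_ell2_nth: "bounded_clinear (\<lambda>F. ell2_nth F i)"
  by (rule bounded_clinearI[where K = 1]) (auto simp: ell2_nth_le)

lemma Abs_ell2_bounded:
  fixes f :: "'i \<Rightarrow> 'k::complex_inner"
  assumes "\<And>A. finite A \<Longrightarrow> (\<Sum>i\<in>A. (norm (f i))\<^sup>2) \<le> K\<^sup>2" "K \<ge> 0"
  shows "ell2_nth (Abs_ell2 f) = f" "norm (Abs_ell2 f) \<le> K"
proof -
  have "(\<lambda>i. (norm (f i))\<^sup>2) summable_on UNIV"
    by (rule nonneg_bdd_above_summable_on) (use assms in \<open>auto intro!: bdd_aboveI2\<close>)
  then show nth: "ell2_nth (Abs_ell2 f) = f"
    by (simp add: Abs_ell2_inverse)
  have "(norm (Abs_ell2 f))\<^sup>2 \<le> K\<^sup>2"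
    unfolding ell2_norm_sq nth
    by (rule infsum_le_finite_sums[OF \<open>(\<lambda>i. (norm (f i))\<^sup>2) summable_on UNIV\<close>]) (use assms in auto)
  then show "norm (Abs_ell2 f) \<le> K"
    using assms(2) by (rule power2_le_imp_le)
qed

text \<open>Contraction of the second tensor factor against \<open>k\<close>; by
  \<open>cinner_etensor_right\<close> it is the adjoint of f \<mapsto> f \<otimes> k. It carries
  conditions on the first tensor factor to conditions on scalar families.\<close>

lift_definition slice :: "'k::complex_inner \<Rightarrow> ('i, 'k) ell2 \<Rightarrow> ('i, complex) ell2"
  is "\<lambda>k F i. cinner (F i) k"
proof -
  fix k :: 'k and F :: "'i \<Rightarrow> 'k"
  assume F: "(\<lambda>i. (norm (F i))\<^sup>2) summable_on UNIV"
  show "(\<lambda>i. (cmod (cinner (F i) k))\<^sup>2) summable_on UNIV"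
  proof (rule summable_on_le)
    show "(\<lambda>i. (norm (F i))\<^sup>2 * (norm k)\<^sup>2) summable_on UNIV"
      by (intro summable_on_cmult_left F)
    show "(cmod (cinner (F i) k))\<^sup>2 \<le> (norm (F i))\<^sup>2 * (norm k)\<^sup>2" for i
      unfolding power_mult_distrib[symmetric] by (intro power_mono norm_cinner_le) auto
  qed auto
qed

lemma ell2_sum_le_norm:
  assumes "\<And>i. norm (f i) \<le> K * norm (ell2_nth F i)" "finite A"
  shows "(\<Sum>i\<in>A. (norm (f i))\<^sup>2) \<le> (K * norm F)\<^sup>2"
proof -
  have "(\<Sum>i\<in>A. (norm (f i))\<^sup>2) \<le> (\<Sum>i\<in>A. (K * norm (ell2_nth F i))\<^sup>2)"
    by (intro sum_mono power_mono assms) auto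
  also have "\<dots> = K\<^sup>2 * (\<Sum>i\<in>A. (norm (ell2_nth F i))\<^sup>2)"
    by (simp add: power_mult_distrib sum_distrib_left)
  also have "\<dots> \<le> K\<^sup>2 * (norm F)\<^sup>2"
    by (intro mult_left_mono ell2_sum_le assms) auto
  finally show ?thesis by (simp add: power_mult_distrib)
qed

lemma norm_ell2_le:
  assumes "\<And>i. norm (ell2_nth G i) \<le> K * norm (ell2_nth F i)" "K \<ge> 0"
  shows "norm G \<le> K * norm F"
proof -
  have "norm (Abs_ell2 (ell2_nth G)) \<le> K * norm F"
    by (rule Abs_ell2_bounded(2)) (use ell2_sum_le_norm[OF assms(1)] assms(2) in auto)
  then show ?thesis by (simp add: ell2_nth_inverse)
qed

lemma bounded_clinear_slice: "bounded_clinear (slice k)"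
proof (rule bounded_clinearI)
  show "norm (slice k F) \<le> norm k * norm F" for F
  proof -
    have "(norm (slice k F))\<^sup>2 \<le> (norm k * norm F)\<^sup>2"
      unfolding ell2_norm_sq
    proof (rule infsum_le_finite_sums)
      show "(\<lambda>i. (norm (ell2_nth (slice k F) i))\<^sup>2) summable_on UNIV"
        using ell2_nth by auto
      show "(\<Sum>i\<in>A. (norm (ell2_nth (slice k F) i))\<^sup>2) \<le> (norm k * norm F)\<^sup>2" if "finite A" for A
        by (rule ell2_sum_le_norm[OF _ that])
          (simp add: slice.rep_eq norm_cinner_le mult.commute[of "norm k"])
    qed
    then show ?thesis by (rule power2_le_imp_le) auto
  qed
qed (auto intro!: ell2_eqI simp: slice.rep_eq cinner_add_left cinner_scaleC_left scaleC_complex_def)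

lemma slice_etensor: "slice k (f \<otimes>\<^sub>e x) = cinner x k *\<^sub>C f"
  by (auto intro!: ell2_eqI simp: slice.rep_eq etensor.rep_eq cinner_scaleC_left scaleC_complex_def)

lemma cinner_etensor_right: "cinner F (f \<otimes>\<^sub>e x) = cinner (slice x F) f"
  by (simp add: cinner_ell2.rep_eq slice.rep_eq etensor.rep_eq cinner_scaleC_right
      cinner_complex_def mult.commute)

text \<open>If F satisfies the coordinate conditions and is orthogonal to all elementary tensors,
  test it against f \<otimes> x with x = F i and f the slice of F along x. The slice must vanish,
  and its coordinate at i is the squared norm of F i. This description replaces the closed span in
  almost all that follows.\<close>

lemma tensor_space_eq:
  fixes D :: "'k::chilbert_space set"
  assumes N: "closed_csubspace N" and D: "closed_csubspace D"
  shows "N \<otimes>\<^sub>s D = {F. (\<forall>i. ell2_nth F i \<in> D) \<and> (\<forall>k. slice k F \<in> N)}"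
  unfolding tensor_space_def
proof (rule closed_csubspace_eqI)
  let ?S = "{f \<otimes>\<^sub>e x |f x. f \<in> N \<and> x \<in> D}"
  let ?R = "{F. (\<forall>i. ell2_nth F i \<in> D) \<and> (\<forall>k. slice k F \<in> N)}"
  have "?R = (\<Inter>i. {F. ell2_nth F i \<in> D}) \<inter> (\<Inter>k. {F. slice k F \<in> N})"
    by auto
  then have R: "closed_csubspace ?R"
    by (simp add: closed_csubspace_Int closed_csubspace_INT closed_csubspace_vimage N D
        bounded_clinear_ell2_nth bounded_clinear_slice)
  show "closed_csubspace (closure (cspan ?S))"
    by (intro closed_csubspace_closure complex_vector.subspace_span)
  have "?S \<subseteq> ?R"
    by (auto simp: slice_etensor etensor.rep_eq closed_csubspaceD(4)[OF N] closed_csubspaceD(4)[OF D])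
  then have "cspan ?S \<subseteq> ?R"
    using R by (intro complex_vector.span_minimal) (auto simp: closed_csubspace_def)
  then show "closure (cspan ?S) \<subseteq> ?R"
    by (rule closure_minimal) (rule closed_csubspaceD(5)[OF R])
  show "F - G \<in> ?R" if "F \<in> ?R" "G \<in> ?R" for F G
    by (rule closed_csubspaceD(3)[OF R that])
  show "F = 0" if F: "F \<in> ?R" and orth: "\<And>G. G \<in> closure (cspan ?S) \<Longrightarrow> cinner F G = 0" for F
  proof (rule ell2_eqI)
    fix i
    have "cinner (slice x F) f = 0" if "f \<in> N" "x \<in> D" for f x
    proof -
      have "f \<otimes>\<^sub>e x \<in> ?S"
        using that by auto
      then have "f \<otimes>\<^sub>e x \<in> closure (cspan ?S)"
        by (intro subsetD[OF closure_subset] complex_vector.span_base)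
      then show ?thesis
        using orth by (simp flip: cinner_etensor_right)
    qed
    from this[of "slice (ell2_nth F i) F" "ell2_nth F i"]
    have "slice (ell2_nth F i) F = 0"
      using F by simp
    from arg_cong[OF this, of "\<lambda>G. ell2_nth G i"]
    have "cinner (ell2_nth F i) (ell2_nth F i) = 0"
      by (simp add: slice.rep_eq)
    then show "ell2_nth F i = ell2_nth 0 i" by simp
  qed
qed

lemma closed_csubspace_tensor_space: "closed_csubspace (N \<otimes>\<^sub>s D)"
  unfolding tensor_space_def by (intro closed_csubspace_closure complex_vector.subspace_span)

lemma etensors_dense: "closure (cspan {f \<otimes>\<^sub>e x |f x. True}) = (UNIV :: ('i, 'k::chilbert_space) ell2 set)"
  using tensor_space_eq[of "UNIV :: ('i, complex) ell2 set" "UNIV :: 'k set"]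
  by (simp add: tensor_space_def)

lemma tensor_op_eqI:
  fixes G :: "('i, 'k::chilbert_space) ell2 \<Rightarrow> ('i, 'l::complex_inner) ell2"
  assumes G: "bounded_clinear G" and eq: "\<And>f x. G (f \<otimes>\<^sub>e x) = A f \<otimes>\<^sub>e B x"
  shows "A \<otimes>\<^sub>o B = G"
  unfolding tensor_op_def
proof (rule the_equality)
  show "G' = G" if G': "bounded_clinear G' \<and> (\<forall>f x. G' (f \<otimes>\<^sub>e x) = A f \<otimes>\<^sub>e B x)" for G'
  proof
    show "G' F = G F" for F
      by (rule bounded_clinear_eq_on_closure_span[where S = "{f \<otimes>\<^sub>e x |f x. True}"])
        (use G G' eq etensors_dense in auto)
  qed
qed (use G eq in simp)

text \<open>Existence behind the definite description: applying \<open>B\<close> to each coordinate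
  is bounded and right on elementary tensors.\<close>

lemma tensor_id:
  fixes B :: "'k::chilbert_space \<Rightarrow> 'l::complex_inner" and F :: "('i, 'k) ell2"
  assumes B: "bounded_clinear B"
  shows ell2_nth_tensor_id: "ell2_nth ((id \<otimes>\<^sub>o B) F) i = B (ell2_nth F i)"
    and bounded_clinear_tensor_id: "bounded_clinear (id \<otimes>\<^sub>o B :: ('i, 'k) ell2 \<Rightarrow> ('i, 'l) ell2)"
proof -
  define G where "G F = Abs_ell2 (\<lambda>i. B (ell2_nth F i))" for F :: "('i, 'k) ell2"
  obtain K where K: "K > 0" "\<And>x. norm (B x) \<le> K * norm x"
    using bounded_clinear_pos_bounded[OF B] by blast
  have bd: "(\<Sum>i\<in>A. (norm (B (ell2_nth F i)))\<^sup>2) \<le> (K * norm F)\<^sup>2" if "finite A"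
    for A and F :: "('i, 'k) ell2"
    by (rule ell2_sum_le_norm[OF K(2) that])
  have nth: "ell2_nth (G F) i = B (ell2_nth F i)" for F i
    unfolding G_def by (subst Abs_ell2_bounded(1)[OF bd]) (use K(1) in auto)
  have nrm: "norm (G F) \<le> K * norm F" for F
    unfolding G_def by (rule Abs_ell2_bounded(2)[OF bd]) (use K(1) in auto)
  have bl: "bounded_clinear G"
    by (rule bounded_clinearI[OF _ _ nrm])
      (auto intro!: ell2_eqI simp: nth bounded_clinear_add[OF B] bounded_clinear_scaleC[OF B])
  have "id \<otimes>\<^sub>o B = G"
    by (rule tensor_op_eqI[OF bl])
      (auto intro!: ell2_eqI simp: nth etensor.rep_eq bounded_clinear_scaleC[OF B])
  then show "ell2_nth ((id \<otimes>\<^sub>o B) F) i = B (ell2_nth F i)" "bounded_clinear (id \<otimes>\<^sub>o B :: ('i, 'k) ell2 \<Rightarrow> ('i, 'l) ell2)"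
    using nth bl by simp_all
qed

lemma slice_tensor_id:
  fixes B :: "'k::chilbert_space \<Rightarrow> 'l::chilbert_space"
  assumes B: "bounded_clinear B"
  shows "slice k ((id \<otimes>\<^sub>o B) F) = slice (cadjoint B k) F"
  by (rule ell2_eqI) (simp add: slice.rep_eq ell2_nth_tensor_id[OF B] cinner_cadjoint[OF B])

text \<open>Right creation tensored with the identity of the coefficient space, given directly on
  families. \<open>create_right\<close> is the scalar case.\<close>

lift_definition shift_right :: "'n \<Rightarrow> ('n list, 'k::complex_inner) ell2 \<Rightarrow> ('n list, 'k) ell2"
  is "\<lambda>j f w. if w \<noteq> [] \<and> last w = j then f (butlast w) else 0"
  subgoal for j f
  proof (rule summable_on_reindex_extend[of f "\<lambda>v. v @ [j]"])
    show "(if w \<noteq> [] \<and> last w = j then f (butlast w) else 0) = 0" if "w \<notin> range (\<lambda>v. v @ [j])" for w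
      using that by (cases w rule: rev_cases) auto
  qed (simp_all add: inj_def)
  done

lemma create_right_eq_shift: "create_right = shift_right"
  by (auto simp: fun_eq_iff shift_right.rep_eq create_right.rep_eq intro!: ell2_eqI)

lemma norm_shift_right: "norm (shift_right j F) = norm F"
proof -
  have "(norm (shift_right j F))\<^sup>2
      = (\<Sum>\<^sub>\<infinity>w\<in>range (\<lambda>v. v @ [j]). (norm (ell2_nth (shift_right j F) w))\<^sup>2)"
    unfolding ell2_norm_sq
  proof (rule infsum_cong_neutral)
    show "(norm (ell2_nth (shift_right j F) w))\<^sup>2 = 0" if "w \<in> UNIV - range (\<lambda>v. v @ [j])" for w
      using that by (cases w rule: rev_cases) (auto simp: shift_right.rep_eq)
  qed auto
  also have "\<dots> = (norm F)\<^sup>2"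
    unfolding ell2_norm_sq
    by (subst infsum_reindex) (auto simp: inj_def o_def shift_right.rep_eq)
  finally show ?thesis by (simp add: power2_eq_iff_nonneg)
qed

lemma bounded_clinear_shift_right: "bounded_clinear (shift_right j)"
  by (rule bounded_clinearI[where K = 1])
    (auto simp: norm_shift_right shift_right.rep_eq intro!: ell2_eqI)

lemma tensor_create_right:
  fixes B :: "'k::chilbert_space \<Rightarrow> 'l::chilbert_space"
  assumes B: "bounded_clinear B"
  shows "(create_right j \<otimes>\<^sub>o B) F = shift_right j ((id \<otimes>\<^sub>o B) F)"
proof -
  have "create_right j \<otimes>\<^sub>o B = (\<lambda>F. shift_right j ((id \<otimes>\<^sub>o B) F))"
    by (rule tensor_op_eqI)
      (auto intro!: bounded_clinear_compose[OF bounded_clinear_shift_right]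
        bounded_clinear_tensor_id B ell2_eqI simp: create_right_eq_shift shift_right.rep_eq
        ell2_nth_tensor_id[OF B] etensor.rep_eq bounded_clinear_scaleC[OF B] bounded_clinear_0[OF B])
  then show ?thesis by simp
qed

lemma slice_shift_right: "slice k (shift_right j F) = create_right j (slice k F)"
  by (auto simp: create_right.rep_eq shift_right.rep_eq slice.rep_eq intro!: ell2_eqI)

section \<open>Compression to \<open>N \<otimes> K\<close>\<close>

text \<open>This is the projection to N tensored with the identity. With the full coefficient space
  as second factor, one operator serves all coefficient subspaces and commutes with every id
  \<otimes> B.\<close>

abbreviation tensor_proj :: "('i, complex) ell2 set \<Rightarrow> ('i, 'k::chilbert_space) ell2 \<Rightarrow> ('i, 'k) ell2"
  where "tensor_proj N \<equiv> ortho_proj (N \<otimes>\<^sub>s UNIV)"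

context
  fixes N :: "('i, complex) ell2 set"
  assumes N: "closed_csubspace N"
begin

lemma slice_tensor_proj: "slice k (tensor_proj N F) \<in> N"
  using ortho_proj_in[OF closed_csubspace_tensor_space, of N UNIV F]
  by (simp add: tensor_space_eq[OF N])

lemma slice_diff_tensor_proj_orth:
  assumes "f \<in> N"
  shows "cinner (slice k (F - tensor_proj N F)) f = 0"
proof -
  have "f \<otimes>\<^sub>e k \<in> N \<otimes>\<^sub>s UNIV"
    using assms by (auto simp: tensor_space_eq[OF N] slice_etensor closed_csubspaceD[OF N])
  then show ?thesis
    using ortho_proj_orth[OF closed_csubspace_tensor_space] by (simp flip: cinner_etensor_right)
qed

lemma tensor_proj_unique:
  assumes "\<And>k. slice k G \<in> N" "\<And>k f. f \<in> N \<Longrightarrow> cinner (slice k (F - G)) f = 0"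
  shows "tensor_proj N F = G"
proof (rule ortho_proj_unique[OF closed_csubspace_tensor_space])
  show "G \<in> N \<otimes>\<^sub>s UNIV"
    using assms by (simp add: tensor_space_eq[OF N])
  show "cinner (F - G) z = 0" if "z \<in> N \<otimes>\<^sub>s UNIV" for z
    using assms that unfolding tensor_space_def
    by (intro orthogonal_closure_cspan[of _ "F - G" z]) (auto simp: cinner_etensor_right)
qed

lemma tensor_proj_eq_0:
  "(\<And>k f. f \<in> N \<Longrightarrow> cinner (slice k F) f = 0) \<Longrightarrow> tensor_proj N F = 0"
  by (rule tensor_proj_unique) (auto simp: bounded_clinear_0[OF bounded_clinear_slice] closed_csubspaceD[OF N])

lemma slice_orth_if_tensor_proj_0:
  "tensor_proj N F = 0 \<Longrightarrow> f \<in> N \<Longrightarrow> cinner (slice k F) f = 0"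
  using slice_diff_tensor_proj_orth[of f k F] by simp

text \<open>Slices of (id \<otimes> B) F along k are slices of F along the adjoint of B at k, so
  both characteristic conditions of the projection are inherited.\<close>

lemma tensor_proj_tensor_id:
  fixes B :: "'k::chilbert_space \<Rightarrow> 'l::chilbert_space"
  assumes B: "bounded_clinear B"
  shows "tensor_proj N ((id \<otimes>\<^sub>o B) F) = (id \<otimes>\<^sub>o B) (tensor_proj N F)"
  by (rule tensor_proj_unique)
    (simp_all add: slice_tensor_id B slice_tensor_proj slice_diff_tensor_proj_orth
      flip: bounded_clinear_diff[OF bounded_clinear_tensor_id])

lemma tensor_id_in_tensor_space:
  fixes B :: "'k::chilbert_space \<Rightarrow> 'l::chilbert_space"
  assumes "bounded_clinear B" "closed_csubspace D" "closed_csubspace E"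
    and "\<And>x. x \<in> D \<Longrightarrow> B x \<in> E" "F \<in> N \<otimes>\<^sub>s D"
  shows "(id \<otimes>\<^sub>o B) F \<in> N \<otimes>\<^sub>s E"
  using assms by (simp add: tensor_space_eq[OF N] ell2_nth_tensor_id slice_tensor_id)

text \<open>F is fixed by id \<otimes> P with P the projection to \<open>D\<close>, and this
  operator commutes with \<open>tensor_proj N\<close>.\<close>

lemma tensor_proj_in:
  fixes D :: "'k::chilbert_space set"
  assumes D: "closed_csubspace D" and F: "\<And>i. ell2_nth F i \<in> D"
  shows "tensor_proj N F \<in> N \<otimes>\<^sub>s D"
proof -
  let ?P = "id \<otimes>\<^sub>o ortho_proj D"
  note P = bounded_clinear_ortho_proj[OF D]
  have "?P F = F"
    by (rule ell2_eqI) (simp add: ell2_nth_tensor_id[OF P] ortho_proj_id[OF D F])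
  then have "tensor_proj N F = ?P (tensor_proj N F)"
    using tensor_proj_tensor_id[OF P, of F] by simp
  then have "ell2_nth (tensor_proj N F) i = ortho_proj D (ell2_nth (tensor_proj N F) i)" for i
    using ell2_nth_tensor_id[OF P, of "tensor_proj N F" i] by simp
  then have "ell2_nth (tensor_proj N F) i \<in> D" for i
    using ortho_proj_in[OF D, of "ell2_nth (tensor_proj N F) i"] by simp
  then show ?thesis
    by (simp add: tensor_space_eq[OF N D] slice_tensor_proj)
qed

lemma ortho_proj_tensor_space:
  fixes D :: "'k::chilbert_space set"
  assumes D: "closed_csubspace D" and F: "\<And>i. ell2_nth F i \<in> D"
  shows "ortho_proj (N \<otimes>\<^sub>s D) F = tensor_proj N F"
proof (rule ortho_proj_unique[OF closed_csubspace_tensor_space tensor_proj_in[OF D F]])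
  show "cinner (F - tensor_proj N F) z = 0" if "z \<in> N \<otimes>\<^sub>s D" for z
  proof (rule ortho_proj_orth[OF closed_csubspace_tensor_space])
    show "z \<in> N \<otimes>\<^sub>s UNIV"
      using that by (simp add: tensor_space_eq[OF N] D)
  qed
qed

lemma tensor_proj_id: "F \<in> N \<otimes>\<^sub>s D \<Longrightarrow> closed_csubspace D \<Longrightarrow> tensor_proj N F = F"
  by (rule ortho_proj_id[OF closed_csubspace_tensor_space]) (simp add: tensor_space_eq[OF N])

end

section \<open>Row contractions and their Halmos unitary\<close>

lemma bounded_clinear_row_op:
  "(\<And>i. bounded_clinear (T i)) \<Longrightarrow> bounded_clinear (row_op T)"
  unfolding row_op_def
  by (rule bounded_clinear_sum_fun) (rule bounded_clinear_compose[of "T _", OF _ bounded_clinear_vec_nth])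

lemma cadjoint_row_op:
  fixes T :: "'n::finite \<Rightarrow> 'h::chilbert_space \<Rightarrow> 'k::complex_inner"
  assumes "\<And>i. bounded_clinear (T i)"
  shows "cadjoint (row_op T) = (\<lambda>x. \<chi> i. cadjoint (T i) x)"
  by (rule cadjointI) (simp add: row_op_def cinner_vec_def cinner_sum_left cinner_cadjoint[OF assms])

lemma cadjoint_cadjoint:
  fixes A :: "'a::chilbert_space \<Rightarrow> 'b::complex_inner"
  assumes "bounded_clinear A"
  shows "cadjoint (cadjoint A) = A"
  by (rule cadjointI) (rule cinner_cadjoint'[OF assms])

text \<open>Positivity of I - T T^* says that the adjoint of the row is a contraction, and an
  operator and its adjoint are contractions together.\<close>

lemma row_contraction_iff:
  fixes T :: "'n::finite \<Rightarrow> 'h::chilbert_space \<Rightarrow> 'h"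
  shows "row_contraction T \<longleftrightarrow>
    (\<forall>i. bounded_clinear (T i)) \<and> (\<forall>v. norm (row_op T v) \<le> norm v)"
proof (cases "\<forall>i. bounded_clinear (T i)")
  case True
  then have T: "bounded_clinear (T i)" for i by blast
  note R = bounded_clinear_row_op[of T, OF T]
  have "cinner (x - (\<Sum>i\<in>UNIV. T i (cadjoint (T i) x))) x
      = of_real ((norm x)\<^sup>2 - (norm (cadjoint (row_op T) x))\<^sup>2)" for x
  proof -
    have "(\<Sum>i\<in>UNIV. T i (cadjoint (T i) x)) = row_op T (cadjoint (row_op T) x)"
      by (simp add: cadjoint_row_op T row_op_def)
    then show ?thesis
      by (simp add: cinner_diff_left cinner_cadjoint[OF R] cinner_self)
  qed
  then have "row_contraction T \<longleftrightarrow> (\<forall>x. norm (cadjoint (row_op T) x) \<le> norm x)"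
    using T by (simp add: row_contraction_def positive_op_def complex_nonneg_Reals_iff
        abs_le_square_iff[symmetric])
  also have "\<dots> \<longleftrightarrow> (\<forall>v. norm (row_op T v) \<le> norm v)"
    using norm_cadjoint_le[OF R, of 1] norm_cadjoint_le[OF bounded_clinear_cadjoint[OF R], of 1]
    by (auto simp: cadjoint_cadjoint[OF R])
  finally show ?thesis
    using T by simp
qed (auto simp: row_contraction_def)

definition halmos :: "('n::finite \<Rightarrow> 'h::complex_inner \<Rightarrow> 'h) \<Rightarrow> 'h \<times> ('h ^ 'n) \<Rightarrow> ('h ^ 'n) \<times> 'h" where
  "halmos T = (\<lambda>(x, v). (cadjoint (row_op T) x + defect T v, defect_star T x - row_op T v))"

context
  fixes T :: "'n::finite \<Rightarrow> 'h::chilbert_space \<Rightarrow> 'h"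
  assumes T: "row_contraction T"
begin

lemma row_contractionD: "bounded_clinear (T i)" "norm (row_op T v) \<le> norm v"
  using T by (auto simp: row_contraction_iff)

lemma bounded_clinear_row: "bounded_clinear (row_op T)" "bounded_clinear (cadjoint (row_op T))"
  by (rule bounded_clinear_row_op[OF row_contractionD(1)]
      bounded_clinear_cadjoint[OF bounded_clinear_row_op[OF row_contractionD(1)]])+

lemma norm_cadjoint_row: "norm (cadjoint (row_op T) x) \<le> norm x"
  using norm_cadjoint_le[OF bounded_clinear_row(1), of 1] row_contractionD(2) by simp

text \<open>The last two relations hold since T intertwines T^* T with T T^* and hence their square
  root limits.\<close>

lemma defect_facts:
  shows bounded_clinear_defect: "bounded_clinear (defect T)"
    and defect_selfadjoint: "cinner (defect T v) w = cinner v (defect T w)"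
    and defect_sq: "defect T (defect T v) = v - cadjoint (row_op T) (row_op T v)"
    and bounded_clinear_defect_star: "bounded_clinear (defect_star T)"
    and defect_star_selfadjoint: "cinner (defect_star T x) y = cinner x (defect_star T y)"
    and defect_star_sq: "defect_star T (defect_star T x) = x - row_op T (cadjoint (row_op T) x)"
    and row_op_defect: "row_op T (defect T v) = defect_star T (row_op T v)"
    and cadjoint_row_op_defect_star:
      "cadjoint (row_op T) (defect_star T x) = defect T (cadjoint (row_op T) x)"
proof -
  note R = bounded_clinear_row
  let ?A = "\<lambda>v. cadjoint (row_op T) (row_op T v)" and ?B = "\<lambda>x. row_op T (cadjoint (row_op T) x)"
  have A: "bounded_clinear ?A" and B: "bounded_clinear ?B"
    by (rule bounded_clinear_compose[OF R(2) R(1)] bounded_clinear_compose[OF R(1) R(2)])+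
  have nA: "norm (?A v) \<le> norm v" for v
    by (rule order_trans[OF norm_cadjoint_row row_contractionD(2)])
  have nB: "norm (?B x) \<le> norm x" for x
    by (rule order_trans[OF row_contractionD(2) norm_cadjoint_row])
  have sA: "cinner (?A v) w = cinner v (?A w)" for v w
    by (simp add: cinner_cadjoint'[OF R(1)] cinner_cadjoint[OF R(1)])
  have sB: "cinner (?B v) w = cinner v (?B w)" for v w
    by (simp add: cinner_cadjoint'[OF R(1)] cinner_cadjoint[OF R(1)])
  note DA = op_sqrt_eq[OF A nA sA] and DB = op_sqrt_eq[OF B nB sB]
  have D: "defect T = (\<lambda>v. v - sqrt_lim ?A v)" and Ds: "defect_star T = (\<lambda>x. x - sqrt_lim ?B x)"
    unfolding defect_def defect_star_def by (rule DA(1), rule DB(1))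
  show bD: "bounded_clinear (defect T)" and bDs: "bounded_clinear (defect_star T)"
    unfolding D Ds
    by (intro bounded_clinear_intros bounded_clinear_id bounded_clinear_sqrt_lim A nA B nB)+
  show "cinner (defect T v) w = cinner v (defect T w)"
    by (rule positive_op_selfadjoint[OF bD]) (simp add: D DA(2))
  show "cinner (defect_star T x) y = cinner x (defect_star T y)"
    by (rule positive_op_selfadjoint[OF bDs]) (simp add: Ds DB(2))
  show "defect T (defect T v) = v - ?A v"
    unfolding D by (rule DA(3))
  show "defect_star T (defect_star T x) = x - ?B x"
    unfolding Ds by (rule DB(3))
  have "row_op T (sqrt_lim ?A v) = sqrt_lim ?B (row_op T v)"
    by (rule sqrt_lim_intertwine[OF A nA B nB R(1)]) (rule refl)
  then show "row_op T (defect T v) = defect_star T (row_op T v)"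
    by (simp add: D Ds bounded_clinear_diff[OF R(1)])
  have "cadjoint (row_op T) (sqrt_lim ?B x) = sqrt_lim ?A (cadjoint (row_op T) x)"
    by (rule sqrt_lim_intertwine[OF B nB A nA R(2)]) (rule refl)
  then show "cadjoint (row_op T) (defect_star T x) = defect T (cadjoint (row_op T) x)"
    by (simp add: D Ds bounded_clinear_diff[OF R(2)])
qed

lemma closed_csubspace_defect_space: "closed_csubspace (defect_space T)"
  and closed_csubspace_defect_star_space: "closed_csubspace (defect_star_space T)"
  unfolding defect_space_def defect_star_space_def
  by (intro closed_csubspace_closure csubspace_range bounded_clinear_defect
      bounded_clinear_defect_star)+

lemma defect_in: "defect T v \<in> defect_space T"
  and defect_star_in: "defect_star T x \<in> defect_star_space T"
  unfolding defect_space_def defect_star_space_def by (auto intro: subsetD[OF closure_subset])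

lemma row_op_in: "d \<in> defect_space T \<Longrightarrow> row_op T d \<in> defect_star_space T"
  and cadjoint_row_op_in: "e \<in> defect_star_space T \<Longrightarrow> cadjoint (row_op T) e \<in> defect_space T"
proof -
  have "defect_space T \<subseteq> {d. row_op T d \<in> defect_star_space T}"
    unfolding defect_space_def[of T]
    by (rule closure_minimal)
      (auto simp: row_op_defect defect_star_in intro!: closed_csubspaceD(5)
        closed_csubspace_vimage bounded_clinear_row closed_csubspace_defect_star_space)
  then show "d \<in> defect_space T \<Longrightarrow> row_op T d \<in> defect_star_space T" by blast
  have "defect_star_space T \<subseteq> {d. cadjoint (row_op T) d \<in> defect_space T}"
    unfolding defect_star_space_def[of T]
    by (rule closure_minimal)
      (auto simp: cadjoint_row_op_defect_star defect_in intro!: closed_csubspaceD(5)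
        closed_csubspace_vimage bounded_clinear_row closed_csubspace_defect_space)
  then show "e \<in> defect_star_space T \<Longrightarrow> cadjoint (row_op T) e \<in> defect_space T" by blast
qed

lemma bounded_clinear_halmos: "bounded_clinear (halmos T)"
  unfolding halmos_def case_prod_beta
  by (intro bounded_clinear_Pair bounded_clinear_plus bounded_clinear_minus_fun
      bounded_clinear_compose[OF _ bounded_clinear_fst] bounded_clinear_compose[OF _ bounded_clinear_snd]
      bounded_clinear_row bounded_clinear_defect bounded_clinear_defect_star)

lemma cinner_halmos: "cinner (halmos T z) (halmos T z') = cinner z z'"
proof -
  note R = bounded_clinear_row(1)
  obtain x v x' v' where z: "z = (x, v)" "z' = (x', v')" by (cases z, cases z')
  let ?R = "row_op T" and ?R' = "cadjoint (row_op T)" and ?D = "defect T" and ?E = "defect_star T"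
  have "cinner (halmos T z) (halmos T z') =
      cinner x (?R (?R' x') + ?R (?D v') + (?E (?E x') - ?E (?R v')))
      + cinner v (?D (?R' x') + ?D (?D v') - (?R' (?E x') - ?R' (?R v')))"
    by (simp add: z halmos_def cinner_Pair cinner_add_left cinner_diff_left
        cinner_add_right cinner_diff_right cinner_cadjoint'[OF R] cinner_cadjoint[OF R]
        defect_selfadjoint defect_star_selfadjoint)
  also have "\<dots> = cinner x x' + cinner v v'"
    by (simp add: row_op_defect cadjoint_row_op_defect_star defect_sq defect_star_sq)
  finally show ?thesis by (simp add: z cinner_Pair)
qed

lemma norm_halmos: "norm (halmos T z) = norm z"
  by (rule norm_eq_if_cinner_eq) (rule cinner_halmos)

lemma unitary_between_halmos:
  "unitary_between (UNIV \<times> defect_space T) (UNIV \<times> defect_star_space T) (halmos T)"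
proof (rule unitary_betweenI)
  note [simp] = bounded_clinear_add[OF bounded_clinear_row(1)] bounded_clinear_diff[OF bounded_clinear_row(1)]
    bounded_clinear_add[OF bounded_clinear_row(2)] bounded_clinear_diff[OF bounded_clinear_row(2)]
    bounded_clinear_add[OF bounded_clinear_defect] bounded_clinear_diff[OF bounded_clinear_defect]
    bounded_clinear_add[OF bounded_clinear_defect_star] bounded_clinear_diff[OF bounded_clinear_defect_star]
  show "halmos T z \<in> UNIV \<times> defect_star_space T" if "z \<in> UNIV \<times> defect_space T" for z
    using that by (auto simp: halmos_def intro!: closed_csubspaceD(3) row_op_in defect_star_in
        closed_csubspace_defect_star_space)
  show "\<exists>z\<in>UNIV \<times> defect_space T. w = halmos T z" if w_in: "w \<in> UNIV \<times> defect_star_space T" for w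
  proof -
    obtain v x where w: "w = (v, x)" "x \<in> defect_star_space T"
      using w_in by auto
    \<comment> \<open>The witness is the adjoint of the Halmos matrix applied to w.\<close>
    have "w = halmos T (row_op T v + defect_star T x, defect T v - cadjoint (row_op T) x)"
      by (simp add: halmos_def w row_op_defect cadjoint_row_op_defect_star defect_sq defect_star_sq)
    moreover have "defect T v - cadjoint (row_op T) x \<in> defect_space T"
      by (intro closed_csubspaceD(3) defect_in cadjoint_row_op_in w closed_csubspace_defect_space)
    ultimately show ?thesis by blast
  qed
qed (rule bounded_clinear_halmos cinner_halmos)+

end

section \<open>Transfer functions of colligations\<close>

text \<open>A colligation \<open>U = (A, B; C, D)\<close> from \<open>H \<times> K\<close> to \<open>H\<^sup>n \<times> L\<close> drives the system
  \<open>x (w i) = r (A x(w) + B u(w))\<^sub>i\<close>, \<open>y w = C x(w) + D u(w)\<close> on words. Its input-output map is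
  \<open>D + C (I - r \<Sum> R\<^sub>i \<otimes> A\<^sub>i)\<^sup>-\<^sup>1 r \<Sum> R\<^sub>i \<otimes> B\<^sub>i\<close>. The state is indexed by the reversed word.\<close>

primrec state ::
    "('h::complex_inner \<times> 'k::complex_inner \<Rightarrow> ('h ^ 'n) \<times> 'l::complex_inner) \<Rightarrow> real \<Rightarrow>
     ('n list \<Rightarrow> 'k) \<Rightarrow> 'n list \<Rightarrow> 'h" where
  "state U r u [] = 0"
| "state U r u (i # v) = r *\<^sub>R fst (U (state U r u v, u (rev v))) $ i"

definition response ::
    "('h::complex_inner \<times> 'k::complex_inner \<Rightarrow> ('h ^ 'n) \<times> 'l::complex_inner) \<Rightarrow> real \<Rightarrow>
     ('n list \<Rightarrow> 'k) \<Rightarrow> 'n list \<Rightarrow> 'l" where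
  "response U r u w = snd (U (state U r u (rev w), u w))"

text \<open>Only the output family has to be square-summable, which makes r = 1 admissible although
  the states may then fail to be square-summable.\<close>

definition transfer_fun ::
    "('h::complex_inner \<times> 'k::complex_inner \<Rightarrow> ('h ^ 'n) \<times> 'l::complex_inner) \<Rightarrow> real \<Rightarrow>
     ('n list, 'k) ell2 \<Rightarrow> ('n list, 'l) ell2" where
  "transfer_fun U r F = Abs_ell2 (response U r (ell2_nth F))"

text \<open>It trades the parameter r of a transfer function for the parameter 1, see
  \<open>transfer_fun_damp\<close>, so that the limit r \<rightarrow> 1 becomes convergence of this
  diagonal operator to the identity.\<close>

definition damp :: "real \<Rightarrow> ('n list, 'k::complex_inner) ell2 \<Rightarrow> ('n list, 'k) ell2" where
  "damp r F = Abs_ell2 (\<lambda>w. r ^ length w *\<^sub>R ell2_nth F w)"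

text \<open>These finite sets exhaust all words and decompose by the last letter, so sums of state
  energies telescope over them.\<close>

definition short_words :: "nat \<Rightarrow> 'n list set" where
  "short_words m = {w. length w < m}"

lemma finite_short_words [simp]: "finite (short_words m :: 'n::finite list set)"
  using finite_lists_length_le[of "UNIV :: 'n set" m]
  by (rule rev_finite_subset) (auto simp: short_words_def)

lemma short_words_cover:
  assumes "finite A"
  obtains m where "A \<subseteq> short_words m"
proof -
  have "w \<in> short_words (Suc (Max (length ` A)))" if "w \<in> A" for w
    using assms that by (auto simp: short_words_def less_Suc_eq_le)
  then show thesis using that by blast
qed

lemma sum_short_words_Suc:
  fixes g :: "'n::finite list \<Rightarrow> 'b::comm_monoid_add"
  shows "(\<Sum>w\<in>short_words (Suc m). g w) = g [] + (\<Sum>w\<in>short_words m. \<Sum>i\<in>UNIV. g (w @ [i]))"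
proof -
  let ?h = "\<lambda>(w, i). w @ [i] :: 'n list"
  have "short_words (Suc m) = insert [] (?h ` (short_words m \<times> UNIV))"
  proof (intro equalityI subsetI)
    fix w :: "'n list" assume "w \<in> short_words (Suc m)"
    then show "w \<in> insert [] (?h ` (short_words m \<times> UNIV))"
      by (cases w rule: rev_cases) (auto simp: short_words_def)
  qed (auto simp: short_words_def)
  moreover have "(\<Sum>w\<in>?h ` (short_words m \<times> UNIV). g w) = (\<Sum>w\<in>short_words m. \<Sum>i\<in>UNIV. g (w @ [i]))"
    by (subst sum.reindex) (auto simp: inj_on_def sum.cartesian_product case_prod_beta)
  moreover have "[] \<notin> ?h ` (short_words m \<times> UNIV)"
    by auto
  ultimately show ?thesis by simp
qed

lemma sum_short_words_mono: "(\<Sum>w\<in>short_words m. g w) \<le> (\<Sum>w\<in>short_words (Suc m). g w)"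
  if "\<And>w. 0 \<le> g w" for g :: "'n::finite list \<Rightarrow> real"
  by (rule sum_mono2[OF finite_short_words]) (use that in \<open>auto simp: short_words_def\<close>)

lemma ell2_nth_damp:
  fixes F :: "('n list, 'k::complex_inner) ell2"
  assumes "0 \<le> r" "r \<le> 1"
  shows "ell2_nth (damp r F) w = r ^ length w *\<^sub>R ell2_nth F w"
proof -
  have "norm (r ^ length w *\<^sub>R ell2_nth F w) \<le> 1 * norm (ell2_nth F w)" for w
    using power_le_one[OF assms, of "length w"] assms
    by (auto intro!: mult_left_le_one_le)
  from ell2_sum_le_norm[of "\<lambda>w. r ^ length w *\<^sub>R ell2_nth F w", OF this]
  have "finite A \<Longrightarrow> (\<Sum>w\<in>A. (norm (r ^ length w *\<^sub>R ell2_nth F w))\<^sup>2) \<le> (norm F)\<^sup>2" for A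
    by simp
  from Abs_ell2_bounded(1)[OF this]
  show ?thesis
    by (simp add: damp_def)
qed

lemma damp_tendsto: "((\<lambda>r. damp r F) \<longlongrightarrow> F) (at_left 1)"
proof (rule tendstoI)
  fix e :: real assume e: "e > 0"
  let ?f = "\<lambda>w. (norm (ell2_nth F w))\<^sup>2"
  have "(?f has_sum (norm F)\<^sup>2) UNIV"
    unfolding ell2_norm_sq using ell2_nth[of F] by (simp add: has_sum_infsum)
  then have "\<forall>\<^sub>F A in finite_subsets_at_top UNIV. dist (sum ?f A) ((norm F)\<^sup>2) < e\<^sup>2 / 8"
    unfolding has_sum_def by (rule tendstoD) (use e in simp)
  then obtain A where A: "finite A" "dist (sum ?f A) ((norm F)\<^sup>2) < e\<^sup>2 / 8"
    unfolding eventually_finite_subsets_at_top by auto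
  \<comment> \<open>Off \<open>A\<close> the energy of F is small uniformly in r; on the finite set
    \<open>A\<close> the weights tend to 1. The two bounds e^2 / 8 add up to the square of e /
    2.\<close>
  have tail: "sum ?f B \<le> e\<^sup>2 / 8" if "finite B" "A \<inter> B = {}" for B
  proof -
    have "sum ?f A + sum ?f B = sum ?f (A \<union> B)"
      using A(1) that by (simp add: sum.union_disjoint)
    also have "\<dots> \<le> (norm F)\<^sup>2"
      using A(1) that by (intro ell2_sum_le) auto
    finally show ?thesis using A(2) unfolding dist_real_def by linarith
  qed
  have "((\<lambda>r. \<Sum>w\<in>A. (1 - r ^ length w)\<^sup>2 * ?f w) \<longlongrightarrow> (\<Sum>w\<in>A. (1 - 1 ^ length w)\<^sup>2 * ?f w)) (at_left (1::real))"
    by (intro tendsto_intros)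
  then have "((\<lambda>r. \<Sum>w\<in>A. (1 - r ^ length w)\<^sup>2 * ?f w) \<longlongrightarrow> 0) (at_left (1::real))"
    by simp
  then have "\<forall>\<^sub>F r in at_left (1::real). (\<Sum>w\<in>A. (1 - r ^ length w)\<^sup>2 * ?f w) < e\<^sup>2 / 8"
    by (rule order_tendstoD) (use e in simp)
  moreover have "\<forall>\<^sub>F r in at_left (1::real). r \<in> {0<..<1}"
    by (rule eventually_at_left_real) simp
  ultimately show "\<forall>\<^sub>F r in at_left 1. dist (damp r F) F < e"
  proof eventually_elim
    case (elim r)
    then have r: "0 \<le> r" "r \<le> 1" by auto
    have nth: "(norm (ell2_nth (damp r F - F) w))\<^sup>2 = (1 - r ^ length w)\<^sup>2 * ?f w" for w
    proof -
      have "ell2_nth (damp r F - F) w = (r ^ length w - 1) *\<^sub>R ell2_nth F w"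
        by (simp add: ell2_nth_damp[OF r] scaleR_diff_left)
      then show ?thesis
        by (simp add: power_mult_distrib power2_commute)
    qed
    have "norm (Abs_ell2 (ell2_nth (damp r F - F))) \<le> e / 2"
    proof (rule Abs_ell2_bounded(2))
      fix B :: "'a list set" assume B: "finite B"
      have "(\<Sum>w\<in>B. (norm (ell2_nth (damp r F - F) w))\<^sup>2)
          = (\<Sum>w\<in>B \<inter> A. (1 - r ^ length w)\<^sup>2 * ?f w) + (\<Sum>w\<in>B - A. (1 - r ^ length w)\<^sup>2 * ?f w)"
        unfolding nth by (rule sum.Int_Diff[OF B])
      also have "\<dots> \<le> (\<Sum>w\<in>A. (1 - r ^ length w)\<^sup>2 * ?f w) + sum ?f (B - A)"
      proof (intro add_mono sum_mono2 sum_mono)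
        show "(1 - r ^ length w)\<^sup>2 * ?f w \<le> ?f w" for w
          using power_le_one[OF r, of "length w"] r
          by (intro mult_left_le_one_le) (auto intro: power_le_one)
      qed (use A in auto)
      also have "\<dots> \<le> e\<^sup>2 / 8 + e\<^sup>2 / 8"
        using elim(1) tail[of "B - A"] B by (intro add_mono) auto
      also have "\<dots> = (e / 2)\<^sup>2"
        by (simp add: power2_eq_square)
      finally show "(\<Sum>w\<in>B. (norm (ell2_nth (damp r F - F) w))\<^sup>2) \<le> (e / 2)\<^sup>2" .
    qed (use e in simp)
    then show ?case
      using e by (simp add: ell2_nth_inverse dist_norm del: ell2_nth_simps)
  qed
qed

lemma norm_vec_scaleR_sq: "(\<Sum>i\<in>UNIV. (norm (r *\<^sub>R v $ i))\<^sup>2) = r\<^sup>2 * (norm v)\<^sup>2"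
  for v :: "'a::real_inner ^ 'n"
  by (simp add: norm_vec_sq power_mult_distrib sum_distrib_left)

context
  fixes U :: "'h::chilbert_space \<times> 'k::chilbert_space \<Rightarrow> ('h ^ 'n::finite) \<times> 'l::chilbert_space"
  assumes U: "bounded_clinear U" and contr: "\<And>z. norm (U z) \<le> norm z"
begin

lemma state_snoc: "state U r u (rev (w @ [i])) = r *\<^sub>R fst (U (state U r u (rev w), u w)) $ i"
  by simp

lemma colligation_energy:
  "(norm (fst (U (x, k))))\<^sup>2 + (norm (snd (U (x, k))))\<^sup>2 \<le> (norm x)\<^sup>2 + (norm k)\<^sup>2"
proof -
  have "(norm (U (x, k)))\<^sup>2 \<le> (norm (x, k))\<^sup>2"
    by (intro power_mono contr) auto
  then show ?thesis
    by (metis norm_Pair_sq prod.collapse)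
qed

text \<open>At each word the energy of the successor states plus the output is at most the energy of
  the state plus the input. Summed over short words the state terms telescope, starting from the
  zero state.\<close>

lemma sum_response_le:
  assumes "0 \<le> r" "r \<le> 1"
  shows "(\<Sum>w\<in>short_words m. (norm (response U r u w))\<^sup>2) \<le> (\<Sum>w\<in>short_words m. (norm (u w))\<^sup>2)"
proof -
  let ?X = "\<lambda>w. state U r u (rev w)"
  have "r\<^sup>2 \<le> 1" using power_le_one[OF assms] .
  have step: "(\<Sum>i\<in>UNIV. (norm (?X (w @ [i])))\<^sup>2) + (norm (response U r u w))\<^sup>2
      \<le> (norm (?X w))\<^sup>2 + (norm (u w))\<^sup>2" for w
  proof -
    have "(\<Sum>i\<in>UNIV. (norm (?X (w @ [i])))\<^sup>2) = r\<^sup>2 * (norm (fst (U (?X w, u w))))\<^sup>2"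
      unfolding state_snoc by (rule norm_vec_scaleR_sq)
    also have "\<dots> \<le> (norm (fst (U (?X w, u w))))\<^sup>2"
      using \<open>r\<^sup>2 \<le> 1\<close> by (intro mult_left_le_one_le) auto
    finally show ?thesis
      using colligation_energy[of "?X w" "u w"] by (simp add: response_def)
  qed
  have "(\<Sum>w\<in>short_words (Suc m). (norm (?X w))\<^sup>2) + (\<Sum>w\<in>short_words m. (norm (response U r u w))\<^sup>2)
      \<le> (\<Sum>w\<in>short_words m. (norm (?X w))\<^sup>2) + (\<Sum>w\<in>short_words m. (norm (u w))\<^sup>2)"
    unfolding sum_short_words_Suc
    using sum_mono[of "short_words m", OF step] by (simp add: sum.distrib)
  then show ?thesis
    using sum_short_words_mono[of "\<lambda>w. (norm (?X w))\<^sup>2" m] by simp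
qed

lemma transfer_fun_facts:
  assumes r: "0 \<le> r" "r \<le> 1"
  shows ell2_nth_transfer_fun: "ell2_nth (transfer_fun U r F) w = response U r (ell2_nth F) w"
    and norm_transfer_fun: "norm (transfer_fun U r F) \<le> norm F"
proof -
  have "(\<Sum>w\<in>A. (norm (response U r (ell2_nth F) w))\<^sup>2) \<le> (norm F)\<^sup>2" if A: "finite A" for A
  proof -
    obtain m where m: "A \<subseteq> short_words m" by (rule short_words_cover[OF A])
    have "(\<Sum>w\<in>A. (norm (response U r (ell2_nth F) w))\<^sup>2)
        \<le> (\<Sum>w\<in>short_words m. (norm (response U r (ell2_nth F) w))\<^sup>2)"
      by (intro sum_mono2 m) auto
    also have "\<dots> \<le> (\<Sum>w\<in>short_words m. (norm (ell2_nth F w))\<^sup>2)"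
      by (rule sum_response_le[OF r])
    also have "\<dots> \<le> (norm F)\<^sup>2"
      by (rule ell2_sum_le) simp
    finally show ?thesis .
  qed
  from Abs_ell2_bounded[OF this]
  show "ell2_nth (transfer_fun U r F) w = response U r (ell2_nth F) w"
    "norm (transfer_fun U r F) \<le> norm F"
    by (simp_all add: transfer_fun_def)
qed

lemma state_add: "state U r (\<lambda>w. u w + u' w) v = state U r u v + state U r u' v"
proof (induction v)
  case (Cons i v)
  then show ?case
    using bounded_clinear_add[OF U, of "(state U r u v, u (rev v))" "(state U r u' v, u' (rev v))"]
    by (simp add: scaleR_right_distrib)
qed simp

lemma state_scaleC: "state U r (\<lambda>w. c *\<^sub>C u w) v = c *\<^sub>C state U r u v"
proof (induction v)
  case (Cons i v)
  then show ?case
    using bounded_clinear_scaleC[OF U, of c "(state U r u v, u (rev v))"]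
    by (simp add: scaleC_prod_def scaleC_vec_def scaleR_scaleC scaleC_scaleC mult.commute)
qed simp

lemma bounded_clinear_transfer_fun:
  assumes r: "0 \<le> r" "r \<le> 1"
  shows "bounded_clinear (transfer_fun U r)"
proof (rule bounded_clinearI[where K = 1])
  show "transfer_fun U r (F + G) = transfer_fun U r F + transfer_fun U r G" for F G
  proof (rule ell2_eqI)
    fix w
    show "ell2_nth (transfer_fun U r (F + G)) w = ell2_nth (transfer_fun U r F + transfer_fun U r G) w"
      using bounded_clinear_add[OF U, of "(state U r (ell2_nth F) (rev w), ell2_nth F w)"
          "(state U r (ell2_nth G) (rev w), ell2_nth G w)"]
      by (simp add: ell2_nth_transfer_fun[OF r] response_def state_add)
  qed
  show "transfer_fun U r (c *\<^sub>C F) = c *\<^sub>C transfer_fun U r F" for c F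
  proof (rule ell2_eqI)
    fix w
    show "ell2_nth (transfer_fun U r (c *\<^sub>C F)) w = ell2_nth (c *\<^sub>C transfer_fun U r F) w"
      using bounded_clinear_scaleC[OF U, of c "(state U r (ell2_nth F) (rev w), ell2_nth F w)"]
      by (simp add: ell2_nth_transfer_fun[OF r] response_def state_scaleC scaleC_prod_def)
  qed
qed (use norm_transfer_fun[OF r] in simp)

text \<open>Each letter contributes one factor r, either through the recursion or through damping,
  so the state for r on damped input is the damped state for 1.\<close>

lemma transfer_fun_damp:
  assumes r: "0 \<le> r" "r \<le> 1"
  shows "transfer_fun U r (damp r F) = damp r (transfer_fun U 1 F)"
proof (rule ell2_eqI)
  fix w
  have U_scaleR: "U (c *\<^sub>R x, c *\<^sub>R k) = c *\<^sub>R U (x, k)" for c x k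
    using bounded_clinear_scaleC[OF U, of "of_real c" "(x, k)"]
    by (simp add: scaleR_scaleC scaleC_prod_def)
  have "state U r (ell2_nth (damp r F)) v = r ^ length v *\<^sub>R state U 1 (ell2_nth F) v" for v
    by (induction v) (simp_all add: ell2_nth_damp[OF r] U_scaleR)
  then show "ell2_nth (transfer_fun U r (damp r F)) w = ell2_nth (damp r (transfer_fun U 1 F)) w"
    by (simp add: ell2_nth_transfer_fun r ell2_nth_damp[OF r] response_def U_scaleR)
qed

text \<open>By the damping identity the error against \<open>damp r (transfer_fun U 1 F)\<close> is
  the transfer function for r at F - \<open>damp r F\<close>, and these transfer functions are
  contractions. This provides the strong limit in \<open>char_fun\<close>.\<close>

lemma transfer_fun_tendsto: "((\<lambda>r. transfer_fun U r F) \<longlongrightarrow> transfer_fun U 1 F) (at_left 1)"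
proof (rule Lim_transform)
  show "((\<lambda>r. damp r (transfer_fun U 1 F)) \<longlongrightarrow> transfer_fun U 1 F) (at_left 1)"
    by (rule damp_tendsto)
  show "((\<lambda>r. transfer_fun U r F - damp r (transfer_fun U 1 F)) \<longlongrightarrow> 0) (at_left 1)"
  proof (rule Lim_null_comparison)
    show "((\<lambda>r. norm (F - damp r F)) \<longlongrightarrow> 0) (at_left 1)"
      using tendsto_norm[OF tendsto_diff[OF tendsto_const damp_tendsto[of F]], of F] by simp
    have "\<forall>\<^sub>F r in at_left (1::real). r \<in> {0<..<1}"
      by (rule eventually_at_left_real) simp
    then show "\<forall>\<^sub>F r in at_left 1.
        norm (transfer_fun U r F - damp r (transfer_fun U 1 F)) \<le> norm (F - damp r F)"
    proof eventually_elim
      case (elim r)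
      then have r: "0 \<le> r" "r \<le> 1" by auto
      have "transfer_fun U r F - damp r (transfer_fun U 1 F) = transfer_fun U r (F - damp r F)"
        by (simp add: transfer_fun_damp[OF r] bounded_clinear_diff[OF bounded_clinear_transfer_fun[OF r]])
      then show ?case
        using norm_transfer_fun[OF r] by simp
    qed
  qed
qed

text \<open>The constant solves c = r^2 (c + 1), which is the recursion for the bound when words get
  one letter longer.\<close>

lemma sum_state_le:
  assumes r: "0 \<le> r" "r < 1"
  shows "(\<Sum>w\<in>short_words m. (norm (state U r (ell2_nth F) (rev w)))\<^sup>2) \<le> r\<^sup>2 / (1 - r\<^sup>2) * (norm F)\<^sup>2"
proof (induction m)
  case 0
  have "r\<^sup>2 \<le> 1" using r by (simp add: power_le_one)
  then show ?case by (simp add: short_words_def)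
next
  case (Suc m)
  let ?X = "\<lambda>w. state U r (ell2_nth F) (rev w)" and ?u = "ell2_nth F"
  have r2: "r\<^sup>2 < 1" using r by (simp add: power_less_one_iff abs_square_less_1)
  have "(\<Sum>i\<in>UNIV. (norm (?X (w @ [i])))\<^sup>2) \<le> r\<^sup>2 * ((norm (?X w))\<^sup>2 + (norm (?u w))\<^sup>2)" for w
  proof -
    have "(\<Sum>i\<in>UNIV. (norm (?X (w @ [i])))\<^sup>2) = r\<^sup>2 * (norm (fst (U (?X w, ?u w))))\<^sup>2"
      unfolding state_snoc by (rule norm_vec_scaleR_sq)
    also have "\<dots> \<le> r\<^sup>2 * ((norm (?X w))\<^sup>2 + (norm (?u w))\<^sup>2)"
      using colligation_energy[of "?X w" "?u w"] by (intro mult_left_mono) (auto intro: order_trans[rotated])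
    finally show ?thesis .
  qed
  then have "(\<Sum>w\<in>short_words (Suc m). (norm (?X w))\<^sup>2)
      \<le> (\<Sum>w\<in>short_words m. r\<^sup>2 * ((norm (?X w))\<^sup>2 + (norm (?u w))\<^sup>2))"
    unfolding sum_short_words_Suc by (simp add: sum_mono)
  also have "\<dots> = r\<^sup>2 * ((\<Sum>w\<in>short_words m. (norm (?X w))\<^sup>2) + (\<Sum>w\<in>short_words m. (norm (?u w))\<^sup>2))"
    by (simp add: sum.distrib flip: sum_distrib_left)
  also have "\<dots> \<le> r\<^sup>2 * (r\<^sup>2 / (1 - r\<^sup>2) * (norm F)\<^sup>2 + (norm F)\<^sup>2)"
    by (intro mult_left_mono add_mono Suc ell2_sum_le) auto
  also have "\<dots> = r\<^sup>2 / (1 - r\<^sup>2) * (norm F)\<^sup>2"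
    using r2 by (simp add: field_simps)
  finally show ?case .
qed

lemma ell2_nth_state:
  assumes r: "0 \<le> r" "r < 1"
  shows "ell2_nth (Abs_ell2 (\<lambda>w. state U r (ell2_nth F) (rev w))) = (\<lambda>w. state U r (ell2_nth F) (rev w))"
proof (rule Abs_ell2_bounded(1)[where K = "sqrt (r\<^sup>2 / (1 - r\<^sup>2) * (norm F)\<^sup>2)"])
  have r2: "r\<^sup>2 < 1" using r by (simp add: power_less_one_iff abs_square_less_1)
  then have nonneg: "0 \<le> r\<^sup>2 / (1 - r\<^sup>2) * (norm F)\<^sup>2" by simp
  then show "0 \<le> sqrt (r\<^sup>2 / (1 - r\<^sup>2) * (norm F)\<^sup>2)" by simp
  fix A :: "'n list set" assume "finite A"
  then obtain m where m: "A \<subseteq> short_words m" by (rule short_words_cover)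
  have "(\<Sum>w\<in>A. (norm (state U r (ell2_nth F) (rev w)))\<^sup>2)
      \<le> (\<Sum>w\<in>short_words m. (norm (state U r (ell2_nth F) (rev w)))\<^sup>2)"
    by (intro sum_mono2 m) auto
  also have "\<dots> \<le> r\<^sup>2 / (1 - r\<^sup>2) * (norm F)\<^sup>2"
    by (rule sum_state_le[OF r])
  finally show "(\<Sum>w\<in>A. (norm (state U r (ell2_nth F) (rev w)))\<^sup>2) \<le> (sqrt (r\<^sup>2 / (1 - r\<^sup>2) * (norm F)\<^sup>2))\<^sup>2"
    using nonneg by (simp only: real_sqrt_pow2)
qed

end

text \<open>The row of right creations applied after \<open>tensor_split\<close>, so that component
  i at the word w moves to w followed by i.\<close>

definition row_shift :: "('n list, 'h ^ 'n) ell2 \<Rightarrow> ('n::finite list, 'h::chilbert_space) ell2" where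
  "row_shift G = (\<Sum>i\<in>UNIV. shift_right i ((id \<otimes>\<^sub>o (\<lambda>v. v $ i)) G))"

lemma ell2_nth_row_shift [simp]:
  "ell2_nth (row_shift G) [] = 0"
  "ell2_nth (row_shift G) (w @ [i]) = ell2_nth G w $ i"
  by (simp_all add: row_shift_def shift_right.rep_eq ell2_nth_tensor_id)

lemma norm_row_shift: "norm (row_shift G) \<le> norm G"
proof -
  have "norm (Abs_ell2 (ell2_nth (row_shift G))) \<le> norm G"
  proof (rule Abs_ell2_bounded(2))
    fix A :: "'a list set" assume A: "finite A"
    obtain m where m: "A \<subseteq> short_words m" by (rule short_words_cover[OF A])
    have "(\<Sum>w\<in>A. (norm (ell2_nth (row_shift G) w))\<^sup>2)
        \<le> (\<Sum>w\<in>short_words m. (norm (ell2_nth (row_shift G) w))\<^sup>2)"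
      by (intro sum_mono2 m) auto
    also have "\<dots> \<le> (\<Sum>w\<in>short_words (Suc m). (norm (ell2_nth (row_shift G) w))\<^sup>2)"
      by (rule sum_short_words_mono) simp
    also have "\<dots> = (\<Sum>w\<in>short_words m. (norm (ell2_nth G w))\<^sup>2)"
      by (simp add: sum_short_words_Suc norm_vec_sq)
    also have "\<dots> \<le> (norm G)\<^sup>2"
      by (rule ell2_sum_le) simp
    finally show "(\<Sum>w\<in>A. (norm (ell2_nth (row_shift G) w))\<^sup>2) \<le> (norm G)\<^sup>2" .
  qed simp
  then show ?thesis by (simp add: ell2_nth_inverse)
qed

lemma tensor_id_id: "(id \<otimes>\<^sub>o id) F = F" for F :: "('i, 'k::chilbert_space) ell2"
  by (rule ell2_eqI) (simp add: ell2_nth_tensor_id)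

text \<open>The state family X solves the equation whose solution operator is the resolvent. The
  operator \<phi> is injective because its value at a word determines a vector from its value at the
  shorter word; so \<open>inv\<close> at the right-hand side is X, with no Neumann series.\<close>

lemma char_fun_approx_eq_transfer_fun:
  fixes T :: "'n::finite \<Rightarrow> 'h::chilbert_space \<Rightarrow> 'h"
  assumes T: "row_contraction T" and r: "0 \<le> r" "r < 1"
  shows "char_fun_approx T r F = transfer_fun (halmos T) r F"
proof -
  note U = bounded_clinear_halmos[OF T] eq_refl[OF norm_halmos[OF T]]
  note bT = row_contractionD(1)[OF T]
  note bTs = bounded_clinear_cadjoint[OF bT]
  define X where "X = Abs_ell2 (\<lambda>w. state (halmos T) r (ell2_nth F) (rev w))"
  have X: "ell2_nth X w = state (halmos T) r (ell2_nth F) (rev w)" for w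
    by (simp add: X_def ell2_nth_state[OF U r])
  define \<phi> where "\<phi> G = G - r *\<^sub>R (\<Sum>i\<in>UNIV. (create_right i \<otimes>\<^sub>o cadjoint (T i)) G)" for G
  have \<phi>_Nil: "ell2_nth (\<phi> G) [] = ell2_nth G []"
    and \<phi>_snoc: "ell2_nth (\<phi> G) (w @ [i]) = ell2_nth G (w @ [i]) - r *\<^sub>R cadjoint (T i) (ell2_nth G w)"
    for G w i
    by (simp_all add: \<phi>_def tensor_create_right[OF bTs] shift_right.rep_eq ell2_nth_tensor_id[OF bTs])
  have "inj \<phi>"
  proof (rule injI)
    fix G G' assume eq: "\<phi> G = \<phi> G'"
    have "ell2_nth G w = ell2_nth G' w" for w
    proof (induction w rule: rev_induct)
      case Nil
      then show ?case using \<phi>_Nil[of G] \<phi>_Nil[of G'] eq by simp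
    next
      case (snoc i w)
      then show ?case using \<phi>_snoc[of G w i] \<phi>_snoc[of G' w i] eq by simp
    qed
    then show "G = G'" by (rule ell2_eqI)
  qed
  define rhs where
    "rhs = r *\<^sub>R row_op (\<lambda>i. create_right i \<otimes>\<^sub>o id) (tensor_split ((id \<otimes>\<^sub>o defect T) F))"
  have rhs: "rhs = r *\<^sub>R row_shift ((id \<otimes>\<^sub>o defect T) F)"
    by (simp add: rhs_def row_op_def row_shift_def tensor_split_def tensor_create_right tensor_id_id)
  have "\<phi> X = rhs"
  proof (rule ell2_eqI)
    show "ell2_nth (\<phi> X) w = ell2_nth rhs w" for w
    proof (cases w rule: rev_cases)
      case (snoc v i)
      then show ?thesis
        by (simp add: \<phi>_snoc rhs X halmos_def cadjoint_row_op[OF bT]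
            ell2_nth_tensor_id[OF bounded_clinear_defect[OF T]] scaleR_right_distrib)
    qed (simp add: \<phi>_Nil rhs X)
  qed
  then have inv: "inv \<phi> rhs = X"
    using \<open>inj \<phi>\<close> inv_f_f by metis
  have "char_fun_approx T r F = - (id \<otimes>\<^sub>o row_op T) F + (id \<otimes>\<^sub>o defect_star T) (inv \<phi> rhs)"
    unfolding char_fun_approx_def rhs_def \<phi>_def ..
  also have "\<dots> = transfer_fun (halmos T) r F"
  proof (rule ell2_eqI)
    have "snd (halmos T (x, v)) = defect_star T x - row_op T v" for x v
      by (simp add: halmos_def)
    then show "ell2_nth (- (id \<otimes>\<^sub>o row_op T) F + (id \<otimes>\<^sub>o defect_star T) (inv \<phi> rhs)) w
        = ell2_nth (transfer_fun (halmos T) r F) w" for w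
      using r by (simp add: inv ell2_nth_transfer_fun[OF U] response_def X
        ell2_nth_tensor_id[OF bounded_clinear_row(1)[OF T]]
        ell2_nth_tensor_id[OF bounded_clinear_defect_star[OF T]])
  qed
  finally show ?thesis .
qed

lemma char_fun_eq_transfer_fun:
  fixes T :: "'n::finite \<Rightarrow> 'h::chilbert_space \<Rightarrow> 'h"
  assumes T: "row_contraction T"
  shows "char_fun T F = transfer_fun (halmos T) 1 F"
  unfolding char_fun_def
proof (rule tendsto_Lim)
  have "\<forall>\<^sub>F r in at_left (1::real). r \<in> {0<..<1}"
    by (rule eventually_at_left_real) simp
  then have "\<forall>\<^sub>F r in at_left 1. transfer_fun (halmos T) r F = char_fun_approx T r F"
    by eventually_elim (simp add: char_fun_approx_eq_transfer_fun[OF T])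
  then show "((\<lambda>r. char_fun_approx T r F) \<longlongrightarrow> transfer_fun (halmos T) 1 F) (at_left 1)"
    by (rule Lim_transform_eventually[rotated])
      (rule transfer_fun_tendsto[OF bounded_clinear_halmos[OF T] eq_refl[OF norm_halmos[OF T]]])
qed simp

context
  fixes U :: "'h::chilbert_space \<times> 'k::chilbert_space \<Rightarrow> ('h ^ 'n::finite) \<times> 'l::chilbert_space"
  assumes U: "bounded_clinear U" and contr: "\<And>z. norm (U z) \<le> norm z"
begin

lemma colligation_blocks:
  "bounded_clinear (\<lambda>x. fst (U (x, 0)))" "bounded_clinear (\<lambda>x. snd (U (x, 0)))"
  "bounded_clinear (\<lambda>k. fst (U (0, k)))" "bounded_clinear (\<lambda>k. snd (U (0, k)))"
proof -
  have 1: "bounded_clinear (\<lambda>x. U (x, 0))"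
    by (rule bounded_clinear_compose[OF U]) (rule bounded_clinear_Pair[OF bounded_clinear_id(1) bounded_clinear_zero])
  have 2: "bounded_clinear (\<lambda>k. U (0, k))"
    by (rule bounded_clinear_compose[OF U]) (rule bounded_clinear_Pair[OF bounded_clinear_zero bounded_clinear_id(1)])
  show "bounded_clinear (\<lambda>x. fst (U (x, 0)))" "bounded_clinear (\<lambda>x. snd (U (x, 0)))"
    "bounded_clinear (\<lambda>k. fst (U (0, k)))" "bounded_clinear (\<lambda>k. snd (U (0, k)))"
    by (rule bounded_clinear_fst'[OF 1] bounded_clinear_snd'[OF 1]
        bounded_clinear_fst'[OF 2] bounded_clinear_snd'[OF 2])+
qed

lemma colligation_split_args: "U (x, k) = U (x, 0) + U (0, k)"
  using bounded_clinear_add[OF U, of "(x, 0)" "(0, k)"] by simp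

context
  fixes N :: "('n list, complex) ell2 set"
  assumes N: "closed_csubspace N"
    and inv: "\<And>f i. (\<And>g. g \<in> N \<Longrightarrow> cinner f g = 0) \<Longrightarrow> (\<And>g. g \<in> N \<Longrightarrow> cinner (create_right i f) g = 0)"
begin

text \<open>\<open>inv\<close> says that right creation preserves the orthogonal complement of
  \<open>N\<close>. The part of G discarded by the projection therefore stays discarded after
  shifting.\<close>

lemma norm_tensor_proj_row_shift:
  fixes G :: "('n list, 'x::chilbert_space ^ 'n) ell2"
  shows "norm (tensor_proj N (row_shift G)) \<le> norm (tensor_proj N G)"
proof -
  let ?Q = "tensor_proj N :: ('n list, 'x) ell2 \<Rightarrow> _"
  let ?G = "tensor_proj N G"
  note Q = bounded_clinear_ortho_proj[OF closed_csubspace_tensor_space]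
  have shift: "?Q (shift_right i H) = 0" if "?Q H = 0" for i H
    by (rule tensor_proj_eq_0[OF N])
      (simp add: slice_shift_right inv slice_orth_if_tensor_proj_0[OF N that])
  have "?Q (row_shift G - row_shift ?G) = (\<Sum>i\<in>UNIV. ?Q (shift_right i ((id \<otimes>\<^sub>o (\<lambda>v. v $ i)) (G - ?G))))"
    by (simp add: row_shift_def bounded_clinear_sum[OF Q] bounded_clinear_diff[OF Q]
        bounded_clinear_diff[OF bounded_clinear_shift_right]
        bounded_clinear_diff[OF bounded_clinear_tensor_id] sum_subtractf)
  also have "\<dots> = 0"
  proof (intro sum.neutral ballI shift)
    have "tensor_proj N ?G = ?G"
      by (rule ortho_proj_id[OF closed_csubspace_tensor_space ortho_proj_in[OF closed_csubspace_tensor_space]])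
    then have "tensor_proj N (G - ?G) = 0"
      by (simp add: bounded_clinear_diff[OF Q])
    then show "?Q ((id \<otimes>\<^sub>o (\<lambda>v. v $ i)) (G - ?G)) = 0" for i
      by (simp only: tensor_proj_tensor_id[OF N bounded_clinear_vec_nth]
          bounded_clinear_0[OF bounded_clinear_tensor_id[OF bounded_clinear_vec_nth]])
  qed
  finally have "?Q (row_shift G) = ?Q (row_shift ?G)"
    by (simp add: bounded_clinear_diff[OF Q])
  then show ?thesis
    using order_trans[OF norm_ortho_proj_le[OF closed_csubspace_tensor_space] norm_row_shift[of ?G]]
    by metis
qed

text \<open>Write Q for the projection, X for the state and v for its unshifted successor, so that X
  is r times the shift of v. As Q z = 0, Q v is the main operator applied to Q X. Hence norm (Q X)
  \<le> r * norm (Q v) \<le> r * norm (Q X), which gives Q X = 0 because r < 1; the output then has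
  projection 0 too.\<close>

lemma tensor_proj_transfer_fun_r:
  assumes z: "tensor_proj N z = 0" and r: "0 \<le> r" "r < 1"
  shows "tensor_proj N (transfer_fun U r z) = 0"
proof -
  note Q = bounded_clinear_ortho_proj[OF closed_csubspace_tensor_space]
  define X where "X = Abs_ell2 (\<lambda>w. state U r (ell2_nth z) (rev w))"
  have X: "ell2_nth X w = state U r (ell2_nth z) (rev w)" for w
    by (simp add: X_def ell2_nth_state[OF U contr r])
  define v where "v = (id \<otimes>\<^sub>o (\<lambda>x. fst (U (x, 0)))) X + (id \<otimes>\<^sub>o (\<lambda>k. fst (U (0, k)))) z"
  have v: "ell2_nth v w = fst (U (ell2_nth X w, ell2_nth z w))" for w
    by (subst colligation_split_args) (simp add: v_def ell2_nth_tensor_id colligation_blocks)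
  have Xv: "X = r *\<^sub>R row_shift v"
  proof (rule ell2_eqI)
    show "ell2_nth X w = ell2_nth (r *\<^sub>R row_shift v) w" for w
      by (cases w rule: rev_cases) (simp_all add: X v)
  qed
  have Qv: "tensor_proj N v = (id \<otimes>\<^sub>o (\<lambda>x. fst (U (x, 0)))) (tensor_proj N X)"
    by (simp add: v_def bounded_clinear_add[OF Q] tensor_proj_tensor_id[OF N] colligation_blocks z
        bounded_clinear_0[OF bounded_clinear_tensor_id[OF colligation_blocks(3)]])
  have "norm (fst (U (x, 0))) \<le> 1 * norm x" for x
    using order_trans[OF _ contr[of "(x, 0)"], of "norm (fst (U (x, 0)))"]
      norm_fst_le[of "fst (U (x, 0))" "snd (U (x, 0))"] by simp
  then have "norm (tensor_proj N v) \<le> 1 * norm (tensor_proj N X)"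
    unfolding Qv by (intro norm_ell2_le) (simp_all add: ell2_nth_tensor_id colligation_blocks)
  moreover have "norm (tensor_proj N X) \<le> r * norm (tensor_proj N v)"
  proof -
    have "tensor_proj N X = r *\<^sub>R tensor_proj N (row_shift v)"
      by (subst Xv) (simp add: scaleR_scaleC bounded_clinear_scaleC[OF Q])
    then show ?thesis
      using r mult_left_mono[OF norm_tensor_proj_row_shift[of v] r(1)] by simp
  qed
  ultimately have "norm (tensor_proj N X) \<le> r * norm (tensor_proj N X)"
    using mult_left_mono[of "norm (tensor_proj N v)" "norm (tensor_proj N X)" r] r by simp
  then have "(1 - r) * norm (tensor_proj N X) \<le> 0"
    by (simp add: algebra_simps)
  then have X0: "tensor_proj N X = 0"
    using r by (simp add: mult_le_0_iff)
  have "transfer_fun U r z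
      = (id \<otimes>\<^sub>o (\<lambda>x. snd (U (x, 0)))) X + (id \<otimes>\<^sub>o (\<lambda>k. snd (U (0, k)))) z"
    using r by (intro ell2_eqI) (subst ell2_nth_transfer_fun[OF U contr], simp_all add: response_def,
      subst colligation_split_args, simp add: ell2_nth_tensor_id colligation_blocks X)
  then show ?thesis
    by (simp add: bounded_clinear_add[OF Q] tensor_proj_tensor_id[OF N] colligation_blocks z X0
        bounded_clinear_0[OF bounded_clinear_tensor_id[OF colligation_blocks(2)]]
        bounded_clinear_0[OF bounded_clinear_tensor_id[OF colligation_blocks(4)]])
qed

text \<open>The kernel of the projection is invariant for r < 1, hence for the strong limit. This is
  what makes compression multiplicative along a cascade.\<close>

lemma tensor_proj_transfer_fun:
  "tensor_proj N (transfer_fun U 1 z) = tensor_proj N (transfer_fun U 1 (tensor_proj N z))"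
proof -
  note Q = bounded_clinear_ortho_proj[OF closed_csubspace_tensor_space]
  let ?z = "z - tensor_proj N z"
  have z: "tensor_proj N ?z = 0"
    by (simp add: bounded_clinear_diff[OF Q]
        ortho_proj_id[OF closed_csubspace_tensor_space ortho_proj_in[OF closed_csubspace_tensor_space]])
  have "((\<lambda>r. tensor_proj N (transfer_fun U r ?z)) \<longlongrightarrow> tensor_proj N (transfer_fun U 1 ?z)) (at_left 1)"
    by (intro tendsto_bounded_clinear[OF Q] transfer_fun_tendsto[OF U contr])
  moreover have "((\<lambda>r. tensor_proj N (transfer_fun U r ?z)) \<longlongrightarrow> 0) (at_left 1)"
  proof (rule tendsto_eventually)
    have "\<forall>\<^sub>F r in at_left (1::real). r \<in> {0<..<1}"
      by (rule eventually_at_left_real) simp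
    then show "\<forall>\<^sub>F r in at_left 1. tensor_proj N (transfer_fun U r ?z) = 0"
      by eventually_elim (simp add: tensor_proj_transfer_fun_r[OF z])
  qed
  ultimately have "tensor_proj N (transfer_fun U 1 ?z) = 0"
    by (rule tendsto_unique[rotated]) simp
  then show ?thesis
    by (simp add: bounded_clinear_diff[OF bounded_clinear_transfer_fun[OF U contr]]
        bounded_clinear_diff[OF Q])
qed

end

lemma transfer_fun_in:
  assumes "\<And>z. z \<in> UNIV \<times> F \<Longrightarrow> U z \<in> UNIV \<times> G" "\<And>w. ell2_nth z w \<in> F"
  shows "ell2_nth (transfer_fun U 1 z) w \<in> G"
  using assms(1)[of "(state U 1 (ell2_nth z) (rev w), ell2_nth z w)"] assms(2)
  by (auto simp: ell2_nth_transfer_fun[OF U contr] response_def mem_Times_iff)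

end

text \<open>The state of the cascade is the pair of the two states, where the second system is
  driven by the response of the first. The cascade identity is available only for inputs in
  \<open>F\<close>, so z must take its values there.\<close>

lemma transfer_fun_cascade:
  fixes U :: "('h1::chilbert_space \<times> 'h2::chilbert_space) \<times> 'k::chilbert_space
      \<Rightarrow> (('h1 \<times> 'h2) ^ 'n::finite) \<times> 'm::chilbert_space"
    and U1 :: "'h1 \<times> 'k \<Rightarrow> ('h1 ^ 'n) \<times> 'l::chilbert_space" and U2 :: "'h2 \<times> 'l \<Rightarrow> ('h2 ^ 'n) \<times> 'm"
  assumes U: "bounded_clinear U" "\<And>z. norm (U z) \<le> norm z"
    and U1: "bounded_clinear U1" "\<And>z. norm (U1 z) \<le> norm z"
    and U2: "bounded_clinear U2" "\<And>z. norm (U2 z) \<le> norm z"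
    and casc: "\<And>x y k. k \<in> F \<Longrightarrow> U ((x, y), k) =
      ((\<chi> i. (fst (U1 (x, k)) $ i, fst (U2 (y, snd (U1 (x, k)))) $ i)), snd (U2 (y, snd (U1 (x, k)))))"
    and z: "\<And>w. ell2_nth z w \<in> F"
  shows "transfer_fun U 1 z = transfer_fun U2 1 (transfer_fun U1 1 z)"
proof (rule ell2_eqI)
  fix w
  have t1: "ell2_nth (transfer_fun U1 1 z) = response U1 1 (ell2_nth z)"
    by (rule ext) (simp add: ell2_nth_transfer_fun[OF U1])
  have "state U 1 (ell2_nth z) v =
      (state U1 1 (ell2_nth z) v, state U2 1 (response U1 1 (ell2_nth z)) v)" for v
    by (induction v) (simp_all add: casc z response_def zero_prod_def)
  then show "ell2_nth (transfer_fun U 1 z) w = ell2_nth (transfer_fun U2 1 (transfer_fun U1 1 z)) w"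
    by (simp add: ell2_nth_transfer_fun[OF U] ell2_nth_transfer_fun[OF U2] t1)
      (simp add: response_def casc z)
qed

section \<open>The commutant of the right creation operators\<close>

lemma create_left_right_commute: "create_left i (create_right j f) = create_right j (create_left i f)"
proof (rule ell2_eqI)
  fix w
  show "ell2_nth (create_left i (create_right j f)) w = ell2_nth (create_right j (create_left i f)) w"
  proof (cases w)
    case (Cons a v)
    then show ?thesis
      by (cases v rule: rev_cases) (auto simp: create_left.rep_eq create_right.rep_eq)
  qed (simp add: create_left.rep_eq create_right.rep_eq)
qed

lemma bounded_clinear_create_right: "bounded_clinear (create_right j)"
  unfolding create_right_eq_shift by (rule bounded_clinear_shift_right)

lemma bounded_clinear_create_left: "bounded_clinear (create_left (j :: 'n))"
proof -
  have "(norm (create_left j F))\<^sup>2 = (norm F)\<^sup>2" for F :: "'n fock"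
  proof -
    have "(norm (create_left j F))\<^sup>2
        = (\<Sum>\<^sub>\<infinity>w\<in>range ((#) j). (norm (ell2_nth (create_left j F) w))\<^sup>2)"
      unfolding ell2_norm_sq
    proof (rule infsum_cong_neutral)
      show "(norm (ell2_nth (create_left j F) w))\<^sup>2 = 0" if "w \<in> UNIV - range ((#) j)" for w
        using that by (cases w) (auto simp: create_left.rep_eq)
    qed auto
    also have "\<dots> = (norm F)\<^sup>2"
      unfolding ell2_norm_sq
      by (subst infsum_reindex) (auto simp: o_def create_left.rep_eq)
    finally show ?thesis .
  qed
  then have "norm (create_left j F) = norm F" for F :: "'n fock"
    by (simp add: power2_eq_iff_nonneg)
  then show ?thesis
    by (intro bounded_clinearI[where K = 1]) (auto intro!: ell2_eqI simp: create_left.rep_eq)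
qed

text \<open>A concrete competitor in the hull that defines \<open>fock_algebra\<close>; commutation
  with right creation is the property of J on which the compression argument rests.\<close>

definition right_commutant :: "('n fock \<Rightarrow> 'n fock) set" where
  "right_commutant = {A. bounded_clinear A \<and> (\<forall>j f. A (create_right j f) = create_right j (A f))}"

lemma word_op_Nil: "word_op T [] = id"
  and word_op_Cons: "word_op T (i # w) = T i \<circ> word_op T w"
  by (simp_all add: word_op_def)

lemma operator_algebraD:
  assumes "operator_algebra \<A>"
  shows "(\<lambda>x. 0) \<in> \<A>" "\<And>A B. A \<in> \<A> \<Longrightarrow> B \<in> \<A> \<Longrightarrow> (\<lambda>x. A x + B x) \<in> \<A>"
    "\<And>c A. A \<in> \<A> \<Longrightarrow> (\<lambda>x. c *\<^sub>C A x) \<in> \<A>" "\<And>A B. A \<in> \<A> \<Longrightarrow> B \<in> \<A> \<Longrightarrow> A \<circ> B \<in> \<A>"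
  using assms by (auto simp: operator_algebra_def)

lemma operator_algebra_right_commutant: "operator_algebra right_commutant"
  by (auto simp: operator_algebra_def right_commutant_def bounded_clinear_plus
      bounded_clinear_scaleC_const bounded_clinear_0 bounded_clinear_add bounded_clinear_scaleC
      bounded_clinear_create_right comp_def intro: bounded_clinear_compose)

text \<open>Moving \<open>create_right j\<close> to the other side of the inner product turns
  commutation into equality of two matrix coefficients of A, a closed condition in the product
  topology from which \<open>wot\<close> is pulled back.\<close>

lemma closedin_wot_right_commutant: "closedin wot (right_commutant :: ('n fock \<Rightarrow> 'n fock) set)"
proof -
  define C :: "('n fock \<times> 'n fock \<Rightarrow> complex) set" where
    "C = (\<Inter>j. \<Inter>f. \<Inter>g. {h. h (create_right j f, g) = h (f, cadjoint (create_right j) g)})"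
  have "closed C"
    unfolding C_def
    by (intro closed_INT ballI closed_Collect_eq continuous_on_product_coordinates)
  have R: "(right_commutant :: ('n fock \<Rightarrow> 'n fock) set) = (\<lambda>A (x, y). cinner (A x) y) -` C \<inter> {A. bounded_clinear A}"
  proof -
    have "(\<forall>j f. A (create_right j f) = create_right j (A f)) \<longleftrightarrow>
        (\<forall>j f g. cinner (A (create_right j f)) g = cinner (A f) (cadjoint (create_right j) g))"
      for A :: "'n fock \<Rightarrow> 'n fock"
    proof (intro iffI allI)
      fix j f g
      assume "\<forall>j f. A (create_right j f) = create_right j (A f)"
      then show "cinner (A (create_right j f)) g = cinner (A f) (cadjoint (create_right j) g)"
        by (simp add: cinner_cadjoint[OF bounded_clinear_create_right])
    next
      fix j f
      assume eq: "\<forall>j f g. cinner (A (create_right j f)) g = cinner (A f) (cadjoint (create_right j) g)"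
      show "A (create_right j f) = create_right j (A f)"
        by (rule cinner_eqI) (simp add: cinner_cadjoint[OF bounded_clinear_create_right] eq)
    qed
    then have "right_commutant = {A :: 'n fock \<Rightarrow> 'n fock. bounded_clinear A \<and> (\<forall>j f g. cinner (A (create_right j f)) g
        = cinner (A f) (cadjoint (create_right j) g))}"
      by (simp add: right_commutant_def)
    then show ?thesis
      by (auto simp: C_def)
  qed
  have top: "topspace (wot :: ('n fock \<Rightarrow> 'n fock) topology) = {A. bounded_clinear A}"
    by (simp add: wot_def topspace_pullback_topology)
  have "openin wot ((\<lambda>A (x, y). cinner (A x) y) -` (- C) \<inter> {A :: 'n fock \<Rightarrow> 'n fock. bounded_clinear A})"
    unfolding wot_def openin_pullback_topology using \<open>closed C\<close> by (auto simp: open_Compl)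
  moreover have "{A. bounded_clinear A} - right_commutant
      = (\<lambda>A (x, y). cinner (A x) y) -` (- C) \<inter> {A :: 'n fock \<Rightarrow> 'n fock. bounded_clinear A}"
    unfolding R by auto
  ultimately show ?thesis
    by (auto simp: closedin_def top right_commutant_def)
qed

lemma right_commutant_generators: "insert id (range create_left) \<subseteq> right_commutant"
  by (auto simp: right_commutant_def bounded_clinear_create_left create_left_right_commute)

text \<open>The right commutant shows that the family being intersected is non-empty; the hull over
  an empty family would consist of all functions.\<close>

lemma fock_algebra_facts:
  shows operator_algebra_fock_algebra: "operator_algebra (fock_algebra :: ('n fock \<Rightarrow> 'n fock) set)"
    and closedin_wot_fock_algebra: "closedin wot (fock_algebra :: ('n fock \<Rightarrow> 'n fock) set)"
    and fock_algebra_subset_right_commutant: "(fock_algebra :: ('n fock \<Rightarrow> 'n fock) set) \<subseteq> right_commutant"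
    and fock_algebra_generators: "insert id (range create_left) \<subseteq> (fock_algebra :: ('n fock \<Rightarrow> 'n fock) set)"
proof -
  let ?\<F> = "{\<A>. (operator_algebra \<A> \<and> closedin wot \<A>) \<and>
    insert id (range create_left) \<subseteq> (\<A> :: ('n fock \<Rightarrow> 'n fock) set)}"
  have F: "fock_algebra = \<Inter>?\<F>"
    by (simp add: fock_algebra_def hull_def)
  have R: "right_commutant \<in> ?\<F>"
    using operator_algebra_right_commutant closedin_wot_right_commutant right_commutant_generators
    by simp
  then show "(fock_algebra :: ('n fock \<Rightarrow> 'n fock) set) \<subseteq> right_commutant"
    unfolding F by blast
  show "closedin wot (fock_algebra :: ('n fock \<Rightarrow> 'n fock) set)"
    unfolding F
  proof (rule closedin_Inter)
    show "?\<F> \<noteq> {}" using R by blast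
  qed simp
  show "insert id (range create_left) \<subseteq> (fock_algebra :: ('n fock \<Rightarrow> 'n fock) set)"
    unfolding F by blast
  have bl: "bounded_clinear A" if "A \<in> fock_algebra" for A :: "'n fock \<Rightarrow> 'n fock"
    using that R unfolding F by (auto simp: right_commutant_def)
  show "operator_algebra (fock_algebra :: ('n fock \<Rightarrow> 'n fock) set)"
    unfolding operator_algebra_def
  proof (intro conjI subsetI ballI allI CollectI bl)
    show "(\<lambda>x. 0) \<in> (fock_algebra :: ('n fock \<Rightarrow> 'n fock) set)"
      unfolding F by (auto simp: operator_algebra_def)
    fix A B :: "'n fock \<Rightarrow> 'n fock" and c :: complex
    assume A: "A \<in> fock_algebra"
    then show "(\<lambda>x. c *\<^sub>C A x) \<in> fock_algebra"
      unfolding F by (auto simp: operator_algebra_def)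
    assume B: "B \<in> fock_algebra"
    from A B show "(\<lambda>x. A x + B x) \<in> fock_algebra" "A \<circ> B \<in> fock_algebra"
      unfolding F by (auto simp: operator_algebra_def)
  qed
qed

lemma ncpoly_eval_in_fock_algebra: "ncpoly_eval p create_left \<in> (fock_algebra :: ('n fock \<Rightarrow> 'n fock) set)"
proof -
  note A = operator_algebraD[OF operator_algebra_fock_algebra]
  have word: "word_op create_left w \<in> (fock_algebra :: ('n fock \<Rightarrow> 'n fock) set)" for w
  proof (induction w)
    case Nil
    show ?case unfolding word_op_Nil by (rule subsetD[OF fock_algebra_generators]) (simp add: id_def)
  next
    case (Cons i w)
    have "create_left i \<in> fock_algebra" using fock_algebra_generators[where 'n = 'n] by auto
    then have "create_left i \<circ> word_op create_left w \<in> fock_algebra" by (rule A(4)) (rule Cons)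
    then show ?case unfolding word_op_Cons .
  qed
  have "(\<lambda>x. \<Sum>w\<in>I. Poly_Mapping.lookup p w *\<^sub>C word_op create_left w x) \<in> fock_algebra" if "finite I" for I
    using that
  proof (induction I rule: finite_induct)
    case empty
    show ?case using A(1) by simp
  next
    case (insert w I)
    have "(\<lambda>x. Poly_Mapping.lookup p w *\<^sub>C word_op create_left w x) \<in> fock_algebra"
      by (rule A(3)[OF word])
    from A(2)[OF this insert(3)] show ?case
      by (simp add: insert(1,2))
  qed
  from this[OF finite_keys] show ?thesis
    by (simp add: ncpoly_eval_def[abs_def])
qed

text \<open>\<open>fock_algebra\<close> is a WOT-closed ideal of itself containing the polynomials,
  hence a competitor in the hull.\<close>

lemma generated_ideal_subset: "generated_ideal P \<subseteq> (right_commutant :: ('n fock \<Rightarrow> 'n fock) set)"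
proof -
  have "two_sided_ideal_of fock_algebra (fock_algebra :: ('n fock \<Rightarrow> 'n fock) set)"
    using operator_algebra_fock_algebra[where 'n = 'n]
    by (simp add: two_sided_ideal_of_def operator_algebra_def)
  then have "generated_ideal P \<subseteq> (fock_algebra :: ('n fock \<Rightarrow> 'n fock) set)"
    unfolding generated_ideal_def
    by (intro hull_minimal) (auto simp: ncpoly_eval_in_fock_algebra closedin_wot_fock_algebra)
  then show ?thesis
    using fock_algebra_subset_right_commutant by blast
qed

lemma closed_csubspace_N_space: "closed_csubspace (N_space J)"
  unfolding N_space_def by (rule closed_csubspace_ortho_compl)

text \<open>\<open>M_space J\<close> is invariant under right creation since \<open>J\<close> commutes with it.\<close>

lemma create_right_N_space_orth:
  assumes J: "J \<subseteq> right_commutant"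
    and f: "\<And>g. g \<in> N_space J \<Longrightarrow> cinner f g = 0" and g: "g \<in> N_space J"
  shows "cinner (create_right i f) g = 0"
proof -
  let ?S = "{\<phi> \<psi> |\<phi> \<psi>. \<phi> \<in> J}"
  let ?R = "cadjoint (create_right i)"
  note R = bounded_clinear_create_right
  \<comment> \<open>Invariance is used in adjoint form, on \<open>N_space J\<close>; this avoids
    identifying the double orthogonal complement of \<open>M_space J\<close>.\<close>
  have "?R g \<in> N_space J"
    unfolding N_space_def M_space_def ortho_compl_def
  proof (intro CollectI ballI, erule orthogonal_closure_cspan[rotated])
    fix y assume y: "y \<in> ?S"
    then obtain \<phi> \<psi> where \<phi>: "y = \<phi> \<psi>" "\<phi> \<in> J" by blast
    then have "create_right i y = \<phi> (create_right i \<psi>)"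
      using J by (auto simp: right_commutant_def)
    then have "create_right i y \<in> ?S"
      using \<phi> by blast
    then have "create_right i y \<in> M_space J"
      unfolding M_space_def by (intro subsetD[OF closure_subset] complex_vector.span_base)
    then have "cinner g (create_right i y) = 0"
      using g by (simp add: N_space_def ortho_compl_def)
    then show "cinner (?R g) y = 0"
      by (simp add: cinner_cadjoint'[OF R])
  qed
  then show ?thesis
    using f by (simp add: cinner_cadjoint[OF R])
qed

section \<open>Splitting and decomposing colligations\<close>

text \<open>If the state space of a unitary colligation is \<open>H\<^sub>1 \<oplus> H\<^sub>2\<close> and \<open>U H\<^sub>2\<close> is orthogonal to \<open>H\<^sub>1\<^sup>n\<close>,
  then \<open>U\<close> is a cascade whose intermediate space \<open>M\<close> is the orthogonal complement of \<open>U H\<^sub>2\<close>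
  in \<open>H\<^sub>2\<^sup>n \<oplus> G\<close>.\<close>

lemma colligation_cascade_split:
  fixes U :: "('h1::chilbert_space \<times> 'h2::chilbert_space) \<times> 'k::chilbert_space
      \<Rightarrow> (('h1 \<times> 'h2) ^ 'n::finite) \<times> 'm::chilbert_space"
  assumes U: "bounded_clinear U" and contr: "\<And>z. norm (U z) \<le> norm z"
    and F: "closed_csubspace F" and G: "closed_csubspace G"
    and unit: "unitary_between (UNIV \<times> F) (UNIV \<times> G) U"
    and tri: "\<And>y i. fst (fst (U ((0, y), 0)) $ i) = 0"
  obtains M :: "(('h2 ^ 'n) \<times> 'm) set" and U1 :: "'h1 \<times> 'k \<Rightarrow> ('h1 ^ 'n) \<times> (('h2 ^ 'n) \<times> 'm)"
    and U2 :: "'h2 \<times> (('h2 ^ 'n) \<times> 'm) \<Rightarrow> ('h2 ^ 'n) \<times> 'm"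
  where "closed_csubspace M" "bounded_clinear U1" "\<And>z. norm (U1 z) \<le> norm z"
    "bounded_clinear U2" "\<And>z. norm (U2 z) \<le> norm z"
    "unitary_between (UNIV \<times> F) (UNIV \<times> M) U1" "unitary_between (UNIV \<times> M) (UNIV \<times> G) U2"
    "\<And>x. fst (U1 (x, 0)) = (\<chi> i. fst (fst (U ((x, 0), 0)) $ i))"
    "\<And>y. fst (U2 (y, 0)) = (\<chi> i. snd (fst (U ((0, y), 0)) $ i))"
    "\<And>x y k. k \<in> F \<Longrightarrow> U ((x, y), k) =
      ((\<chi> i. (fst (U1 (x, k)) $ i, fst (U2 (y, snd (U1 (x, k)))) $ i)), snd (U2 (y, snd (U1 (x, k)))))"
proof -
  define up :: "(('h1 \<times> 'h2) ^ 'n) \<times> 'm \<Rightarrow> 'h1 ^ 'n" where "up z = (\<chi> i. fst (fst z $ i))" for z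
  define lo :: "(('h1 \<times> 'h2) ^ 'n) \<times> 'm \<Rightarrow> ('h2 ^ 'n) \<times> 'm"
    where "lo z = ((\<chi> i. snd (fst z $ i)), snd z)" for z
  have blc: "bounded_clinear up" "bounded_clinear lo"
    unfolding up_def lo_def
    by (intro bounded_clinear_vec_lambda bounded_clinear_Pair bounded_clinear_fst'
        bounded_clinear_snd' bounded_clinear_vec_nth' bounded_clinear_id)+
  have cin: "cinner z z' = cinner (up z) (up z') + cinner (lo z) (lo z')" for z z'
    by (cases z; cases z') (simp add: up_def lo_def cinner_Pair cinner_vec_def cinner_prod_def sum.distrib)
  have recon: "z = z'" if "up z = up z'" "lo z = lo z'" for z z'
    using that by (auto simp: up_def lo_def vec_eq_iff prod_eq_iff)
  define V where "V y = lo (U ((0, y), 0))" for y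
  have V: "bounded_clinear V"
    unfolding V_def
    by (rule bounded_clinear_compose[OF blc(2)], rule bounded_clinear_compose[OF U])
      (intro bounded_clinear_Pair bounded_clinear_zero bounded_clinear_id)
  have upV: "up (U ((0, y), 0)) = 0" for y
    by (simp add: up_def tri vec_eq_iff)
  note F0 = closed_csubspaceD(1)[OF F] and G0 = closed_csubspaceD(1)[OF G]
  note UD = unitary_betweenD[OF unit]
  have cV: "cinner (V y) (V y') = cinner y y'" for y y'
    using UD(4)[of "((0, y), 0)" "((0, y'), 0)"] F0
    by (simp add: cin upV V_def cinner_Pair)
  have VG: "V y \<in> UNIV \<times> G" for y
    using UD(2)[of "((0, y), 0)"] F0 by (auto simp: V_def lo_def mem_Times_iff)
  define M where "M = (UNIV \<times> G) \<inter> ortho_compl (range V)"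
  have M: "closed_csubspace M"
    unfolding M_def
    by (intro closed_csubspace_Int closed_csubspace_Times closed_csubspace_UNIV G
        closed_csubspace_ortho_compl)
  have MV: "cinner l (V y) = 0" if "l \<in> M" for l y
    using that by (auto simp: M_def ortho_compl_def)
  have MV': "cinner (V y) l = 0" if "l \<in> M" for l y
    using MV[OF that] by (simp add: cinner_commute_0)
  define e1 :: "'h1 \<times> 'k \<Rightarrow> ('h1 \<times> 'h2) \<times> 'k" where "e1 z = ((fst z, 0), snd z)" for z
  have e1: "bounded_clinear e1"
    unfolding e1_def
    by (intro bounded_clinear_Pair bounded_clinear_zero bounded_clinear_fst bounded_clinear_snd)
  have norm_e1: "norm (e1 z) = norm z" for z
    by (cases z) (simp add: e1_def norm_Pair)
  define U1 where "U1 z = (up (U (e1 z)), lo (U (e1 z)))" for z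
  \<comment> \<open>On \<open>M\<close> this is the sum of \<open>V\<close> and the inclusion; the
    projection makes it a contraction on the whole ambient type.\<close>
  define U2 where "U2 z = V (fst z) + ortho_proj M (snd z)" for z
  note P = bounded_clinear_ortho_proj[OF M]
  have U1b: "bounded_clinear U1"
    unfolding U1_def
    by (intro bounded_clinear_Pair bounded_clinear_compose[OF blc(1) bounded_clinear_compose[OF U e1]]
        bounded_clinear_compose[OF blc(2) bounded_clinear_compose[OF U e1]])
  have U2b: "bounded_clinear U2"
    unfolding U2_def
    by (intro bounded_clinear_plus bounded_clinear_compose[OF V bounded_clinear_fst]
        bounded_clinear_compose[OF P bounded_clinear_snd])
  have cU1: "cinner (U1 z) (U1 z') = cinner (U (e1 z)) (U (e1 z'))" for z z'
    by (simp add: U1_def cinner_Pair cin)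
  have U1c: "norm (U1 z) \<le> norm z" for z
    using norm_eq_if_cinner_eq[OF cU1] contr[of "e1 z"] by (simp add: norm_e1)
  have cU2: "cinner (U2 z) (U2 z')
      = cinner (fst z) (fst z') + cinner (ortho_proj M (snd z)) (ortho_proj M (snd z'))" for z z'
    by (simp add: U2_def cinner_add_left cinner_add_right cV MV MV' ortho_proj_in[OF M])
  have U2c: "norm (U2 z) \<le> norm z" for z
  proof -
    have "norm (U2 z) = norm (fst z, ortho_proj M (snd z))"
      by (rule norm_eq_if_cinner_eq) (simp add: cU2 cinner_Pair)
    also have "\<dots> \<le> norm (fst z, snd z)"
      unfolding norm_Pair
      by (intro real_sqrt_le_mono add_left_mono power_mono norm_ortho_proj_le[OF M] norm_ge_zero)
    finally show ?thesis by simp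
  qed
  have loU1: "lo (U (e1 (x, k))) \<in> M" if k: "k \<in> F" for x k
  proof -
    have "lo (U (e1 (x, k))) \<in> UNIV \<times> G"
      using UD(2)[of "((x, 0), k)"] k by (auto simp: lo_def e1_def mem_Times_iff)
    moreover have "cinner (lo (U (e1 (x, k)))) (V y) = 0" for y
    proof -
      have "cinner (U ((x, 0), k)) (U ((0, y), 0)) = 0"
        using UD(4)[of "((x, 0), k)" "((0, y), 0)"] k F0 by (simp add: cinner_Pair)
      then show ?thesis
        by (simp add: cin upV e1_def V_def)
    qed
    ultimately show ?thesis
      by (auto simp: M_def ortho_compl_def)
  qed
  have unit1: "unitary_between (UNIV \<times> F) (UNIV \<times> M) U1"
  proof (rule unitary_betweenI[OF U1b])
    show "U1 z \<in> UNIV \<times> M" if "z \<in> UNIV \<times> F" for z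
      using that loU1 by (auto simp: U1_def)
    show "cinner (U1 z) (U1 z') = cinner z z'" if "z \<in> UNIV \<times> F" "z' \<in> UNIV \<times> F" for z z'
      unfolding cU1 using UD(4)[of "e1 z" "e1 z'"] that by (auto simp: e1_def cinner_Pair)
    show "\<exists>z\<in>UNIV \<times> F. w = U1 z" if w: "w \<in> UNIV \<times> M" for w
    proof -
      obtain a l where al: "w = (a, l)" "l \<in> M" using w by auto
      define v where "v = ((\<chi> i. (a $ i, fst l $ i)), snd l)"
      have ul: "up v = a" "lo v = l"
        by (simp_all add: v_def up_def lo_def)
      have "v \<in> UNIV \<times> G"
        using al by (auto simp: v_def M_def)
      from UD(3)[OF this] obtain x y k where xyk: "v = U ((x, y), k)" "k \<in> F"
        by auto
      \<comment> \<open>Since l is orthogonal to the range of \<open>V\<close>, the preimage has no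
        component in the second state space.\<close>
      have "cinner y y = cinner (U ((x, y), k)) (U ((0, y), 0))"
        using UD(4)[of "((x, y), k)" "((0, y), 0)"] xyk F0 by (simp add: cinner_Pair)
      also have "\<dots> = 0"
        using MV[OF al(2), of y] by (simp add: cin upV ul flip: xyk(1) V_def)
      finally have "w = U1 (x, k)"
        using ul xyk al by (simp add: U1_def e1_def)
      then show ?thesis using xyk by blast
    qed
  qed
  have unit2: "unitary_between (UNIV \<times> M) (UNIV \<times> G) U2"
  proof (rule unitary_betweenI[OF U2b])
    note UG = closed_csubspace_Times[OF closed_csubspace_UNIV G]
    show "U2 z \<in> UNIV \<times> G" if "z \<in> UNIV \<times> M" for z
      unfolding U2_def using ortho_proj_in[OF M, of "snd z"]
      by (intro closed_csubspaceD(2)[OF UG] VG) (auto simp: M_def)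
    show "cinner (U2 z) (U2 z') = cinner z z'" if "z \<in> UNIV \<times> M" "z' \<in> UNIV \<times> M" for z z'
      using that by (auto simp: cU2 cinner_Pair ortho_proj_id[OF M])
    show "\<exists>z\<in>UNIV \<times> M. w = U2 z" if w: "w \<in> UNIV \<times> G" for w
    proof -
      define v :: "(('h1 \<times> 'h2) ^ 'n) \<times> 'm" where "v = ((\<chi> i. (0, fst w $ i)), snd w)"
      have ul: "up v = 0" "lo v = w"
        by (simp_all add: v_def up_def lo_def vec_eq_iff)
      have "v \<in> UNIV \<times> G"
        using w by (auto simp: v_def)
      from UD(3)[OF this] obtain x y k where xyk: "v = U ((x, y), k)" "k \<in> F"
        by auto
      \<comment> \<open>With y the second state of the preimage of (0, w), V y is the projection of
        w to the range of \<open>V\<close>, and the remainder lies in \<open>M\<close>.\<close>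
      have "cinner (w - V y) (V y') = 0" for y'
      proof -
        have "cinner w (V y') = cinner v (U ((0, y'), 0))"
          by (simp add: cin upV ul V_def)
        also have "\<dots> = cinner y y'"
          unfolding xyk(1) using UD(4)[of "((x, y), k)" "((0, y'), 0)"] xyk(2) F0
          by (simp add: cinner_Pair)
        finally show ?thesis by (simp add: cinner_diff_left cV)
      qed
      then have "w - V y \<in> M"
        using closed_csubspaceD(3)[OF UG w VG] by (auto simp: M_def ortho_compl_def)
      moreover from this have "w = U2 (y, w - V y)"
        by (simp add: U2_def ortho_proj_id[OF M])
      ultimately show ?thesis by blast
    qed
  qed
  have casc: "U ((x, y), k) =
      ((\<chi> i. (fst (U1 (x, k)) $ i, fst (U2 (y, snd (U1 (x, k)))) $ i)), snd (U2 (y, snd (U1 (x, k)))))"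
    if k: "k \<in> F" for x y k
  proof -
    have sum: "U ((x, y), k) = U (e1 (x, k)) + U ((0, y), 0)"
      using bounded_clinear_add[OF U, of "e1 (x, k)" "((0, y), 0)"] by (simp add: e1_def)
    have "U2 (y, snd (U1 (x, k))) = lo (U ((x, y), k))"
      unfolding sum
      by (simp add: U2_def U1_def ortho_proj_id[OF M loU1[OF k]] V_def bounded_clinear_add[OF blc(2)])
    moreover have "fst (U1 (x, k)) = up (U ((x, y), k))"
      unfolding sum by (simp add: U1_def bounded_clinear_add[OF blc(1)] upV)
    ultimately show ?thesis
      by (simp add: up_def lo_def vec_eq_iff prod_eq_iff)
  qed
  have "fst (U1 (x, 0)) = (\<chi> i. fst (fst (U ((x, 0), 0)) $ i))" for x
    by (simp add: U1_def up_def e1_def)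
  moreover have "fst (U2 (y, 0)) = (\<chi> i. snd (fst (U ((0, y), 0)) $ i))" for y
    by (simp add: U2_def V_def lo_def bounded_clinear_0[OF P])
  ultimately show thesis
    using M U1b U1c U2b U2c unit1 unit2 casc by (intro that)
qed

text \<open>A unitary colligation with main operator \<open>S\<^sup>*\<close> is the Halmos colligation of \<open>S\<close> plus a
  unitary feedthrough on the inputs \<open>E\<close> that do not reach the state. The map \<open>j\<close> moves \<open>E\<close> to a
  prescribed ambient space.\<close>

lemma colligation_halmos_decomposition:
  fixes U :: "'h::chilbert_space \<times> 'k::chilbert_space \<Rightarrow> ('h ^ 'n::finite) \<times> 'l::chilbert_space"
    and j :: "'k \<Rightarrow> 'm::chilbert_space"
  assumes S: "row_contraction S" and U: "bounded_clinear U"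
    and F: "closed_csubspace F" and G: "closed_csubspace G"
    and unit: "unitary_between (UNIV \<times> F) (UNIV \<times> G) U"
    and main: "\<And>x. fst (U (x, 0)) = cadjoint (row_op S) x"
    and j: "bounded_clinear j" "bounded_clinear j'" "\<And>k. j' (j k) = k"
      "\<And>k k'. cinner (j k) (j k') = cinner k k'"
  obtains E :: "'m set" and \<alpha> :: "('h ^ 'n) \<times> 'm \<Rightarrow> 'k" and \<beta> :: "'h \<times> 'm \<Rightarrow> 'l"
  where "closed_csubspace E"
    "unitary_between (defect_space S \<times> E) F \<alpha>" "unitary_between (defect_star_space S \<times> E) G \<beta>"
    "\<And>x d e. d \<in> defect_space S \<Longrightarrow> e \<in> E \<Longrightarrow>
      U (x, \<alpha> (d, e)) = (fst (halmos S (x, d)), \<beta> (snd (halmos S (x, d)), e))"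
proof -
  note UD = unitary_betweenD[OF unit]
  note F0 = closed_csubspaceD(1)[OF F] and G0 = closed_csubspaceD(1)[OF G]
  note R = bounded_clinear_row(1)[OF S] and bD = bounded_clinear_defect[OF S]
    and bDs = bounded_clinear_defect_star[OF S]
  obtain V where V: "unitary_between (UNIV \<times> G) (UNIV \<times> F) V"
    and UV: "\<And>w. w \<in> UNIV \<times> G \<Longrightarrow> U (V w) = w"
    by (rule unitary_between_inverse[OF closed_csubspace_Times[OF closed_csubspace_UNIV F] unit]) blast
  note VD = unitary_betweenD[OF V]
  \<comment> \<open>The inverse of a unitary acts as its adjoint between the subspaces.\<close>
  have swap: "cinner (V w) z = cinner w (U z)" if "w \<in> UNIV \<times> G" "z \<in> UNIV \<times> F" for w z
    using UD(4)[OF VD(2)[OF that(1)] that(2)] UV[OF that(1)] by simp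
  \<comment> \<open>\<open>q\<close> is the adjoint of the input-to-state block, and
    \<open>c\<close> the state-to-output block. Unitarity gives them the Gram forms of the two
    defect operators, so they differ from these by the isometries \<open>W\<close> and
    \<open>Ws\<close> below.\<close>
  define q where "q v = snd (V (v, 0))" for v
  define c where "c x = snd (U (x, 0))" for x
  have bq: "bounded_clinear q" and bc: "bounded_clinear c"
    unfolding q_def c_def
    by (rule bounded_clinear_snd', rule bounded_clinear_compose[OF VD(1)] bounded_clinear_compose[OF UD(1)],
        intro bounded_clinear_Pair bounded_clinear_id bounded_clinear_zero)+
  have fstV: "fst (V (v, 0)) = row_op S v" for v
  proof (rule cinner_eqI)
    fix x
    have "cinner (V (v, 0)) (x, 0) = cinner (v, 0) (U (x, 0))"
      by (rule swap) (auto simp: F0 G0)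
    then have "cinner (fst (V (v, 0))) x = cinner v (cadjoint (row_op S) x)"
      by (simp add: cinner_prod_def main)
    then show "cinner (fst (V (v, 0))) x = cinner (row_op S v) x"
      by (simp add: cinner_cadjoint[OF R])
  qed
  have Veq: "V (v, 0) = (row_op S v, q v)" for v
    by (simp add: q_def prod_eq_iff fstV)
  have Ueq: "U (x, 0) = (cadjoint (row_op S) x, c x)" for x
    by (simp add: c_def prod_eq_iff main)
  have qF: "q v \<in> F" for v
    using VD(2)[of "(v, 0)"] G0 by (simp add: Veq)
  have cG: "c x \<in> G" for x
    using UD(2)[of "(x, 0)"] F0 by (simp add: Ueq)
  have Dq: "cinner (defect S v) (defect S w) = cinner (q v) (q w)" for v w
  proof -
    have "cinner (V (v, 0)) (V (w, 0)) = cinner (v, 0) (w, 0 :: 'l)"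
      using VD(4)[of "(v, 0)" "(w, 0)"] G0 by simp
    then have "cinner (q v) (q w) = cinner v w - cinner (row_op S v) (row_op S w)"
      by (simp add: Veq cinner_Pair eq_diff_eq add.commute)
    then show ?thesis
      by (simp add: defect_selfadjoint[OF S] defect_sq[OF S] cinner_diff_right cinner_cadjoint[OF R])
  qed
  have Dc: "cinner (defect_star S x) (defect_star S y) = cinner (c x) (c y)" for x y
  proof -
    have "cinner (U (x, 0)) (U (y, 0)) = cinner (x, 0) (y, 0 :: 'k)"
      using UD(4)[of "(x, 0)" "(y, 0)"] F0 by simp
    then have "cinner (c x) (c y) = cinner x y - cinner (cadjoint (row_op S) x) (cadjoint (row_op S) y)"
      by (simp add: Ueq cinner_Pair eq_diff_eq add.commute)
    then show ?thesis
      by (simp add: defect_star_selfadjoint[OF S] defect_star_sq[OF S] cinner_diff_right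
          cinner_cadjoint'[OF R])
  qed
  let ?Q = "closure (range q)" and ?C = "closure (range c)"
  have Q: "closed_csubspace ?Q" and C: "closed_csubspace ?C"
    by (intro closed_csubspace_closure csubspace_range bq bc)+
  have QF: "?Q \<subseteq> F" by (rule closure_minimal) (auto simp: qF closed_csubspaceD(5)[OF F])
  have CG: "?C \<subseteq> G" by (rule closure_minimal) (auto simp: cG closed_csubspaceD(5)[OF G])
  obtain W where W: "unitary_between (defect_space S) ?Q W" and WD: "\<And>v. W (defect S v) = q v"
    unfolding defect_space_def by (rule isometry_extension[OF bD bq Dq]) blast
  obtain Ws where Ws: "unitary_between (defect_star_space S) ?C Ws" and WsD: "\<And>x. Ws (defect_star S x) = c x"
    unfolding defect_star_space_def by (rule isometry_extension[OF bDs bc Dc]) blast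
  note WDs = unitary_betweenD[OF W] and WsDs = unitary_betweenD[OF Ws]
  \<comment> \<open>The kernel in \<open>F\<close> of the input-to-state block, described through
    its adjoint.\<close>
  define E0 where "E0 = F \<inter> ortho_compl (range q)"
  have E0: "closed_csubspace E0"
    unfolding E0_def by (intro closed_csubspace_Int F closed_csubspace_ortho_compl)
  define \<delta> where "\<delta> k = snd (U (0, k))" for k
  have b\<delta>: "bounded_clinear \<delta>"
    unfolding \<delta>_def
    by (rule bounded_clinear_snd', rule bounded_clinear_compose[OF UD(1)],
        intro bounded_clinear_Pair bounded_clinear_id bounded_clinear_zero)
  have UE: "U (0, k) = (0, \<delta> k)" if k: "k \<in> E0" for k
  proof -
    have "cinner (fst (U (0, k))) v = 0" for v
    proof -
      have "cinner (V (v, 0)) (0, k) = cinner (v, 0) (U (0, k))"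
        using k G0 by (intro swap) (auto simp: E0_def)
      then have "cinner (q v) k = cinner v (fst (U (0, k)))"
        by (simp add: Veq cinner_prod_def)
      moreover have "cinner k (q v) = 0"
        using k by (auto simp: E0_def ortho_compl_def)
      ultimately show ?thesis
        using cinner_commute_0[of k "q v"] cinner_commute_0[of v "fst (U (0, k))"] by simp
    qed
    then have "fst (U (0, k)) = 0"
      using cinner_self_eq_0 by blast
    then show ?thesis by (simp add: \<delta>_def prod_eq_iff)
  qed
  have \<delta>G: "\<delta> k \<in> G" if "k \<in> E0" for k
    using UD(2)[of "(0, k)"] UE[OF that] that by (simp add: E0_def)
  have c\<delta>: "cinner (\<delta> k) (\<delta> k') = cinner k k'" if "k \<in> E0" "k' \<in> E0" for k k'
    using UD(4)[of "(0, k)" "(0, k')"] UE that by (simp add: E0_def cinner_Pair)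
  have \<delta>c: "cinner (\<delta> k) (c x) = 0" if "k \<in> E0" for k x
    using UD(4)[of "(0, k)" "(x, 0)"] UE[OF that] Ueq F0 that by (simp add: E0_def cinner_Pair)
  have Eq: "cinner k y = 0" if "k \<in> E0" "y \<in> ?Q" for k y
    by (rule ortho_compl_closure[OF _ that(2)]) (use that(1) in \<open>auto simp: E0_def ortho_compl_def\<close>)
  have \<delta>C: "cinner (\<delta> k) y = 0" if "k \<in> E0" "y \<in> ?C" for k y
    by (rule ortho_compl_closure[OF _ that(2)]) (use \<delta>c[OF that(1)] in auto)
  have UW: "U (0, W d) = (defect S d, - Ws (row_op S d))" if d: "d \<in> defect_space S" for d
  proof -
    let ?A = "\<lambda>d. U (0, W d)" and ?B = "\<lambda>d. (defect S d, - Ws (row_op S d))"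
    have bA: "bounded_clinear ?A"
      by (rule bounded_clinear_compose[OF UD(1)]) (intro bounded_clinear_Pair bounded_clinear_zero WDs(1))
    have bB: "bounded_clinear ?B"
      using bounded_clinear_minus_fun[OF bounded_clinear_zero bounded_clinear_compose[OF WsDs(1) R]]
      by (intro bounded_clinear_Pair bD) simp
    \<comment> \<open>On the range of the defect operator, (0, q v) is V (v, 0) minus (S v, 0), and
      \<open>U\<close> undoes \<open>V\<close>. The relation between S and its defect operators
      brings the output to the form of the Halmos matrix.\<close>
    have "?A (defect S v) = ?B (defect S v)" for v
    proof -
      have "(0, q v) = V (v, 0) - (row_op S v, 0)"
        by (simp add: Veq)
      then have "U (0, q v) = (v, 0) - U (row_op S v, 0)"
        using UV[of "(v, 0)"] G0 by (simp add: bounded_clinear_diff[OF UD(1)])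
      then show ?thesis
        by (simp add: WD Ueq defect_sq[OF S] row_op_defect[OF S] WsD)
    qed
    then have "closure (range (defect S)) \<subseteq> {d. ?A d = ?B d}"
      by (intro closure_minimal closed_Collect_eq continuous_on_bounded_clinear bA bB) auto
    then show ?thesis
      using d by (auto simp: defect_space_def)
  qed
  \<comment> \<open>The image of \<open>E0\<close> under \<open>j\<close>, written with preimages so
    that closedness is immediate.\<close>
  define E where "E = {m. j (j' m) - m \<in> {0}} \<inter> {m. j' m \<in> E0}"
  have zero: "closed_csubspace {0 :: 'm}"
    by (rule closed_csubspaceI) auto
  have E: "closed_csubspace E"
    unfolding E_def
    by (intro closed_csubspace_Int closed_csubspace_vimage zero E0 j bounded_clinear_minus_fun
        bounded_clinear_compose[OF j(1) j(2)] bounded_clinear_id)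
  have j'E: "j' e \<in> E0" "j (j' e) = e" if "e \<in> E" for e
    using that by (auto simp: E_def)
  have jE: "j k \<in> E" if "k \<in> E0" for k
    using that by (simp add: E_def j)
  have cj': "cinner (j' e) (j' e') = cinner e e'" if "e \<in> E" "e' \<in> E" for e e'
    using j(4)[of "j' e" "j' e'"] that j'E by simp
  define \<alpha> where "\<alpha> p = W (fst p) + j' (snd p)" for p
  define \<beta> where "\<beta> p = Ws (fst p) + \<delta> (j' (snd p))" for p
  have "unitary_between (defect_space S \<times> E) F \<alpha>"
  proof (rule unitary_betweenI)
    show "bounded_clinear \<alpha>"
      unfolding \<alpha>_def
      by (intro bounded_clinear_plus bounded_clinear_compose[OF WDs(1) bounded_clinear_fst]
          bounded_clinear_compose[OF j(2) bounded_clinear_snd])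
    show "\<alpha> p \<in> F" if "p \<in> defect_space S \<times> E" for p
      using that WDs(2) QF j'E unfolding \<alpha>_def
      by (intro closed_csubspaceD(2)[OF F]) (auto simp: E0_def)
    show "cinner (\<alpha> p) (\<alpha> p') = cinner p p'" if "p \<in> defect_space S \<times> E" "p' \<in> defect_space S \<times> E" for p p'
    proof -
      obtain d e d' e' where p: "p = (d, e)" "p' = (d', e')" "d \<in> defect_space S" "d' \<in> defect_space S"
        "e \<in> E" "e' \<in> E"
        using \<open>p \<in> _\<close> \<open>p' \<in> _\<close> by auto
      have "cinner (j' e) (W d') = 0" "cinner (j' e') (W d) = 0"
        using Eq j'E WDs(2) p by auto
      then show ?thesis
        by (simp add: p \<alpha>_def cinner_Pair cinner_add_left cinner_add_right WDs(4) cj' cinner_commute_0[of "W d"])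
    qed
    show "\<exists>p\<in>defect_space S \<times> E. k = \<alpha> p" if k: "k \<in> F" for k
    proof -
      let ?P = "ortho_proj ?Q k"
      obtain d where d: "d \<in> defect_space S" "?P = W d"
        using WDs(3)[OF ortho_proj_in[OF Q]] by blast
      have "k - ?P \<in> F"
        using ortho_proj_in[OF Q, of k] QF by (intro closed_csubspaceD(3)[OF F k]) auto
      moreover have "cinner (k - ?P) (q v) = 0" for v
        by (rule ortho_proj_orth[OF Q]) (auto intro: subsetD[OF closure_subset])
      ultimately have e: "k - ?P \<in> E0"
        by (auto simp: E0_def ortho_compl_def)
      have "k = \<alpha> (d, j (k - ?P))"
        using d by (simp add: \<alpha>_def j)
      then show ?thesis using d jE[OF e] by blast
    qed
  qed
  moreover have "unitary_between (defect_star_space S \<times> E) G \<beta>"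
  proof (rule unitary_betweenI)
    show "bounded_clinear \<beta>"
      unfolding \<beta>_def
      by (intro bounded_clinear_plus bounded_clinear_compose[OF WsDs(1) bounded_clinear_fst]
          bounded_clinear_compose[OF b\<delta> bounded_clinear_compose[OF j(2) bounded_clinear_snd]])
    show "\<beta> p \<in> G" if "p \<in> defect_star_space S \<times> E" for p
      using that WsDs(2) CG j'E \<delta>G unfolding \<beta>_def
      by (intro closed_csubspaceD(2)[OF G]) auto
    show "cinner (\<beta> p) (\<beta> p') = cinner p p'"
      if "p \<in> defect_star_space S \<times> E" "p' \<in> defect_star_space S \<times> E" for p p'
    proof -
      obtain d e d' e' where p: "p = (d, e)" "p' = (d', e')" "d \<in> defect_star_space S"
        "d' \<in> defect_star_space S" "e \<in> E" "e' \<in> E"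
        using \<open>p \<in> _\<close> \<open>p' \<in> _\<close> by auto
      have "cinner (\<delta> (j' e)) (Ws d') = 0" "cinner (\<delta> (j' e')) (Ws d) = 0"
        using \<delta>C j'E WsDs(2) p by auto
      then show ?thesis
        by (simp add: p \<beta>_def cinner_Pair cinner_add_left cinner_add_right WsDs(4) c\<delta> j'E cj'
            cinner_commute_0[of "Ws d"])
    qed
    show "\<exists>p\<in>defect_star_space S \<times> E. g = \<beta> p" if g: "g \<in> G" for g
    proof -
      let ?P = "ortho_proj ?C g"
      obtain d where d: "d \<in> defect_star_space S" "?P = Ws d"
        using WsDs(3)[OF ortho_proj_in[OF C]] by blast
      have gG: "g - ?P \<in> G"
        using ortho_proj_in[OF C, of g] CG by (intro closed_csubspaceD(3)[OF G g]) auto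
      have orth: "cinner (g - ?P) (c x) = 0" for x
        by (rule ortho_proj_orth[OF C]) (auto intro: subsetD[OF closure_subset])
      \<comment> \<open>The remainder is orthogonal to all outputs coming from states, so its
        preimage has zero state, and its input does not reach the state either: k lies in
        \<open>E0\<close>.\<close>
      obtain x k where xk: "V (0, g - ?P) = (x, k)" by (cases "V (0, g - ?P)")
      have kF: "k \<in> F"
        using VD(2)[of "(0, g - ?P)"] gG xk by simp
      have "cinner (V (0, g - ?P)) (x, 0) = cinner (0, g - ?P) (U (x, 0))"
        by (rule swap) (auto simp: gG F0)
      then have x: "x = 0"
        by (simp add: xk Ueq cinner_Pair orth)
      have Uk: "U (0, k) = (0, g - ?P)"
        using UV[of "(0, g - ?P)"] gG xk x by simp
      have "cinner (q v) k = 0" for v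
      proof -
        have "cinner (V (v, 0)) (0, k) = cinner (v, 0) (U (0, k))"
          by (rule swap) (auto simp: kF G0)
        then show ?thesis by (simp add: Veq cinner_Pair Uk)
      qed
      then have e: "k \<in> E0"
        using kF by (auto simp: E0_def ortho_compl_def cinner_commute_0[of k])
      have "g = \<beta> (d, j k)"
        using d Uk by (simp add: \<beta>_def j \<delta>_def)
      then show ?thesis using d jE[OF e] by blast
    qed
  qed
  moreover have "U (x, \<alpha> (d, e)) = (fst (halmos S (x, d)), \<beta> (snd (halmos S (x, d)), e))"
    if d: "d \<in> defect_space S" and e: "e \<in> E" for x d e
  proof -
    have "(x, \<alpha> (d, e)) = (x, 0) + (0, W d) + (0, j' e)"
      by (simp add: \<alpha>_def)
    then have "U (x, \<alpha> (d, e)) = U (x, 0) + U (0, W d) + U (0, j' e)"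
      by (simp only: bounded_clinear_add[OF UD(1)])
    also have "\<dots> = (fst (halmos S (x, d)), \<beta> (snd (halmos S (x, d)), e))"
      by (simp add: Ueq UW[OF d] UE j'E[OF e] halmos_def \<beta>_def bounded_clinear_diff[OF WsDs(1)] WsD)
    finally show ?thesis .
  qed
  ultimately show thesis
    by (intro that[OF E])
qed

lemma bounded_operator_betweenI:
  assumes "bounded_clinear B" "csubspace X" "\<And>x. x \<in> X \<Longrightarrow> A x = B x" "\<And>x. x \<in> X \<Longrightarrow> B x \<in> Y"
  shows "bounded_operator_between X Y A"
proof -
  obtain K where "\<And>x. norm (B x) \<le> K * norm x"
    using bounded_clinear_pos_bounded[OF assms(1)] by blast
  then show ?thesis
    using assms
    by (auto simp: bounded_operator_between_def complex_vector.subspace_add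
        complex_vector.subspace_scale bounded_clinear_add bounded_clinear_scaleC)
qed

section \<open>Constrained characteristic functions\<close>

context
  fixes J :: "('n::finite fock \<Rightarrow> 'n fock) set"
  assumes J: "J \<subseteq> right_commutant"
begin

lemma N_space_create_right:
  "(\<And>g. g \<in> N_space J \<Longrightarrow> cinner f g = 0) \<Longrightarrow> g \<in> N_space J \<Longrightarrow> cinner (create_right i f) g = 0"
  by (rule create_right_N_space_orth[OF J])

lemma transfer_fun_halmos_in:
  fixes S :: "'n \<Rightarrow> 'h::chilbert_space \<Rightarrow> 'h"
  assumes "row_contraction S" "\<And>w. ell2_nth F w \<in> defect_space S"
  shows "ell2_nth (transfer_fun (halmos S) 1 F) w \<in> defect_star_space S"
  by (rule transfer_fun_in[OF bounded_clinear_halmos[OF assms(1)] eq_refl[OF norm_halmos[OF assms(1)]],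
        where F = "defect_space S"])
    (use unitary_betweenD(2)[OF unitary_between_halmos[OF assms(1)]] assms(2) in auto)

lemma constrained_char_fun_eq:
  fixes S :: "'n \<Rightarrow> 'h::chilbert_space \<Rightarrow> 'h"
  assumes S: "row_contraction S" and F: "\<And>w. ell2_nth F w \<in> defect_space S"
  shows "constrained_char_fun J S F = tensor_proj (N_space J) (transfer_fun (halmos S) 1 F)"
  unfolding constrained_char_fun_def char_fun_eq_transfer_fun[OF S]
  by (rule ortho_proj_tensor_space[OF closed_csubspace_N_space closed_csubspace_defect_star_space[OF S]
        transfer_fun_halmos_in[OF S F]])

text \<open>By \<open>eq\<close> the component in \<open>E\<close> never enters the state, so
  \<open>U\<close> driven by \<alpha> (d, e) and the Halmos colligation driven by d have the same
  states. The compression commutes with \<beta> and the coordinate embeddings, as these act on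
  coefficients only.\<close>

lemma constrained_char_fun_block:
  fixes U :: "'h::chilbert_space \<times> 'k::chilbert_space \<Rightarrow> ('h ^ 'n) \<times> 'l::chilbert_space"
    and S :: "'n \<Rightarrow> 'h \<Rightarrow> 'h" and E :: "'m::chilbert_space set"
  assumes U: "bounded_clinear U" "\<And>z. norm (U z) \<le> norm z" and S: "row_contraction S"
    and E: "closed_csubspace E" and \<alpha>: "bounded_clinear \<alpha>" and \<beta>: "bounded_clinear \<beta>"
    and eq: "\<And>x d e. d \<in> defect_space S \<Longrightarrow> e \<in> E \<Longrightarrow>
      U (x, \<alpha> (d, e)) = (fst (halmos S (x, d)), \<beta> (snd (halmos S (x, d)), e))"
    and F: "F \<in> N_space J \<otimes>\<^sub>s (defect_space S \<times> E)"
  shows "tensor_proj (N_space J) (transfer_fun U 1 ((id \<otimes>\<^sub>o \<alpha>) F))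
      = (id \<otimes>\<^sub>o \<beta>) (block_diag (constrained_char_fun J S) id F)"
    and "block_diag (constrained_char_fun J S) id F \<in> N_space J \<otimes>\<^sub>s (defect_star_space S \<times> E)"
proof -
  note N = closed_csubspace_N_space[of J]
  note D = closed_csubspace_defect_space[OF S] and Ds = closed_csubspace_defect_star_space[OF S]
  note Q = bounded_clinear_ortho_proj[OF closed_csubspace_tensor_space]
  let ?inl = "\<lambda>x :: 'h. (x, 0 :: 'm)" and ?inr = "\<lambda>y :: 'm. (0 :: 'h, y)"
  have bl: "bounded_clinear ?inl" "bounded_clinear ?inr"
    by (intro bounded_clinear_Pair bounded_clinear_id bounded_clinear_zero)+
  note H = bounded_clinear_halmos[OF S] eq_refl[OF norm_halmos[OF S]]
  define F1 where "F1 = (id \<otimes>\<^sub>o fst) F"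
  define F2 where "F2 = (id \<otimes>\<^sub>o snd) F"
  have F1: "F1 \<in> N_space J \<otimes>\<^sub>s defect_space S" and F2: "F2 \<in> N_space J \<otimes>\<^sub>s E"
    unfolding F1_def F2_def
    by (rule tensor_id_in_tensor_space[OF N _ closed_csubspace_Times[OF D E] _ _ F];
        auto simp: D E)+
  have nth1: "ell2_nth F1 w = fst (ell2_nth F w)" and nth2: "ell2_nth F2 w = snd (ell2_nth F w)" for w
    by (simp_all add: F1_def F2_def ell2_nth_tensor_id)
  have in1: "ell2_nth F1 w \<in> defect_space S" and in2: "ell2_nth F2 w \<in> E" for w
    using F1 F2 by (auto simp: tensor_space_eq[OF N] D E)
  define G where "G = (id \<otimes>\<^sub>o ?inl) (transfer_fun (halmos S) 1 F1) + (id \<otimes>\<^sub>o ?inr) F2"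
  have G: "tensor_proj (N_space J) G = block_diag (constrained_char_fun J S) id F"
    unfolding block_diag_def F1_def[symmetric] F2_def[symmetric] G_def
    by (simp add: bounded_clinear_add[OF Q] tensor_proj_tensor_id[OF N] bl
        tensor_proj_id[OF N F2 E] constrained_char_fun_eq[OF S in1])
  have "transfer_fun U 1 ((id \<otimes>\<^sub>o \<alpha>) F) = (id \<otimes>\<^sub>o \<beta>) G"
  proof (rule ell2_eqI)
    fix w
    let ?u = "ell2_nth ((id \<otimes>\<^sub>o \<alpha>) F)"
    have u: "?u w = \<alpha> (ell2_nth F1 w, ell2_nth F2 w)" for w
      by (simp add: ell2_nth_tensor_id[OF \<alpha>] nth1 nth2)
    have "state U 1 u v = state (halmos S) 1 (ell2_nth F1) v"
      if "\<And>w. u w = \<alpha> (ell2_nth F1 w, ell2_nth F2 w)" for u v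
      by (induction v) (simp_all add: that eq[OF in1 in2])
    from this[OF u] have st: "state U 1 ?u v = state (halmos S) 1 (ell2_nth F1) v" for v .
    have nG: "ell2_nth G w = (response (halmos S) 1 (ell2_nth F1) w, ell2_nth F2 w)"
      by (simp add: G_def ell2_nth_tensor_id bl ell2_nth_transfer_fun[OF H])
    show "ell2_nth (transfer_fun U 1 ((id \<otimes>\<^sub>o \<alpha>) F)) w = ell2_nth ((id \<otimes>\<^sub>o \<beta>) G) w"
      by (simp add: ell2_nth_transfer_fun[OF U] ell2_nth_tensor_id[OF \<beta>] nG response_def st u
          eq[OF in1 in2])
  qed
  then show "tensor_proj (N_space J) (transfer_fun U 1 ((id \<otimes>\<^sub>o \<alpha>) F))
      = (id \<otimes>\<^sub>o \<beta>) (block_diag (constrained_char_fun J S) id F)"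
    by (simp add: tensor_proj_tensor_id[OF N \<beta>] G)
  show "block_diag (constrained_char_fun J S) id F \<in> N_space J \<otimes>\<^sub>s (defect_star_space S \<times> E)"
    unfolding G[symmetric]
    by (rule tensor_proj_in[OF N closed_csubspace_Times[OF Ds E]])
      (simp add: G_def ell2_nth_tensor_id bl transfer_fun_halmos_in[OF S in1] in2)
qed

end

section \<open>Compressions to the diagonal blocks\<close>

lemma norm_vec_cong:
  fixes v :: "'x::real_inner ^ 'n" and w :: "'y::real_inner ^ 'n"
  assumes "\<And>i. norm (v $ i) = norm (w $ i)"
  shows "norm v = norm w"
  using assms by (simp add: norm_vec_def)

text \<open>Compressions are not multiplicative in general, so agreement is required on all words.
  Single letters then give contractivity, and linear combinations give the polynomial
  relations.\<close>

lemma constrained_row_contraction_compression: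
  fixes T :: "'n::finite \<Rightarrow> 'h::chilbert_space \<Rightarrow> 'h" and A :: "'n \<Rightarrow> 'k::chilbert_space \<Rightarrow> 'k"
  assumes T: "constrained_row_contraction P T" and A: "\<And>i. bounded_clinear (A i)"
    and \<iota>: "bounded_clinear \<iota>" "\<And>x. norm (\<iota> x) = norm x" and \<pi>: "bounded_clinear \<pi>" "\<And>x. norm (\<pi> x) \<le> norm x"
    and compr: "\<And>w x. \<pi> (word_op T w (\<iota> x)) = word_op A w x"
  shows "constrained_row_contraction P A"
proof -
  note Tr = T[unfolded constrained_row_contraction_def]
  have \<pi>T: "\<pi> (T i (\<iota> x)) = A i x" for i x
    using compr[of "[i]" x] by (simp add: word_op_def)
  have "norm (row_op A v) \<le> norm v" for v
  proof -
    have "row_op A v = \<pi> (row_op T (\<chi> i. \<iota> (v $ i)))"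
      by (simp add: row_op_def bounded_clinear_sum[OF \<pi>(1)] \<pi>T)
    also have "norm \<dots> \<le> norm (\<chi> i. \<iota> (v $ i))"
      using order_trans[OF \<pi>(2) row_contractionD(2)] Tr by blast
    also have "\<dots> = norm v"
      by (rule norm_vec_cong) (simp add: \<iota>)
    finally show ?thesis .
  qed
  then have "row_contraction A"
    using A by (simp add: row_contraction_iff)
  moreover have "ncpoly_eval p A = (\<lambda>x. 0)" if "p \<in> P" for p
  proof
    fix x
    have "ncpoly_eval p A x = \<pi> (ncpoly_eval p T (\<iota> x))"
      by (simp add: ncpoly_eval_def bounded_clinear_sum[OF \<pi>(1)] bounded_clinear_scaleC[OF \<pi>(1)] compr)
    also have "ncpoly_eval p T (\<iota> x) = 0"
      using Tr that by (simp add: fun_eq_iff)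
    finally show "ncpoly_eval p A x = 0"
      by (simp add: bounded_clinear_0[OF \<pi>(1)])
  qed
  ultimately show ?thesis
    by (simp add: constrained_row_contraction_def)
qed

theorem theorem5p2:
  fixes P :: "'n::finite ncpoly set"
    and J :: "('n fock \<Rightarrow> 'n fock) set"
    and T :: "'n \<Rightarrow> 'a::chilbert_space \<times> 'b::chilbert_space \<times> 'c::chilbert_space \<Rightarrow> 'a \<times> 'b \<times> 'c"
    and S :: "'n \<Rightarrow> 'a \<Rightarrow> 'a" and N :: "'n \<Rightarrow> 'b \<Rightarrow> 'b" and C :: "'n \<Rightarrow> 'c \<Rightarrow> 'c"
    and X :: "'n \<Rightarrow> 'b \<Rightarrow> 'a" and Y :: "'n \<Rightarrow> 'c \<Rightarrow> 'a" and Z :: "'n \<Rightarrow> 'c \<Rightarrow> 'b"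
  assumes J: "J = generated_ideal P" "J \<noteq> fock_algebra"
    and entries:
      "\<And>i. bounded_clinear (S i)" "\<And>i. bounded_clinear (X i)" "\<And>i. bounded_clinear (Y i)"
      "\<And>i. bounded_clinear (N i)" "\<And>i. bounded_clinear (Z i)" "\<And>i. bounded_clinear (C i)"
    and T_form: "\<And>i x y z. T i (x, y, z) = (S i x + X i y + Y i z, N i y + Z i z, C i z)"
    and T: "constrained_row_contraction P T"
  shows "constrained_row_contraction P S \<and>
    constrained_row_contraction P N \<and>
    constrained_row_contraction P C \<and>
    (\<exists>(E\<^sub>1 :: (('a \<times> 'b \<times> 'c) \<times> (('a \<times> 'b \<times> 'c) ^ 'n)) set)
      (E\<^sub>2 :: (('a \<times> 'b \<times> 'c) \<times> (('a \<times> 'b \<times> 'c) ^ 'n)) set)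
      (E :: (('a \<times> 'b \<times> 'c) \<times> (('a \<times> 'b \<times> 'c) ^ 'n)) set) \<tau>\<^sub>1 \<tau>\<^sub>2.
        closed_csubspace E\<^sub>1 \<and> closed_csubspace E\<^sub>2 \<and> closed_csubspace E \<and>
        unitary_between (defect_star_space N \<times> E) (defect_space C \<times> E\<^sub>1) \<tau>\<^sub>1 \<and>
        unitary_between (defect_star_space S \<times> E\<^sub>2) (defect_space N \<times> E) \<tau>\<^sub>2 \<and>
        coincide (N_space J)
          (defect_space T) (defect_star_space T) (constrained_char_fun J T)
          (defect_space S \<times> E\<^sub>2) (defect_star_space C \<times> E\<^sub>1)
          (block_diag (constrained_char_fun J C) id \<circ> (id \<otimes>\<^sub>o \<tau>\<^sub>1) \<circ>
           block_diag (constrained_char_fun J N) id \<circ> (id \<otimes>\<^sub>o \<tau>\<^sub>2) \<circ>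
           block_diag (constrained_char_fun J S) id))"
proof -
  have Jc: "J \<subseteq> right_commutant"
    unfolding J(1) by (rule generated_ideal_subset)

  \<comment> \<open>Diagonal blocks as multiplicative compressions\<close>
  have S: "constrained_row_contraction P S"
  proof (rule constrained_row_contraction_compression[OF T entries(1)])
    \<comment> \<open>The first summand is invariant under T.\<close>
    have "word_op T w (x, 0) = (word_op S w x, 0)" for w x
    proof (induction w)
      case (Cons i w)
      then show ?case
        using T_form[of i "word_op S w x" 0 0]
        by (simp add: word_op_Cons zero_prod_def bounded_clinear_0 entries)
    qed (simp add: word_op_Nil)
    then show "fst (word_op T w (x, 0)) = word_op S w x" for w x
      by simp
    show "norm (fst v) \<le> norm v" for v :: "'a \<times> 'b \<times> 'c"
      by (cases v) (simp only: fst_conv norm_fst_le)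
  qed (auto intro!: bounded_clinear_Pair simp: norm_Pair)
  have N: "constrained_row_contraction P N"
  proof (rule constrained_row_contraction_compression[OF T entries(4)])
    \<comment> \<open>The first coordinate picks up entries of X but never feeds back into the other
      two.\<close>
    have "snd (word_op T w (0, y, 0)) = (word_op N w y, 0)" for w y
    proof (induction w)
      case (Cons i w)
      then show ?case
        using T_form[of i "fst (word_op T w (0, y, 0))" "word_op N w y" 0]
        by (cases "word_op T w (0, y, 0)") (simp add: word_op_Cons bounded_clinear_0 entries)
    qed (simp add: word_op_Nil)
    then show "fst (snd (word_op T w (0, y, 0))) = word_op N w y" for w y
      by simp
    show "norm (fst (snd v)) \<le> norm v" for v :: "'a \<times> 'b \<times> 'c"
      by (cases v) (auto intro: order_trans[OF norm_fst_le norm_snd_le])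
  qed (auto intro!: bounded_clinear_Pair simp: norm_Pair)
  have C: "constrained_row_contraction P C"
  proof (rule constrained_row_contraction_compression[OF T entries(6)])
    have "snd (snd (word_op T w v)) = word_op C w (snd (snd v))" for w v
    proof (induction w)
      case (Cons i w)
      then show ?case
        by (cases "word_op T w v") (simp add: word_op_Cons T_form)
    qed (simp add: word_op_Nil)
    then show "snd (snd (word_op T w (0, 0, z))) = word_op C w z" for w z
      by simp
    show "norm (snd (snd v)) \<le> norm v" for v :: "'a \<times> 'b \<times> 'c"
      by (cases v) (auto intro: order_trans[OF norm_snd_le norm_snd_le])
  qed (auto intro!: bounded_clinear_Pair simp: norm_Pair)
  have rc: "row_contraction T" "row_contraction S" "row_contraction N" "row_contraction C"
    using T S N C by (auto simp: constrained_row_contraction_def)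

  \<comment> \<open>Block entries of the adjoints\<close>
  note bT = row_contractionD(1)[OF rc(1)]
  have fstH: "fst (halmos T (v, 0)) $ i = cadjoint (T i) v" for v i
    by (simp add: halmos_def bounded_clinear_0[OF bounded_clinear_defect[OF rc(1)]] cadjoint_row_op[OF bT])
  have adj: "cinner (cadjoint (T i) v) w = cinner v (T i w)" for i v w
    by (rule cinner_cadjoint'[OF bT])
  have Tx: "T i (x, 0) = (S i x, 0)" for i x
    using T_form[of i x 0 0] by (simp add: zero_prod_def bounded_clinear_0 entries)
  have Ty: "T i (0, y, 0) = (X i y, N i y, 0)" for i y
    using T_form[of i 0 y 0] by (simp add: bounded_clinear_0 entries)
  have adj0: "fst (cadjoint (T i) (0, p)) = 0" for i p
  proof (rule cinner_eqI)
    show "cinner (fst (cadjoint (T i) (0, p))) x = cinner 0 x" for x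
      using adj[of i "(0, p)" "(x, 0)"] by (simp add: cinner_prod_def Tx)
  qed
  have adjS: "fst (cadjoint (T i) (x, 0)) = cadjoint (S i) x" for i x
  proof (rule cinner_eqI)
    show "cinner (fst (cadjoint (T i) (x, 0))) x' = cinner (cadjoint (S i) x) x'" for x'
      using adj[of i "(x, 0)" "(x', 0)"] by (simp add: cinner_prod_def Tx cinner_cadjoint'[OF entries(1)])
  qed
  have adjN: "fst (snd (cadjoint (T i) (0, y, 0))) = cadjoint (N i) y" for i y
  proof (rule cinner_eqI)
    show "cinner (fst (snd (cadjoint (T i) (0, y, 0)))) y' = cinner (cadjoint (N i) y) y'" for y'
      using adj[of i "(0, y, 0)" "(0, y', 0)"]
      by (simp add: cinner_prod_def Ty cinner_cadjoint'[OF entries(4)])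
  qed
  have adjN0: "fst (snd (cadjoint (T i) (0, 0, z))) = 0" for i z
  proof (rule cinner_eqI)
    show "cinner (fst (snd (cadjoint (T i) (0, 0, z)))) y' = cinner 0 y'" for y'
      using adj[of i "(0, 0, z)" "(0, y', 0)"] by (simp add: cinner_prod_def Ty)
  qed
  have adjC: "snd (snd (cadjoint (T i) (0, 0, z))) = cadjoint (C i) z" for i z
  proof (rule cinner_eqI)
    show "cinner (snd (snd (cadjoint (T i) (0, 0, z)))) z' = cinner (cadjoint (C i) z) z'" for z'
      using adj[of i "(0, 0, z)" "(0, 0, z')"]
      by (simp add: cinner_prod_def T_form bounded_clinear_0 entries cinner_cadjoint'[OF entries(6)])
  qed

  \<comment> \<open>Two successive cascade splittings\<close>
  note HT = bounded_clinear_halmos[OF rc(1)] eq_refl[OF norm_halmos[OF rc(1)]]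
  note DT = closed_csubspace_defect_space[OF rc(1)] and DTs = closed_csubspace_defect_star_space[OF rc(1)]
  have H0: "fst (fst (halmos T ((0, p), 0)) $ i) = 0" for p i
    by (simp add: fstH adj0)
  obtain M1 :: "((('b \<times> 'c) ^ 'n) \<times> ('a \<times> 'b \<times> 'c)) set" and U1 U' where
    M1: "closed_csubspace M1" and U1: "bounded_clinear U1" "\<And>z. norm (U1 z) \<le> norm z"
    and U': "bounded_clinear U'" "\<And>z. norm (U' z) \<le> norm z"
    and unit1: "unitary_between (UNIV \<times> defect_space T) (UNIV \<times> M1) U1"
    and unit': "unitary_between (UNIV \<times> M1) (UNIV \<times> defect_star_space T) U'"
    and main1: "\<And>x. fst (U1 (x, 0)) = (\<chi> i. fst (fst (halmos T ((x, 0), 0)) $ i))"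
    and main': "\<And>y. fst (U' (y, 0)) = (\<chi> i. snd (fst (halmos T ((0, y), 0)) $ i))"
    and casc1: "\<And>x y k. k \<in> defect_space T \<Longrightarrow> halmos T ((x, y), k) =
      ((\<chi> i. (fst (U1 (x, k)) $ i, fst (U' (y, snd (U1 (x, k)))) $ i)), snd (U' (y, snd (U1 (x, k)))))"
    by (rule colligation_cascade_split[OF HT DT DTs unitary_between_halmos[OF rc(1)] H0]) blast
  \<comment> \<open>The main operator of \<open>U'\<close> is the compression of the adjoint of T to
    the last two summands, again block lower triangular, so the splitting applies once more.\<close>
  have U'0: "fst (fst (U' ((0, z), 0)) $ i) = 0" for z i
    by (simp add: main' fstH adjN0)
  obtain M2 :: "(('c ^ 'n) \<times> ('a \<times> 'b \<times> 'c)) set" and U2 U3 where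
    M2: "closed_csubspace M2" and U2: "bounded_clinear U2" "\<And>z. norm (U2 z) \<le> norm z"
    and U3: "bounded_clinear U3" "\<And>z. norm (U3 z) \<le> norm z"
    and unit2: "unitary_between (UNIV \<times> M1) (UNIV \<times> M2) U2"
    and unit3: "unitary_between (UNIV \<times> M2) (UNIV \<times> defect_star_space T) U3"
    and main2: "\<And>x. fst (U2 (x, 0)) = (\<chi> i. fst (fst (U' ((x, 0), 0)) $ i))"
    and main3: "\<And>y. fst (U3 (y, 0)) = (\<chi> i. snd (fst (U' ((0, y), 0)) $ i))"
    and casc2: "\<And>x y k. k \<in> M1 \<Longrightarrow> U' ((x, y), k) =
      ((\<chi> i. (fst (U2 (x, k)) $ i, fst (U3 (y, snd (U2 (x, k)))) $ i)), snd (U3 (y, snd (U2 (x, k)))))"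
    by (rule colligation_cascade_split[OF U' M1 DTs unit' U'0]) blast

  \<comment> \<open>Halmos coordinates for the three factors\<close>
  have mS: "fst (U1 (x, 0)) = cadjoint (row_op S) x" for x
    by (simp add: main1 fstH adjS cadjoint_row_op[OF entries(1)])
  have mN: "fst (U2 (y, 0)) = cadjoint (row_op N) y" for y
    by (simp add: main2 main' fstH adjN cadjoint_row_op[OF entries(4)])
  have mC: "fst (U3 (z, 0)) = cadjoint (row_op C) z" for z
    by (simp add: main3 main' fstH adjC cadjoint_row_op[OF entries(6)])
  \<comment> \<open>The three factors have input spaces of three different types.
    \<open>?j1\<close>, \<open>?j2\<close> and \<open>?j3\<close> embed them isometrically into the
    type prescribed for the complements, padding missing coordinates by 0.\<close>
  let ?j1 = "\<lambda>v :: ('a \<times> 'b \<times> 'c) ^ 'n. (0 :: 'a \<times> 'b \<times> 'c, v)"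
  have j1: "bounded_clinear ?j1" "bounded_clinear snd" "snd (?j1 k) = k" "cinner (?j1 k) (?j1 k') = cinner k k'"
    for k k'
    by (auto intro!: bounded_clinear_Pair simp: cinner_Pair)
  obtain E2 :: "(('a \<times> 'b \<times> 'c) \<times> (('a \<times> 'b \<times> 'c) ^ 'n)) set" and \<alpha>1 \<beta>1
    where E2: "closed_csubspace E2"
    and \<alpha>1: "unitary_between (defect_space S \<times> E2) (defect_space T) \<alpha>1"
    and \<beta>1: "unitary_between (defect_star_space S \<times> E2) M1 \<beta>1"
    and eq1: "\<And>x d e. d \<in> defect_space S \<Longrightarrow> e \<in> E2 \<Longrightarrow>
      U1 (x, \<alpha>1 (d, e)) = (fst (halmos S (x, d)), \<beta>1 (snd (halmos S (x, d)), e))"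
    by (rule colligation_halmos_decomposition[OF rc(2) U1(1) DT M1 unit1 mS j1]) blast
  let ?j2 = "\<lambda>p :: (('b \<times> 'c) ^ 'n) \<times> ('a \<times> 'b \<times> 'c). (snd p, \<chi> i. (0 :: 'a, fst p $ i))"
  let ?j2' = "\<lambda>p :: ('a \<times> 'b \<times> 'c) \<times> (('a \<times> 'b \<times> 'c) ^ 'n). ((\<chi> i. snd (snd p $ i)), fst p)"
  have j2: "bounded_clinear ?j2" "bounded_clinear ?j2'"
    by (intro bounded_clinear_Pair bounded_clinear_vec_lambda bounded_clinear_snd' bounded_clinear_fst'
        bounded_clinear_vec_nth' bounded_clinear_id bounded_clinear_zero)+
  have j2i: "?j2' (?j2 k) = k" "cinner (?j2 k) (?j2 k') = cinner k k'" for k k'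
    by (auto simp: cinner_prod_def cinner_vec_def)
  obtain E :: "(('a \<times> 'b \<times> 'c) \<times> (('a \<times> 'b \<times> 'c) ^ 'n)) set" and \<alpha>2 \<beta>2
    where E: "closed_csubspace E"
    and \<alpha>2: "unitary_between (defect_space N \<times> E) M1 \<alpha>2"
    and \<beta>2: "unitary_between (defect_star_space N \<times> E) M2 \<beta>2"
    and eq2: "\<And>x d e. d \<in> defect_space N \<Longrightarrow> e \<in> E \<Longrightarrow>
      U2 (x, \<alpha>2 (d, e)) = (fst (halmos N (x, d)), \<beta>2 (snd (halmos N (x, d)), e))"
    by (rule colligation_halmos_decomposition[OF rc(3) U2(1) M1 M2 unit2 mN j2 j2i]) blast
  let ?j3 = "\<lambda>p :: ('c ^ 'n) \<times> ('a \<times> 'b \<times> 'c). (snd p, \<chi> i. (0 :: 'a, 0 :: 'b, fst p $ i))"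
  let ?j3' = "\<lambda>p :: ('a \<times> 'b \<times> 'c) \<times> (('a \<times> 'b \<times> 'c) ^ 'n). ((\<chi> i. snd (snd (snd p $ i))), fst p)"
  have j3: "bounded_clinear ?j3" "bounded_clinear ?j3'"
    by (intro bounded_clinear_Pair bounded_clinear_vec_lambda bounded_clinear_snd' bounded_clinear_fst'
        bounded_clinear_vec_nth' bounded_clinear_id bounded_clinear_zero)+
  have j3i: "?j3' (?j3 k) = k" "cinner (?j3 k) (?j3 k') = cinner k k'" for k k'
    by (auto simp: cinner_prod_def cinner_vec_def)
  obtain E1 :: "(('a \<times> 'b \<times> 'c) \<times> (('a \<times> 'b \<times> 'c) ^ 'n)) set" and \<alpha>3 \<beta>3
    where E1: "closed_csubspace E1"
    and \<alpha>3: "unitary_between (defect_space C \<times> E1) M2 \<alpha>3"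
    and \<beta>3: "unitary_between (defect_star_space C \<times> E1) (defect_star_space T) \<beta>3"
    and eq3: "\<And>x d e. d \<in> defect_space C \<Longrightarrow> e \<in> E1 \<Longrightarrow>
      U3 (x, \<alpha>3 (d, e)) = (fst (halmos C (x, d)), \<beta>3 (snd (halmos C (x, d)), e))"
    by (rule colligation_halmos_decomposition[OF rc(4) U3(1) M2 DTs unit3 mC j3 j3i]) blast

  \<comment> \<open>Inverse coordinates and connecting unitaries\<close>
  note D = closed_csubspace_defect_space closed_csubspace_defect_star_space
  note cS = closed_csubspace_Times[OF D(1)[OF rc(2)] E2] and cSs = closed_csubspace_Times[OF D(2)[OF rc(2)] E2]
    and cN = closed_csubspace_Times[OF D(1)[OF rc(3)] E] and cNs = closed_csubspace_Times[OF D(2)[OF rc(3)] E]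
    and cC = closed_csubspace_Times[OF D(1)[OF rc(4)] E1] and cCs = closed_csubspace_Times[OF D(2)[OF rc(4)] E1]
  obtain W where W: "unitary_between (defect_space T) (defect_space S \<times> E2) W"
    and W\<alpha>: "\<And>y. y \<in> defect_space T \<Longrightarrow> \<alpha>1 (W y) = y"
    by (rule unitary_between_inverse[OF cS \<alpha>1]) blast
  obtain V2 where V2: "unitary_between M1 (defect_space N \<times> E) V2" and \<alpha>V2: "\<And>y. y \<in> M1 \<Longrightarrow> \<alpha>2 (V2 y) = y"
    by (rule unitary_between_inverse[OF cN \<alpha>2]) blast
  obtain V3 where V3: "unitary_between M2 (defect_space C \<times> E1) V3" and \<alpha>V3: "\<And>y. y \<in> M2 \<Longrightarrow> \<alpha>3 (V3 y) = y"
    by (rule unitary_between_inverse[OF cC \<alpha>3]) blast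
  obtain Ws where Ws: "unitary_between (defect_star_space T) (defect_star_space C \<times> E1) Ws"
    and Ws\<beta>: "\<And>x. x \<in> defect_star_space C \<times> E1 \<Longrightarrow> Ws (\<beta>3 x) = x"
    by (rule unitary_between_inverse[OF cCs \<beta>3]) blast
  \<comment> \<open>\<open>M2\<close> has output coordinates \<beta>2 from the middle factor and
    input coordinates \<alpha>3 for the last one; \<tau>1 passes from the former to the latter.
    Likewise \<tau>2 compares \<beta>1 and \<alpha>2 on \<open>M1\<close>.\<close>
  define \<tau>1 where "\<tau>1 x = V3 (\<beta>2 x)" for x
  define \<tau>2 where "\<tau>2 x = V2 (\<beta>1 x)" for x
  have \<tau>1: "unitary_between (defect_star_space N \<times> E) (defect_space C \<times> E1) \<tau>1"
    unfolding \<tau>1_def by (rule unitary_between_compose[OF \<beta>2 V3])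
  have \<tau>2: "unitary_between (defect_star_space S \<times> E2) (defect_space N \<times> E) \<tau>2"
    unfolding \<tau>2_def by (rule unitary_between_compose[OF \<beta>1 V2])
  note UD = unitary_betweenD
  note NJ = closed_csubspace_N_space[of J]
  let ?M = "block_diag (constrained_char_fun J C) id \<circ> (id \<otimes>\<^sub>o \<tau>1) \<circ>
    block_diag (constrained_char_fun J N) id \<circ> (id \<otimes>\<^sub>o \<tau>2) \<circ> block_diag (constrained_char_fun J S) id"
  let ?Q = "tensor_proj (N_space J)"
  have tensor_id_cancel: "(id \<otimes>\<^sub>o A) ((id \<otimes>\<^sub>o B) G) = G"
    if "bounded_clinear A" "bounded_clinear B" "\<And>x. x \<in> K \<Longrightarrow> A (B x) = x" "G \<in> N_space J \<otimes>\<^sub>s K" "closed_csubspace K"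
    for A :: "'y::chilbert_space \<Rightarrow> 'x::chilbert_space" and B G K
    using that by (intro ell2_eqI) (simp add: ell2_nth_tensor_id tensor_space_eq[OF NJ])
  have DTin: "ell2_nth F w \<in> defect_space T" if "F \<in> N_space J \<otimes>\<^sub>s defect_space T" for F w
    using that by (simp add: tensor_space_eq[OF NJ DT])
  have compressed: "?Q (transfer_fun V 1 z) = ?Q (transfer_fun V 1 (?Q z))"
    if "bounded_clinear V" "\<And>z. norm (V z) \<le> norm z"
    for V :: "'h::chilbert_space \<times> 'k::chilbert_space \<Rightarrow> ('h ^ 'n) \<times> 'l::chilbert_space" and z
    by (rule tensor_proj_transfer_fun[OF that NJ N_space_create_right[OF Jc]])

  \<comment> \<open>Factorization of the compressed transfer function\<close>
  have factor: "?Q (transfer_fun (halmos T) 1 ((id \<otimes>\<^sub>o \<alpha>1) G)) = (id \<otimes>\<^sub>o \<beta>3) (?M G)"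
    "?M G \<in> N_space J \<otimes>\<^sub>s (defect_star_space C \<times> E1)"
    if G: "G \<in> N_space J \<otimes>\<^sub>s (defect_space S \<times> E2)" for G
  proof -
    define F where "F = (id \<otimes>\<^sub>o \<alpha>1) G"
    define G1 where "G1 = block_diag (constrained_char_fun J S) id G"
    define G2 where "G2 = (id \<otimes>\<^sub>o \<tau>2) G1"
    define G3 where "G3 = block_diag (constrained_char_fun J N) id G2"
    define G4 where "G4 = (id \<otimes>\<^sub>o \<tau>1) G3"
    define G5 where "G5 = block_diag (constrained_char_fun J C) id G4"
    have MG: "?M G = G5"
      by (simp add: G1_def G2_def G3_def G4_def G5_def)
    have "F \<in> N_space J \<otimes>\<^sub>s defect_space T"
      unfolding F_def by (rule tensor_id_in_tensor_space[OF NJ UD(1)[OF \<alpha>1] cS DT UD(2)[OF \<alpha>1] G])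
    then have Fin: "ell2_nth F w \<in> defect_space T" for w
      by (rule DTin)
    note B1 = constrained_char_fun_block[OF Jc U1 rc(2) E2 UD(1)[OF \<alpha>1] UD(1)[OF \<beta>1] eq1 G,
        folded F_def G1_def]
    have G1in: "ell2_nth G1 w \<in> defect_star_space S \<times> E2" for w
      using B1(2) by (simp add: tensor_space_eq[OF NJ cSs])
    have G2: "G2 \<in> N_space J \<otimes>\<^sub>s (defect_space N \<times> E)"
      unfolding G2_def by (rule tensor_id_in_tensor_space[OF NJ UD(1)[OF \<tau>2] cSs cN UD(2)[OF \<tau>2] B1(2)])
    have \<alpha>G2: "(id \<otimes>\<^sub>o \<alpha>2) G2 = (id \<otimes>\<^sub>o \<beta>1) G1"
    proof (rule ell2_eqI)
      show "ell2_nth ((id \<otimes>\<^sub>o \<alpha>2) G2) w = ell2_nth ((id \<otimes>\<^sub>o \<beta>1) G1) w" for w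
        using \<alpha>V2[OF UD(2)[OF \<beta>1 G1in[of w]]]
        by (simp add: G2_def ell2_nth_tensor_id UD(1)[OF \<alpha>2] UD(1)[OF \<beta>1] UD(1)[OF \<tau>2]) (simp add: \<tau>2_def)
    qed
    note B2 = constrained_char_fun_block[OF Jc U2 rc(3) E UD(1)[OF \<alpha>2] UD(1)[OF \<beta>2] eq2 G2,
        folded G3_def]
    have G3in: "ell2_nth G3 w \<in> defect_star_space N \<times> E" for w
      using B2(2) by (simp add: tensor_space_eq[OF NJ cNs])
    have G4: "G4 \<in> N_space J \<otimes>\<^sub>s (defect_space C \<times> E1)"
      unfolding G4_def by (rule tensor_id_in_tensor_space[OF NJ UD(1)[OF \<tau>1] cNs cC UD(2)[OF \<tau>1] B2(2)])
    have \<alpha>G4: "(id \<otimes>\<^sub>o \<alpha>3) G4 = (id \<otimes>\<^sub>o \<beta>2) G3"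
    proof (rule ell2_eqI)
      show "ell2_nth ((id \<otimes>\<^sub>o \<alpha>3) G4) w = ell2_nth ((id \<otimes>\<^sub>o \<beta>2) G3) w" for w
        using \<alpha>V3[OF UD(2)[OF \<beta>2 G3in[of w]]]
        by (simp add: G4_def ell2_nth_tensor_id UD(1)[OF \<alpha>3] UD(1)[OF \<beta>2] UD(1)[OF \<tau>1]) (simp add: \<tau>1_def)
    qed
    note B3 = constrained_char_fun_block[OF Jc U3 rc(4) E1 UD(1)[OF \<alpha>3] UD(1)[OF \<beta>3] eq3 G4,
        folded G5_def]
    have "transfer_fun (halmos T) 1 F = transfer_fun U' 1 (transfer_fun U1 1 F)"
      by (rule transfer_fun_cascade[OF HT U1 U' casc1 Fin])
    also have "\<dots> = transfer_fun U3 1 (transfer_fun U2 1 (transfer_fun U1 1 F))"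
      by (rule transfer_fun_cascade[OF U' U2 U3 casc2 transfer_fun_in[OF U1 UD(2)[OF unit1] Fin]])
    \<comment> \<open>The projection is inserted in front of each later factor, first outside
      \<open>U2\<close> and then outside \<open>U1\<close>.\<close>
    finally have "?Q (transfer_fun (halmos T) 1 F)
        = ?Q (transfer_fun U3 1 (?Q (transfer_fun U2 1 (?Q (transfer_fun U1 1 F)))))"
      using compressed[OF U3, of "transfer_fun U2 1 (transfer_fun U1 1 F)"]
        compressed[OF U2, of "transfer_fun U1 1 F"] by simp
    also have "\<dots> = (id \<otimes>\<^sub>o \<beta>3) G5"
      by (simp only: B1(1) \<alpha>G2[symmetric] B2(1) \<alpha>G4[symmetric] B3(1))
    finally show "?Q (transfer_fun (halmos T) 1 ((id \<otimes>\<^sub>o \<alpha>1) G)) = (id \<otimes>\<^sub>o \<beta>3) (?M G)"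
      unfolding MG F_def .
    show "?M G \<in> N_space J \<otimes>\<^sub>s (defect_star_space C \<times> E1)"
      unfolding MG by (rule B3(2))
  qed

  \<comment> \<open>Coincidence of the two operators\<close>
  have sub: "csubspace (N_space J \<otimes>\<^sub>s K)" for K :: "'x::chilbert_space set"
    by (rule closed_csubspace_tensor_space[unfolded closed_csubspace_def, THEN conjunct1])
  note bQ = bounded_clinear_compose[OF bounded_clinear_ortho_proj[OF closed_csubspace_tensor_space]
      bounded_clinear_transfer_fun[OF HT zero_le_one order_refl]]
  have "coincide (N_space J) (defect_space T) (defect_star_space T) (constrained_char_fun J T)
      (defect_space S \<times> E2) (defect_star_space C \<times> E1) ?M"
    unfolding coincide_def
  proof (intro conjI exI ballI)
    show "bounded_operator_between (N_space J \<otimes>\<^sub>s defect_space T) (N_space J \<otimes>\<^sub>s defect_star_space T)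
        (constrained_char_fun J T)"
    proof (rule bounded_operator_betweenI[OF bQ sub])
      fix F assume "F \<in> N_space J \<otimes>\<^sub>s defect_space T"
      note F = DTin[OF this]
      show "constrained_char_fun J T F = ?Q (transfer_fun (halmos T) 1 F)"
        by (rule constrained_char_fun_eq[OF Jc rc(1) F])
      show "?Q (transfer_fun (halmos T) 1 F) \<in> N_space J \<otimes>\<^sub>s defect_star_space T"
        by (rule tensor_proj_in[OF NJ DTs transfer_fun_halmos_in[OF Jc rc(1) F]])
    qed
    show "bounded_operator_between (N_space J \<otimes>\<^sub>s (defect_space S \<times> E2))
        (N_space J \<otimes>\<^sub>s (defect_star_space C \<times> E1)) ?M"
    \<comment> \<open>Linearity and boundedness of the product are read off from the compressed
      transfer function of T, conjugated by \<alpha>1 and \<open>Ws\<close>, with which it agrees on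
      its domain.\<close>
    proof (rule bounded_operator_betweenI[OF bounded_clinear_compose[OF
            bounded_clinear_tensor_id[OF UD(1)[OF Ws]]
            bounded_clinear_compose[OF bQ bounded_clinear_tensor_id[OF UD(1)[OF \<alpha>1]]]] sub])
      fix G assume G: "G \<in> N_space J \<otimes>\<^sub>s (defect_space S \<times> E2)"
      show eq: "?M G = (id \<otimes>\<^sub>o Ws) (?Q (transfer_fun (halmos T) 1 ((id \<otimes>\<^sub>o \<alpha>1) G)))"
        unfolding factor(1)[OF G]
        by (rule tensor_id_cancel[OF UD(1)[OF Ws] UD(1)[OF \<beta>3] Ws\<beta> factor(2)[OF G] cCs, symmetric])
      show "(id \<otimes>\<^sub>o Ws) (?Q (transfer_fun (halmos T) 1 ((id \<otimes>\<^sub>o \<alpha>1) G)))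
          \<in> N_space J \<otimes>\<^sub>s (defect_star_space C \<times> E1)"
        unfolding eq[symmetric] by (rule factor(2)[OF G])
    qed
    fix F assume F: "F \<in> N_space J \<otimes>\<^sub>s defect_space T"
    have G: "(id \<otimes>\<^sub>o W) F \<in> N_space J \<otimes>\<^sub>s (defect_space S \<times> E2)"
      by (rule tensor_id_in_tensor_space[OF NJ UD(1)[OF W] DT cS UD(2)[OF W] F])
    have FG: "(id \<otimes>\<^sub>o \<alpha>1) ((id \<otimes>\<^sub>o W) F) = F"
      by (rule tensor_id_cancel[OF UD(1)[OF \<alpha>1] UD(1)[OF W] W\<alpha> F DT])
    have "(id \<otimes>\<^sub>o Ws) (constrained_char_fun J T F) = (id \<otimes>\<^sub>o Ws) (?Q (transfer_fun (halmos T) 1 F))"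
      by (simp only: constrained_char_fun_eq[OF Jc rc(1) DTin[OF F]])
    also have "\<dots> = (id \<otimes>\<^sub>o Ws) ((id \<otimes>\<^sub>o \<beta>3) (?M ((id \<otimes>\<^sub>o W) F)))"
      using factor(1)[OF G] by (simp only: FG)
    also have "\<dots> = ?M ((id \<otimes>\<^sub>o W) F)"
      by (rule tensor_id_cancel[OF UD(1)[OF Ws] UD(1)[OF \<beta>3] Ws\<beta> factor(2)[OF G] cCs])
    finally show "(id \<otimes>\<^sub>o Ws) (constrained_char_fun J T F) = ?M ((id \<otimes>\<^sub>o W) F)" .
  qed (rule W Ws)+
  with S N C E1 E2 E \<tau>1 \<tau>2 show ?thesis
    by blast
qed

end
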